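(* Let $X_n$, $n\ge 1$, be a standard stationary Gaussian sequence with correlation function $\rho(n)=\mathbb{E}\{X_1X_{n+1}\}$ satisfying $\lim_{n\to\infty}\rho(n)\ln n=0$. Let $S, S_n$, $n\ge1$, be independent non-negative random variables with common distribution function $F$, independent of the $X_n$'s and of a standard normal random variable $X$ (with $S$ independent of $X$), and suppose that there are constants $L,p>0$ and an ultimately monotone function $g$, regularly varying at infinity with some index $\alpha\in\mathbb{R}$, such that $$\mathbb{P}\{S>u\}=(1+o(1))\,g(u)\exp(-Lu^p),\qquad u\to\infty.$$ Set $Y=SX$ and $Y_n=S_nX_n$, and suppose that there exist sequences $u_n(x)$, $n\ge1$, $x\in\mathbb{R}$, such that $\lim_{n\to\infty} n\,\mathbb{P}\{Y>u_n(x)\}=\exp(-x)$ for every $x\in\mathbb{R}$. For positive integers $k$ and $l$, let $M_n^{(k)}$ and $m_n^{(l)}$ denote the $k$th largest and the $l$th smallest of $Y_1,\dots,Y_n$. Then for all $x,y\in\mathbb{R}$ $$\lim_{n\to\infty}\mathbb{P}\left\{M_n^{(k)}\le u_n(x),\ m_n^{(l)}>-u_n(y)\right\}=\exp\left(-\exp(-x)-\exp(-y)\right)\sum_{i=0}^{k-1}\frac{\exp(-ix)}{i!}\sum_{j=0}^{l-1}\frac{\exp(-jy)}{j!}.$$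
   Context: A standard stationary Gaussian sequence is a (jointly) Gaussian sequence $X_n$, $n\ge1$, in which each $X_n$ is $N(0,1)$ distributed and $\rho(n)=\mathbb{E}\{X_1X_{n+1}\}=\mathbb{E}\{X_jX_{n+j}\}$ for all $j\ge1$. A function $g$ is regularly varying at infinity with index $\alpha$ if $\lim_{t\to\infty}g(tx)/g(t)=x^\alpha$ for all $x>0$. *)

theory Defs
  imports "HOL-Probability.Probability" "HOL-Library.Landau_Symbols"
begin

(* Degenerate (point mass) laws count as Gaussian, as needed for linear combinations
   of a Gaussian family with singular covariance matrix. *)
definition gaussian_law :: "real measure \<Rightarrow> bool" where
  "gaussian_law N \<longleftrightarrow>
     (\<exists>\<mu> \<sigma>. \<sigma> > 0 \<and> N = density lborel (normal_density \<mu> \<sigma>)) \<or> (\<exists>\<mu>. N = return borel \<mu>)"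

definition (in prob_space) jointly_gaussian :: "'i set \<Rightarrow> ('i \<Rightarrow> 'a \<Rightarrow> real) \<Rightarrow> bool" where
  "jointly_gaussian I X \<longleftrightarrow>
     (\<forall>i\<in>I. random_variable borel (X i)) \<and>
     (\<forall>J c. finite J \<and> J \<subseteq> I \<longrightarrow> gaussian_law (distr M borel (\<lambda>\<omega>. \<Sum>i\<in>J. c i * X i \<omega>)))"

(* Sequences are indexed by n \<ge> 1; the value at index 0 is never used. *)
definition (in prob_space) correlation_function :: "(nat \<Rightarrow> 'a \<Rightarrow> real) \<Rightarrow> nat \<Rightarrow> real" where
  "correlation_function X n = expectation (\<lambda>\<omega>. X 1 \<omega> * X (n + 1) \<omega>)"

definition (in prob_space) standard_stationary_gaussian :: "(nat \<Rightarrow> 'a \<Rightarrow> real) \<Rightarrow> bool" where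
  "standard_stationary_gaussian X \<longleftrightarrow>
     jointly_gaussian {1..} X \<and>
     (\<forall>n\<ge>1. distributed M lborel (X n) std_normal_density) \<and>
     (\<forall>n\<ge>1. \<forall>j\<ge>1. expectation (\<lambda>\<omega>. X j \<omega> * X (n + j) \<omega>) = correlation_function X n)"

definition regularly_varying :: "(real \<Rightarrow> real) \<Rightarrow> real \<Rightarrow> bool" where
  "regularly_varying g \<alpha> \<longleftrightarrow> (\<forall>x>0. ((\<lambda>t. g (t * x) / g t) \<longlongrightarrow> x powr \<alpha>) at_top)"

definition ultimately_monotone :: "(real \<Rightarrow> real) \<Rightarrow> bool" where
  "ultimately_monotone g \<longleftrightarrow> (\<exists>t. mono_on {t..} g \<or> antimono_on {t..} g)"

(* Order statistics of y 1, ..., y n, counted with multiplicity;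
   meaningful only for 1 \<le> k \<le> n and 1 \<le> l \<le> n, arbitrary otherwise. *)
definition kth_largest :: "nat \<Rightarrow> nat \<Rightarrow> (nat \<Rightarrow> real) \<Rightarrow> real" where
  "kth_largest k n y = rev (sort (map y [1..<Suc n])) ! (k - 1)"

definition lth_smallest :: "nat \<Rightarrow> nat \<Rightarrow> (nat \<Rightarrow> real) \<Rightarrow> real" where
  "lth_smallest l n y = sort (map y [1..<Suc n]) ! (l - 1)"

end

theory Submission
  imports Defs "HOL-Real_Asymp.Real_Asymp"
begin

text \<open>Let \<open>N\<close> and \<open>N'\<close> count the indices \<open>i \<le> n\<close> with \<open>Yn i > u n x\<close> and \<open>Yn i \<le> - u n y\<close>; the event is
  \<open>N < k \<and> N' < l\<close>, so it suffices that \<open>(N, N')\<close> converges to a pair of independent Poisson variables with means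
  \<open>exp (- x)\<close> and \<open>exp (- y)\<close>, which follows from convergence of the generating functions \<open>E (s ^ N * t ^ N')\<close>.
  Such a generating function is the expectation of a product of step functions of the \<open>Yn i\<close>.  Conditionally on the
  scales, Berman's comparison inequality (interpolate between the covariance matrix and the identity) bounds its distance to the
  product of expectations by a sum over pairs of terms \<open>\<bar>\<rho>\<bar> exp (- (w / s i)\<^sup>2 / (2 (1 + \<bar>\<rho>\<bar>))) exp (- (w / s j)\<^sup>2 / (2 (1 + \<bar>\<rho>\<bar>)))\<close>.
  The interpolation formula is an identity between finite sums of exponentials when the test functions are
  trigonometric polynomials, and passes to step functions by approximation.  After integrating out the scales, Mills'
  ratio bounds each exponential factor by \<open>P (Y > w)\<close> up to powers of \<open>ln n\<close>, so the sum vanishes because \<open>\<rho>(n) ln n \<rightarrow> 0\<close>.\<close>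

section \<open>Trigonometric polynomials\<close>

text \<open>The covariance matrix may be singular, so joint densities cannot be relied on;
  characteristic functions always exist and depend on the covariance through an explicit
  exponential. Densities appear only for pairs, where nondegeneracy can be derived from
  \<open>\<rho> \<rightarrow> 0\<close>. Passing to steps works because the comparison bound sees a
  derivative only through its integral against a Gaussian weight, and a smoothed jump keeps integral
  one however steep it is. The obstacle in the final sum is that the correction of the exponent
  costs a factor \<open>exp (4 * \<bar>\<rho>\<bar> * ln n)\<close>, harmless only where
  \<open>\<bar>\<rho>\<bar> * ln n\<close> is bounded. At short lags there is only a bound
  \<open>R < 1\<close>; since \<open>2 / (1 + R) > 1\<close>, a separate estimate still beats the
  few pairs concerned. At long lags the Mills ratio costs \<open>sqrt (ln n)\<close> per factor,
  hence \<open>ln n\<close> per pair: exactly the rate that the hypothesis on \<open>\<rho>\<close>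
  compensates. The tail assumption on \<open>S\<close> supplies P(S > 0) > 0, which makes the levels
  eventually positive; otherwise the upper and lower exceedance events could overlap.\<close>

definition trig_poly :: "real set \<Rightarrow> (real \<Rightarrow> complex) \<Rightarrow> real \<Rightarrow> complex" where
  "trig_poly T a x = (\<Sum>m\<in>T. a m * cis (m * x))"

definition is_trig_poly :: "(real \<Rightarrow> complex) \<Rightarrow> bool" where
  "is_trig_poly f \<longleftrightarrow> (\<exists>T a. finite T \<and> f = trig_poly T a)"

lemma is_trig_poly_cis: "is_trig_poly (\<lambda>x. c * cis (m * x))"
  unfolding is_trig_poly_def
  by (rule exI[of _ "{m}"], rule exI[of _ "\<lambda>_. c"]) (auto simp: trig_poly_def)

lemma is_trig_poly_const: "is_trig_poly (\<lambda>x. c)"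
  using is_trig_poly_cis[of c 0] by simp

lemma is_trig_poly_add:
  assumes "is_trig_poly f" "is_trig_poly g"
  shows "is_trig_poly (\<lambda>x. f x + g x)"
proof -
  obtain T a where T: "finite T" "f = trig_poly T a"
    using assms(1) by (auto simp: is_trig_poly_def)
  obtain T' a' where T': "finite T'" "g = trig_poly T' a'"
    using assms(2) by (auto simp: is_trig_poly_def)
  have *: "trig_poly S b x = trig_poly (S \<union> S') (\<lambda>m. if m \<in> S then b m else 0) x"
    if "finite S" "finite S'" for S S' b x
    unfolding trig_poly_def using that by (intro sum.mono_neutral_cong_left) auto
  have "(\<lambda>x. f x + g x) =
    trig_poly (T \<union> T') (\<lambda>m. (if m \<in> T then a m else 0) + (if m \<in> T' then a' m else 0))"
    unfolding T(2) T'(2) *[OF T(1) T'(1)] *[OF T'(1) T(1)] Un_commute[of T']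
    by (auto simp: trig_poly_def sum.distrib ring_distribs)
  then show ?thesis
    using T(1) T'(1) unfolding is_trig_poly_def by blast
qed

lemma is_trig_poly_sum:
  assumes "\<And>i. i \<in> A \<Longrightarrow> is_trig_poly (f i)"
  shows "is_trig_poly (\<lambda>x. \<Sum>i\<in>A. f i x)"
  using assms
  by (induction A rule: infinite_finite_induct) (auto intro: is_trig_poly_const is_trig_poly_add)

lemma is_trig_poly_mult:
  assumes "is_trig_poly f" "is_trig_poly g"
  shows "is_trig_poly (\<lambda>x. f x * g x)"
proof -
  obtain T a where T: "f = trig_poly T a"
    using assms(1) by (auto simp: is_trig_poly_def)
  obtain T' a' where T': "g = trig_poly T' a'"
    using assms(2) by (auto simp: is_trig_poly_def)
  have "(\<lambda>x. f x * g x) = (\<lambda>x. \<Sum>m\<in>T. \<Sum>m'\<in>T'. a m * a' m' * cis ((m + m') * x))"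
    unfolding T T' trig_poly_def sum_product
    by (intro ext sum.cong refl) (simp add: cis_mult ring_distribs)
  then show ?thesis
    by (simp only:) (intro is_trig_poly_sum is_trig_poly_cis)
qed

lemma is_trig_poly_power: "is_trig_poly f \<Longrightarrow> is_trig_poly (\<lambda>x. f x ^ n)"
  by (induction n) (auto intro: is_trig_poly_const is_trig_poly_mult)

lemma is_trig_poly_sin: "is_trig_poly (\<lambda>x. complex_of_real (sin (x / \<tau>)))"
proof -
  have "complex_of_real (sin y) = (- \<i> / 2) * cis y + (\<i> / 2) * cis (- y)" for y
    by (simp add: complex_eq_iff)
  then have "(\<lambda>x. complex_of_real (sin (x / \<tau>))) =
      (\<lambda>x. (- \<i> / 2) * cis (inverse \<tau> * x) + (\<i> / 2) * cis ((- inverse \<tau>) * x))"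
    by (simp add: field_simps fun_eq_iff)
  then show ?thesis
    by (simp only:) (intro is_trig_poly_add is_trig_poly_cis)
qed

text \<open>For \<open>\<tau> > 0\<close>, \<open>\<tau> * sin (x / \<tau>)\<close> is a periodic
  stand-in for \<open>x\<close> with values in [-\<tau>, \<tau>]. A polynomial that is a good
  approximation on that interval thus becomes a trigonometric polynomial controlled on the whole
  line, and the stand-in tends to \<open>x\<close> as \<open>\<tau>\<close> grows.\<close>

lemma is_trig_poly_real_polynomial_function:
  assumes "real_polynomial_function p"
  shows "is_trig_poly (\<lambda>x. complex_of_real (p (\<tau> * sin (x / \<tau>))))"
proof -
  obtain a n where p: "p = (\<lambda>x. \<Sum>i\<le>n. a i * x^i)"
    using assms real_polynomial_function_iff_sum by auto
  show ?thesis
    unfolding p of_real_sum of_real_mult of_real_power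
    by (intro is_trig_poly_sum is_trig_poly_mult is_trig_poly_power is_trig_poly_const is_trig_poly_sin)
qed

lemma has_vector_derivative_trig_poly:
  "(trig_poly T a has_vector_derivative trig_poly T (\<lambda>m. \<i> * m * a m) x) (at x)"
proof -
  have c: "((\<lambda>x. cis (m * x)) has_vector_derivative (\<i> * m * cis (m * x))) (at x)" for m x
  proof -
    have "((\<lambda>x. m * x) has_real_derivative m) (at x)"
      by (auto intro!: derivative_eq_intros)
    moreover have "(cis has_vector_derivative (\<i> * cis (m * x))) (at (m * x))"
      unfolding cis_conv_exp by (rule has_vector_derivative_iexp)
    ultimately have "(cis \<circ> (\<lambda>x. m * x) has_vector_derivative m *\<^sub>R (\<i> * cis (m * x))) (at x)"
      by (intro vector_diff_chain_at) (auto simp: has_real_derivative_iff_has_vector_derivative)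
    then show ?thesis by (simp add: o_def scaleR_conv_of_real mult_ac)
  qed
  show ?thesis
    unfolding trig_poly_def
    by (rule derivative_eq_intros c refl has_vector_derivative_sum has_vector_derivative_mult_right)+
      (auto simp: mult_ac)
qed

text \<open>The coefficients of an approximant obtained by composing a polynomial with a sine are
  only known to exist. Uniqueness of derivatives gives those of its derivative without computing
  them.\<close>

lemma trig_poly_deriv_unique:
  assumes "\<And>x. complex_of_real (f x) = trig_poly T a x"
    and "(f has_real_derivative f') (at x)"
  shows "complex_of_real f' = trig_poly T (\<lambda>m. \<i> * m * a m) x"
proof -
  have "((\<lambda>x. complex_of_real (f x)) has_vector_derivative complex_of_real f') (at x)"
    using assms(2) by (simp add: has_real_derivative_iff_has_vector_derivative has_vector_derivative_of_real)
  moreover have "(\<lambda>x. complex_of_real (f x)) = trig_poly T a"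
    using assms(1) by auto
  ultimately show ?thesis
    using has_vector_derivative_trig_poly vector_derivative_unique_at by metis
qed

lemma continuous_trig_poly: "continuous_on A (trig_poly T a)"
  unfolding trig_poly_def cis_conv_exp by (intro continuous_intros)

text \<open>Uniform approximation of a function says nothing about its derivative, so the derivative
  is approximated first and integrated afterwards; \<open>c\<close> makes the values at 0
  agree.\<close>

lemma real_polynomial_function_antiderivative:
  assumes "real_polynomial_function q"
  obtains p where "real_polynomial_function p" "p 0 = c"
    "\<And>x. (p has_real_derivative q x) (at x)"
proof -
  obtain a n where q: "q = (\<lambda>x. \<Sum>i\<le>n. a i * x^i)"
    using assms real_polynomial_function_iff_sum by auto
  define p where "p = (\<lambda>x. c + (\<Sum>i\<le>n. (a i / (Suc i)) * x ^ Suc i))"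
  show thesis
  proof
    have "real_polynomial_function (\<lambda>x::real. x)"
      by (intro real_polynomial_function.intros(1) bounded_linear_ident)
    then show "real_polynomial_function p"
      unfolding p_def
      by (intro real_polynomial_function.intros real_polynomial_function_sum
          real_polynomial_function_power) auto
    show "p 0 = c" by (simp add: p_def)
    show "(p has_real_derivative q x) (at x)" for x
      unfolding p_def q
      by (rule derivative_eq_intros refl DERIV_power | simp add: mult.commute)+
  qed
qed

lemma sin_rescaled_tendsto:
  "(\<lambda>N. (real N + 1) * sin (x / (real N + 1))) \<longlonglongrightarrow> x"
proof -
  have "((\<lambda>t. t * sin (x / t)) \<longlongrightarrow> x) at_top"
  proof (cases "x = 0")
    case False
    have "(\<lambda>h::real. sin h / h) \<midarrow>0\<rightarrow> 1"
      using DERIV_sin[of 0] by (simp add: DERIV_def)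
    moreover have "filterlim (\<lambda>t. x / t) (at 0) at_top"
      using False unfolding filterlim_at
      by (auto intro!: tendsto_divide_0[OF tendsto_const] filterlim_at_top_imp_at_infinity filterlim_ident
        eventually_mono[OF eventually_gt_at_top[of 0]])
    ultimately have "((\<lambda>t. sin (x / t) / (x / t)) \<longlongrightarrow> 1) at_top"
      by (rule filterlim_compose)
    then have "((\<lambda>t. x * (sin (x / t) / (x / t))) \<longlongrightarrow> x * 1) at_top"
      by (intro tendsto_intros)
    then show ?thesis using False by (simp add: mult.commute)
  qed auto
  moreover have "filterlim (\<lambda>N. real N + 1) at_top sequentially"
    using filterlim_tendsto_add_at_top[OF tendsto_const[of "1::real"] filterlim_real_sequentially]
    by (simp add: add.commute)
  ultimately show ?thesis by (rule filterlim_compose)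
qed

lemma cos_rescaled_tendsto: "(\<lambda>N. cos (x / (real N + 1))) \<longlonglongrightarrow> 1"
proof -
  have "(\<lambda>N. x / (real N + 1)) \<longlonglongrightarrow> 0"
    using tendsto_mult[OF tendsto_const[of x] LIMSEQ_inverse_real_of_nat]
    by (simp add: divide_inverse add.commute)
  then have "(\<lambda>N. cos (x / (real N + 1))) \<longlonglongrightarrow> cos 0"
    by (intro tendsto_intros)
  then show ?thesis by simp
qed

lemma tendsto_of_close:
  fixes g :: "nat \<Rightarrow> real"
  assumes "isCont \<psi> x" "z \<longlonglongrightarrow> x" "\<And>N. \<bar>\<psi> (z N) - g N\<bar> \<le> 1 / (real N + 1)"
  shows "g \<longlonglongrightarrow> \<psi> x"
proof -
  have 1: "(\<lambda>N. \<psi> (z N)) \<longlonglongrightarrow> \<psi> x"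
    by (rule isCont_tendsto_compose[OF assms(1,2)])
  have "(\<lambda>N. 1 / (real N + 1)) \<longlonglongrightarrow> 0"
    using LIMSEQ_inverse_real_of_nat by (simp add: inverse_eq_divide add.commute)
  then have "(\<lambda>N. \<psi> (z N) - g N) \<longlonglongrightarrow> 0"
    by (rule Lim_null_comparison[rotated]) (use assms(3) in auto)
  from tendsto_diff[OF 1 this] show ?thesis by simp
qed

text \<open>Weierstrass approximation on growing intervals, followed by the rescaled sine. Uniform
  convergence on the line is out of reach in general, but pointwise convergence with a common bound
  suffices for dominated convergence.\<close>

lemma continuous_trig_poly_approx:
  fixes \<psi> :: "real \<Rightarrow> real"
  assumes cont: "continuous_on UNIV \<psi>" and bd: "\<And>x. \<bar>\<psi> x\<bar> \<le> B"
  obtains f :: "nat \<Rightarrow> real \<Rightarrow> real"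
  where "\<And>N. is_trig_poly (\<lambda>x. complex_of_real (f N x))"
    "\<And>N x. \<bar>f N x\<bar> \<le> B + 1" "\<And>x. (\<lambda>N. f N x) \<longlonglongrightarrow> \<psi> x"
proof -
  have "\<exists>p. real_polynomial_function p \<and>
      (\<forall>x\<in>{-(real N + 1)..real N + 1}. \<bar>\<psi> x - p x\<bar> < 1 / (real N + 1))" for N
    using Stone_Weierstrass_real_polynomial_function[of "{-(real N + 1)..real N + 1}" \<psi> "1 / (real N + 1)"]
      continuous_on_subset[OF cont] by (metis compact_Icc of_nat_Suc of_nat_0_less_iff zero_less_Suc
        zero_less_divide_1_iff add.commute subset_UNIV)
  then obtain p where p: "\<And>N. real_polynomial_function (p N)"
    "\<And>N x. x \<in> {-(real N + 1)..real N + 1} \<Longrightarrow> \<bar>\<psi> x - p N x\<bar> < 1 / (real N + 1)"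
    by metis
  define z where "z N x = (real N + 1) * sin (x / (real N + 1))" for N x
  have z: "z N x \<in> {-(real N + 1)..real N + 1}" for N x
    using mult_left_mono[OF sin_le_one[of "x / (real N + 1)"], of "real N + 1"]
     mult_left_mono[OF sin_ge_minus_one[of "x / (real N + 1)"], of "real N + 1"]
    by (auto simp: z_def)
  have close: "\<bar>\<psi> (z N x) - p N (z N x)\<bar> \<le> 1 / (real N + 1)" for N x
    using p(2)[OF z] by (simp add: less_imp_le)
  show thesis
  proof
    show "is_trig_poly (\<lambda>x. complex_of_real (p N (z N x)))" for N
      unfolding z_def by (rule is_trig_poly_real_polynomial_function[OF p(1)])
    have "1 / (real N + 1) \<le> 1" for N by simp
    then show "\<bar>p N (z N x)\<bar> \<le> B + 1" for N x
      using close[of N x] bd[of "z N x"] by (smt (verit))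
    show "(\<lambda>N. p N (z N x)) \<longlonglongrightarrow> \<psi> x" for x
      by (rule tendsto_of_close[of _ _ "\<lambda>N. z N x", OF _ _ close])
        (use cont sin_rescaled_tendsto in \<open>auto simp: continuous_on_eq_continuous_at z_def\<close>)
  qed
qed

text \<open>The bound \<open>1 + 1 / (real N + 1)\<close> on the approximants matters: in the
  comparison inequality it is raised to the power \<open>card I\<close> and still has to tend to
  1.\<close>

lemma C1_trig_poly_approx:
  fixes \<phi> \<phi>' :: "real \<Rightarrow> real"
  assumes deriv: "\<And>x. (\<phi> has_real_derivative \<phi>' x) (at x)" and cont: "continuous_on UNIV \<phi>'"
    and bd: "\<And>x. \<bar>\<phi> x\<bar> \<le> 1" and bd': "\<And>x. \<bar>\<phi>' x\<bar> \<le> B"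
  obtains f f' :: "nat \<Rightarrow> real \<Rightarrow> real" and T a where
    "\<And>N. finite (T N)"
    "\<And>N x. complex_of_real (f N x) = trig_poly (T N) (a N) x"
    "\<And>N x. complex_of_real (f' N x) = trig_poly (T N) (\<lambda>m. \<i> * m * a N m) x"
    "\<And>N x. \<bar>f N x\<bar> \<le> 1 + 1 / (real N + 1)" "\<And>N x. \<bar>f' N x\<bar> \<le> B + 1"
    "\<And>x. (\<lambda>N. f N x) \<longlonglongrightarrow> \<phi> x" "\<And>x. (\<lambda>N. f' N x) \<longlonglongrightarrow> \<phi>' x"
proof -
  \<comment> \<open>The square compensates the integration over an interval of half-length
    \<open>real N + 1\<close>, which leaves an error \<open>1 / (real N + 1)\<close> for the
    antiderivative.\<close>
  have "\<exists>q. real_polynomial_function q \<and>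
      (\<forall>x\<in>{-(real N + 1)..real N + 1}. \<bar>\<phi>' x - q x\<bar> < 1 / (real N + 1)\<^sup>2)" for N
  proof -
    have "0 < 1 / (real N + 1)\<^sup>2"
      by (metis add.commute of_nat_0_less_iff of_nat_Suc zero_less_Suc zero_less_divide_1_iff zero_less_power)
    from Stone_Weierstrass_real_polynomial_function[of "{-(real N + 1)..real N + 1}" \<phi>', OF _ _ this]
    show ?thesis
      using continuous_on_subset[OF cont] by (metis compact_Icc subset_UNIV)
  qed
  then obtain q where q: "\<And>N. real_polynomial_function (q N)"
    "\<And>N x. x \<in> {-(real N + 1)..real N + 1} \<Longrightarrow> \<bar>\<phi>' x - q N x\<bar> < 1 / (real N + 1)\<^sup>2"
    by metis
  have "\<exists>p. real_polynomial_function p \<and> p 0 = \<phi> 0 \<and> (\<forall>x. (p has_real_derivative q N x) (at x))" for N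
    using real_polynomial_function_antiderivative[OF q(1)[of N]] by metis
  then obtain p where p: "\<And>N. real_polynomial_function (p N)" "\<And>N. p N 0 = \<phi> 0"
    "\<And>N x. (p N has_real_derivative q N x) (at x)" by metis
  have pc: "\<bar>\<phi> x - p N x\<bar> \<le> 1 / (real N + 1)" if x: "x \<in> {-(real N + 1)..real N + 1}" for N x
  proof -
    have "norm ((\<phi> x - p N x) - (\<phi> 0 - p N 0)) \<le> (1 / (real N + 1)\<^sup>2) * norm (x - 0)"
    proof (rule field_differentiable_bound[where S = "{-(real N + 1)..real N + 1}" and f' = "\<lambda>x. \<phi>' x - q N x"])
      show "((\<lambda>x. \<phi> x - p N x) has_field_derivative \<phi>' z - q N z) (at z within {-(real N + 1)..real N + 1})" for z
        using DERIV_diff[OF deriv p(3)] has_field_derivative_at_within by blast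
      show "norm (\<phi>' z - q N z) \<le> 1 / (real N + 1)\<^sup>2" if "z \<in> {-(real N + 1)..real N + 1}" for z
        using q(2)[OF that] by simp
    qed (use x in auto)
    also have "\<dots> \<le> (1 / (real N + 1)\<^sup>2) * (real N + 1)"
      using x by (intro mult_left_mono) auto
    also have "\<dots> = 1 / (real N + 1)"
      by (simp add: power2_eq_square)
    finally show ?thesis by (simp add: p(2))
  qed
  have le1: "1 / (real N + 1)\<^sup>2 \<le> 1 / (real N + 1)" for N
    by (intro divide_left_mono) (auto simp: power2_eq_square)
  have le2: "1 / (real N + 1) \<le> 1" for N by simp
  define z where "z N x = (real N + 1) * sin (x / (real N + 1))" for N x
  have z: "z N x \<in> {-(real N + 1)..real N + 1}" for N x
    using mult_left_mono[OF sin_le_one[of "x / (real N + 1)"], of "real N + 1"]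
     mult_left_mono[OF sin_ge_minus_one[of "x / (real N + 1)"], of "real N + 1"]
    by (auto simp: z_def)
  have dz: "(z N has_real_derivative cos (x / (real N + 1))) (at x)" for N x
    unfolding z_def by (rule derivative_eq_intros refl | simp)+
  define f where "f N x = p N (z N x)" for N x
  \<comment> \<open>The cosine is the derivative of \<open>z N\<close>; it has modulus at most 1 and
    tends to 1, so it harms neither the bound nor the limit.\<close>
  define f' where "f' N x = q N (z N x) * cos (x / (real N + 1))" for N x
  have close: "\<bar>\<phi> (z N x) - f N x\<bar> \<le> 1 / (real N + 1)" for N x
    unfolding f_def by (rule pc[OF z])
  have close': "\<bar>\<phi>' (z N x) - q N (z N x)\<bar> \<le> 1 / (real N + 1)" for N x
    using q(2)[OF z, of N x] le1[of N] by linarith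
  have "\<exists>T a. finite T \<and> (\<lambda>x. complex_of_real (f N x)) = trig_poly T a" for N
    using is_trig_poly_real_polynomial_function[OF p(1), of N "real N + 1"]
    unfolding is_trig_poly_def f_def z_def .
  then obtain T a where Ta: "\<And>N. finite (T N)" "\<And>N. (\<lambda>x. complex_of_real (f N x)) = trig_poly (T N) (a N)"
    by metis
  have Ta2: "complex_of_real (f N x) = trig_poly (T N) (a N) x" for N x
    by (rule fun_cong[OF Ta(2)])
  have zc: "(\<lambda>N. z N x) \<longlonglongrightarrow> x" for x
    unfolding z_def by (rule sin_rescaled_tendsto)
  show thesis
  proof
    show "finite (T N)" for N by fact
    show "complex_of_real (f N x) = trig_poly (T N) (a N) x" for N x by (rule Ta2)
    have "(f N has_real_derivative f' N x) (at x)" for N x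
      unfolding f_def f'_def by (rule DERIV_chain2[OF p(3) dz])
    from trig_poly_deriv_unique[OF Ta2 this]
    show "complex_of_real (f' N x) = trig_poly (T N) (\<lambda>m. \<i> * m * a N m) x" for N x .
    show "\<bar>f N x\<bar> \<le> 1 + 1 / (real N + 1)" for N x
      using close[of N x] bd[of "z N x"] by linarith
    have "\<bar>q N (z N x)\<bar> \<le> B + 1" for N x
      using close'[of N x] bd'[of "z N x"] le2[of N] by linarith
    then have "\<bar>q N (z N x)\<bar> * \<bar>cos (x / (real N + 1))\<bar> \<le> (B + 1) * 1" for N x
      by (intro mult_mono abs_cos_le_one) (auto intro: order_trans[OF abs_ge_zero])
    then show "\<bar>f' N x\<bar> \<le> B + 1" for N x
      unfolding f'_def abs_mult by simp
    show "(\<lambda>N. f N x) \<longlonglongrightarrow> \<phi> x" for x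
      by (rule tendsto_of_close[OF DERIV_isCont[OF deriv] zc close])
    have "(\<lambda>N. q N (z N x)) \<longlonglongrightarrow> \<phi>' x" for x
      by (rule tendsto_of_close[OF _ zc close'])
        (use cont in \<open>auto simp: continuous_on_eq_continuous_at\<close>)
    from tendsto_mult[OF this cos_rescaled_tendsto]
    show "(\<lambda>N. f' N x) \<longlonglongrightarrow> \<phi>' x" for x
      unfolding f'_def by simp
  qed
qed

section \<open>Gaussian families\<close>

lemma borel_measurable_cis [measurable]: "cis \<in> borel_measurable borel"
  unfolding cis_conv_exp by (intro borel_measurable_continuous_onI continuous_intros)

lemma integral_cis_std_normal:
  "(LINT x|std_normal_distribution. cis (t * x)) = of_real (exp (- t\<^sup>2 / 2))"
  using fun_cong[OF char_std_normal_distribution, of t]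
  by (simp add: char_def cis_conv_exp mult_ac)

lemma prob_space_std_normal: "prob_space std_normal_distribution"
  using real_dist_normal_dist real_distribution.axioms(1) by blast

lemma measurable_std_normal: "measurable P std_normal_distribution = borel_measurable P"
  by (intro measurable_cong_sets) auto

lemma prod_cis: "(\<Prod>k\<in>A. cis (f k)) = cis (\<Sum>k\<in>A. f k)"
  by (induction A rule: infinite_finite_induct) (auto simp: cis_mult)

abbreviation prod_mean :: "'a measure \<Rightarrow> ('i \<Rightarrow> 'a \<Rightarrow> real) \<Rightarrow> 'i set \<Rightarrow> ('i \<Rightarrow> real \<Rightarrow> real) \<Rightarrow> real" where
  "prod_mean P Z I f \<equiv> LINT \<omega>|P. (\<Prod>k\<in>I. f k (Z k \<omega>))"

abbreviation quad_form :: "'i set \<Rightarrow> ('i \<Rightarrow> 'i \<Rightarrow> real) \<Rightarrow> ('i \<Rightarrow> real) \<Rightarrow> real" where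
  "quad_form I R c \<equiv> \<Sum>i\<in>I. \<Sum>j\<in>I. c i * c j * R i j"

text \<open>The factor that one coordinate contributes to a product bound for the standard bivariate
  normal density when the correlation has modulus at most \<open>\<rho>\<close>.\<close>

abbreviation damp :: "real \<Rightarrow> real \<Rightarrow> real" where
  "damp \<rho> x \<equiv> exp (- x\<^sup>2 / (2 * (1 + \<rho>)))"

text \<open>A centred Gaussian vector with covariance \<open>R\<close>, encoded by its
  characteristic function: singular \<open>R\<close> is included, and the dependence on
  \<open>R\<close> is explicit, ready to be differentiated.\<close>

definition gaussian_family :: "'a measure \<Rightarrow> ('i \<Rightarrow> 'a \<Rightarrow> real) \<Rightarrow> 'i set \<Rightarrow> ('i \<Rightarrow> 'i \<Rightarrow> real) \<Rightarrow> bool" where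
  "gaussian_family P Z I R \<longleftrightarrow> prob_space P \<and> (\<forall>i\<in>I. Z i \<in> borel_measurable P) \<and>
     (\<forall>c. (LINT \<omega>|P. cis (\<Sum>i\<in>I. c i * Z i \<omega>)) =
        of_real (exp (- quad_form I R c / 2)))"

lemma gaussian_family_mono:
  assumes "gaussian_family P Z I R" "J \<subseteq> I" "finite I"
  shows "gaussian_family P Z J R"
  unfolding gaussian_family_def
proof (intro conjI allI)
  fix c :: "'b \<Rightarrow> real"
  define d where "d i = (if i \<in> J then c i else 0)" for i
  have "(\<Sum>i\<in>J. c i * Z i \<omega>) = (\<Sum>i\<in>I. d i * Z i \<omega>)" for \<omega>
    using assms(2,3) by (intro sum.mono_neutral_cong_left) (auto simp: d_def)
  moreover have "(\<Sum>i\<in>J. \<Sum>j\<in>J. c i * c j * R i j) = (\<Sum>i\<in>I. \<Sum>j\<in>I. d i * d j * R i j)"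
    using assms(2,3) by (intro sum.mono_neutral_cong_left) (auto simp: d_def)
  ultimately show "(LINT \<omega>|P. cis (\<Sum>i\<in>J. c i * Z i \<omega>)) =
        of_real (exp (- (\<Sum>i\<in>J. \<Sum>j\<in>J. c i * c j * R i j) / 2))"
    using assms(1) by (simp add: gaussian_family_def)
qed (use assms in \<open>auto simp: gaussian_family_def\<close>)

lemma gaussian_family_cong:
  assumes "\<And>i j. i \<in> I \<Longrightarrow> j \<in> I \<Longrightarrow> R i j = R' i j"
  shows "gaussian_family P Z I R \<longleftrightarrow> gaussian_family P Z I R'"
  using assms by (simp add: gaussian_family_def)

text \<open>Expanding the product leaves one exponential for each choice \<open>c\<close> of a
  frequency at every index, and its mean is the characteristic function at \<open>c\<close>.\<close>

lemma gaussian_family_integral_trig_poly: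
  assumes gf: "gaussian_family P Z I R" and I: "finite I" and T: "\<And>k. k \<in> I \<Longrightarrow> finite (T k)"
  shows "(LINT \<omega>|P. (\<Prod>k\<in>I. trig_poly (T k) (b k) (Z k \<omega>))) =
    (\<Sum>c\<in>PiE I T. (\<Prod>k\<in>I. b k (c k)) * of_real (exp (- quad_form I R c / 2)))"
proof -
  interpret prob_space P using gf by (simp add: gaussian_family_def)
  have [measurable]: "Z i \<in> borel_measurable P" if "i \<in> I" for i
    using gf that by (simp add: gaussian_family_def)
  have int: "integrable P (\<lambda>\<omega>. cis (\<Sum>i\<in>I. c i * Z i \<omega>))" for c
    by (intro integrable_const_bound[of _ 1]) auto
  have "(\<Prod>k\<in>I. trig_poly (T k) (b k) (Z k \<omega>)) =
      (\<Sum>c\<in>PiE I T. (\<Prod>k\<in>I. b k (c k)) * cis (\<Sum>i\<in>I. c i * Z i \<omega>))" for \<omega>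
    unfolding trig_poly_def using I T
    by (simp add: prod_sum_PiE prod.distrib prod_cis)
  then have "(LINT \<omega>|P. (\<Prod>k\<in>I. trig_poly (T k) (b k) (Z k \<omega>))) =
      (\<Sum>c\<in>PiE I T. (\<Prod>k\<in>I. b k (c k)) * (LINT \<omega>|P. cis (\<Sum>i\<in>I. c i * Z i \<omega>)))"
    using int by (simp add: Bochner_Integration.integral_sum)
  then show ?thesis
    using gf by (simp add: gaussian_family_def)
qed

lemma gaussian_family_PiM:
  assumes I: "finite I"
  shows "gaussian_family (Pi\<^sub>M I (\<lambda>_. std_normal_distribution)) (\<lambda>i \<omega>. \<omega> i) I (\<lambda>i j. if i = j then 1 else 0)"
  unfolding gaussian_family_def
proof (intro conjI allI ballI)
  interpret N: prob_space std_normal_distribution by (rule prob_space_std_normal)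
  interpret P: product_prob_space "\<lambda>_. std_normal_distribution" I by unfold_locales
  show "prob_space (Pi\<^sub>M I (\<lambda>_. std_normal_distribution))" by (rule P.prob_space_axioms)
  show "(\<lambda>\<omega>. \<omega> i) \<in> borel_measurable (Pi\<^sub>M I (\<lambda>_. std_normal_distribution))" if "i \<in> I" for i
    using measurable_component_singleton[OF that, of "\<lambda>_. std_normal_distribution"]
    by (simp add: measurable_std_normal)
  fix c :: "'a \<Rightarrow> real"
  have "(LINT \<omega>|(Pi\<^sub>M I (\<lambda>_. std_normal_distribution)). cis (\<Sum>i\<in>I. c i * \<omega> i)) =
      (LINT \<omega>|(Pi\<^sub>M I (\<lambda>_. std_normal_distribution)). (\<Prod>i\<in>I. cis (c i * \<omega> i)))"
    by (simp add: prod_cis)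
  also have "\<dots> = (\<Prod>i\<in>I. LINT x|std_normal_distribution. cis (c i * x))"
    by (intro P.product_integral_prod I N.integrable_const_bound[of _ 1]) auto
  also have "\<dots> = of_real (exp (\<Sum>i\<in>I. - (c i)\<^sup>2 / 2))"
    using I by (simp add: integral_cis_std_normal exp_sum)
  also have "(\<Sum>i\<in>I. - (c i)\<^sup>2 / 2) = - (\<Sum>i\<in>I. \<Sum>j\<in>I. c i * c j * (if i = j then 1 else 0)) / 2"
    using I by (simp add: if_distrib[of "\<lambda>x. _ * x"] power2_eq_square sum_negf sum_divide_distrib cong: if_cong)
  finally show "(LINT \<omega>|(Pi\<^sub>M I (\<lambda>_. std_normal_distribution)). cis (\<Sum>i\<in>I. c i * \<omega> i)) =
    of_real (exp (- (\<Sum>i\<in>I. \<Sum>j\<in>I. c i * c j * (if i = j then 1 else 0)) / 2))" .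
qed

lemma integral_pair_mult:
  fixes f :: "'a \<Rightarrow> 'c::{real_normed_field, banach, second_countable_topology}"
  assumes "prob_space P" "prob_space Q" "f \<in> borel_measurable P" "g \<in> borel_measurable Q"
    and bf: "\<And>x. norm (f x) \<le> B" and bg: "\<And>x. norm (g x) \<le> C"
  shows "(LINT \<omega>|(P \<Otimes>\<^sub>M Q). f (fst \<omega>) * g (snd \<omega>)) = (LINT x|P. f x) * (LINT y|Q. g y)"
proof -
  interpret P: prob_space P by fact
  interpret Q: prob_space Q by fact
  interpret PQ: pair_prob_space P Q ..
  note [measurable] = assms(3,4)
  have "integrable (P \<Otimes>\<^sub>M Q) (\<lambda>\<omega>. f (fst \<omega>) * g (snd \<omega>))"
    using bf bg by (intro PQ.integrable_const_bound[of _ "B * C"])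
      (auto simp: norm_mult intro!: mult_mono intro: order_trans[OF norm_ge_zero])
  from PQ.integral_fst'[OF this] show ?thesis by simp
qed

text \<open>With \<open>s = sqrt h\<close> and \<open>t = sqrt (1 - h)\<close> this realises the
  interpolated covariance on a product space, which replaces an argument that the interpolated
  matrix is positive semidefinite.\<close>

lemma gaussian_family_pair:
  assumes "gaussian_family P X I R" "gaussian_family Q Y I R'"
  shows "gaussian_family (P \<Otimes>\<^sub>M Q) (\<lambda>i \<omega>. s * X i (fst \<omega>) + t * Y i (snd \<omega>)) I
    (\<lambda>i j. s\<^sup>2 * R i j + t\<^sup>2 * R' i j)"
  unfolding gaussian_family_def
proof (intro conjI allI ballI)
  interpret P: prob_space P using assms by (simp add: gaussian_family_def)
  interpret Q: prob_space Q using assms by (simp add: gaussian_family_def)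
  interpret PQ: pair_prob_space P Q ..
  show "prob_space (P \<Otimes>\<^sub>M Q)" by unfold_locales
  have [measurable]: "X i \<in> borel_measurable P" "Y i \<in> borel_measurable Q" if "i \<in> I" for i
    using assms that by (auto simp: gaussian_family_def)
  show "(\<lambda>\<omega>. s * X i (fst \<omega>) + t * Y i (snd \<omega>)) \<in> borel_measurable (P \<Otimes>\<^sub>M Q)" if "i \<in> I" for i
    using that by measurable
  fix c :: "'b \<Rightarrow> real"
  have "(LINT \<omega>|(P \<Otimes>\<^sub>M Q). cis (\<Sum>i\<in>I. c i * (s * X i (fst \<omega>) + t * Y i (snd \<omega>)))) =
     (LINT \<omega>|(P \<Otimes>\<^sub>M Q). cis (\<Sum>i\<in>I. (c i * s) * X i (fst \<omega>)) * cis (\<Sum>i\<in>I. (c i * t) * Y i (snd \<omega>)))"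
    by (simp add: cis_mult sum.distrib ring_distribs mult.assoc)
  also have "\<dots> = (LINT \<omega>|P. cis (\<Sum>i\<in>I. (c i * s) * X i \<omega>)) * (LINT \<omega>|Q. cis (\<Sum>i\<in>I. (c i * t) * Y i \<omega>))"
    by (rule integral_pair_mult[OF P.prob_space_axioms Q.prob_space_axioms]) auto
  also have "\<dots> = of_real (exp (- (\<Sum>i\<in>I. \<Sum>j\<in>I. (c i * s) * (c j * s) * R i j) / 2)
      * exp (- (\<Sum>i\<in>I. \<Sum>j\<in>I. (c i * t) * (c j * t) * R' i j) / 2))"
    using assms by (simp add: gaussian_family_def)
  also have "exp (- (\<Sum>i\<in>I. \<Sum>j\<in>I. (c i * s) * (c j * s) * R i j) / 2)
      * exp (- (\<Sum>i\<in>I. \<Sum>j\<in>I. (c i * t) * (c j * t) * R' i j) / 2) =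
     exp (- (\<Sum>i\<in>I. \<Sum>j\<in>I. c i * c j * (s\<^sup>2 * R i j + t\<^sup>2 * R' i j)) / 2)"
    unfolding exp_add[symmetric]
    by (rule arg_cong[of _ _ exp])
      (simp add: ring_distribs power2_eq_square sum.distrib mult_ac add_divide_distrib diff_divide_distrib)
  finally show "(LINT \<omega>|(P \<Otimes>\<^sub>M Q). cis (\<Sum>i\<in>I. c i * (s * X i (fst \<omega>) + t * Y i (snd \<omega>)))) =
     of_real (exp (- (\<Sum>i\<in>I. \<Sum>j\<in>I. c i * c j * (s\<^sup>2 * R i j + t\<^sup>2 * R' i j)) / 2))" .
qed

text \<open>An explicit model of a correlated pair, built from two independent standard normals, on
  which integrals can be computed by densities.\<close>

lemma gaussian_family_two:
  assumes "i \<noteq> j" "\<bar>r\<bar> \<le> 1" "R i i = 1" "R j j = 1" "R i j = r" "R j i = r"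
  shows "gaussian_family (std_normal_distribution \<Otimes>\<^sub>M std_normal_distribution)
    (\<lambda>k \<omega>. if k = i then fst \<omega> else r * fst \<omega> + sqrt (1 - r\<^sup>2) * snd \<omega>) {i, j} R"
  unfolding gaussian_family_def
proof (intro conjI allI ballI)
  let ?N = std_normal_distribution
  let ?Z = "\<lambda>k \<omega>. if k = i then fst \<omega> else r * fst \<omega> + sqrt (1 - r\<^sup>2) * snd \<omega>"
  interpret N: prob_space ?N by (rule prob_space_std_normal)
  interpret PQ: pair_prob_space ?N ?N ..
  show "prob_space (?N \<Otimes>\<^sub>M ?N)" by unfold_locales
  have [measurable]: "fst \<in> borel_measurable (?N \<Otimes>\<^sub>M ?N)" "snd \<in> borel_measurable (?N \<Otimes>\<^sub>M ?N)"
    using measurable_fst[of ?N ?N] measurable_snd[of ?N ?N]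
    by (simp_all add: measurable_std_normal)
  show "?Z k \<in> borel_measurable (?N \<Otimes>\<^sub>M ?N)" for k by measurable
  fix c :: "'a \<Rightarrow> real"
  have r: "1 - r\<^sup>2 \<ge> 0" using assms(2) by (simp add: abs_square_le_1)
  define s where "s = sqrt (1 - r\<^sup>2)"
  have s: "s\<^sup>2 = 1 - r\<^sup>2" using r by (simp add: s_def)
  have "(LINT \<omega>|(?N \<Otimes>\<^sub>M ?N). cis (\<Sum>k\<in>{i,j}. c k * ?Z k \<omega>)) =
      (LINT \<omega>|(?N \<Otimes>\<^sub>M ?N). cis ((c i + c j * r) * fst \<omega>) * cis ((c j * s) * snd \<omega>))"
    using assms(1) by (simp add: cis_mult ring_distribs s_def mult_ac add_ac)
  also have "\<dots> = (LINT x|?N. cis ((c i + c j * r) * x)) * (LINT x|?N. cis ((c j * s) * x))"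
    by (rule integral_pair_mult[OF N.prob_space_axioms N.prob_space_axioms]) auto
  also have "\<dots> = of_real (exp (- (c i + c j * r)\<^sup>2 / 2) * exp (- (c j * s)\<^sup>2 / 2))"
    by (simp add: integral_cis_std_normal)
  also have "exp (- (c i + c j * r)\<^sup>2 / 2) * exp (- (c j * s)\<^sup>2 / 2) =
     exp (- (\<Sum>k\<in>{i,j}. \<Sum>l\<in>{i,j}. c k * c l * R k l) / 2)"
    unfolding exp_add[symmetric] power_mult_distrib s using assms(1,3-)
    by (intro arg_cong[of _ _ exp]) (simp add: field_simps power2_eq_square)
  finally show "(LINT \<omega>|(?N \<Otimes>\<^sub>M ?N). cis (\<Sum>k\<in>{i,j}. c k * ?Z k \<omega>)) =
     of_real (exp (- (\<Sum>k\<in>{i,j}. \<Sum>l\<in>{i,j}. c k * c l * R k l) / 2))" .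
qed

lemma integral_prod_tendsto:
  fixes f :: "nat \<Rightarrow> 'i \<Rightarrow> real \<Rightarrow> real"
  assumes P: "prob_space P" and Z: "\<And>k. k \<in> I \<Longrightarrow> Z k \<in> borel_measurable P" and I: "finite I"
    and f: "\<And>N k. k \<in> I \<Longrightarrow> f N k \<in> borel_measurable borel"
    and bd: "\<And>N k x. k \<in> I \<Longrightarrow> \<bar>f N k x\<bar> \<le> B"
    and lim: "\<And>k x. k \<in> I \<Longrightarrow> (\<lambda>N. f N k x) \<longlonglongrightarrow> \<psi> k x"
  shows "(\<lambda>N. prod_mean P Z I (f N)) \<longlonglongrightarrow> (prod_mean P Z I \<psi>)"
proof -
  interpret prob_space P by fact
  note [measurable] = Z f
  have \<psi>[measurable]: "\<psi> k \<in> borel_measurable borel" if "k \<in> I" for k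
    by (rule borel_measurable_LIMSEQ_real[OF lim[OF that] f[OF that]])
  show ?thesis
  proof (rule integral_dominated_convergence[where w = "\<lambda>_. B ^ card I"])
    show "AE \<omega> in P. (\<lambda>N. \<Prod>k\<in>I. f N k (Z k \<omega>)) \<longlonglongrightarrow> (\<Prod>k\<in>I. \<psi> k (Z k \<omega>))"
      using lim by (intro AE_I2 tendsto_prod) auto
    have "norm (\<Prod>k\<in>I. f N k (Z k \<omega>)) \<le> (\<Prod>k\<in>I. B)" for N \<omega>
      unfolding prod_norm[symmetric] using bd by (intro prod_mono) auto
    then show "AE \<omega> in P. norm (\<Prod>k\<in>I. f N k (Z k \<omega>)) \<le> B ^ card I" for N
      by simp
  qed (measurable; fail)+
qed

lemma gaussian_family_integral_real_trig_poly:
  assumes gf: "gaussian_family P Z I R" and I: "finite I" and T: "\<And>k. k \<in> I \<Longrightarrow> finite (T k)"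
    and f: "\<And>k x. k \<in> I \<Longrightarrow> complex_of_real (f k x) = trig_poly (T k) (b k) x"
  shows "(prod_mean P Z I f) =
     (\<Sum>c\<in>PiE I T. Re (\<Prod>k\<in>I. b k (c k)) * exp (- quad_form I R c / 2))"
proof -
  have "complex_of_real (prod_mean P Z I f) =
     (\<Sum>c\<in>PiE I T. (\<Prod>k\<in>I. b k (c k)) * of_real (exp (- quad_form I R c / 2)))"
  proof -
    have "(\<Prod>k\<in>I. trig_poly (T k) (b k) (Z k \<omega>)) = complex_of_real (\<Prod>k\<in>I. f k (Z k \<omega>))" for \<omega>
      using f by simp
    then show ?thesis
      using gaussian_family_integral_trig_poly[OF gf I, where T = T and b = b] T
      by (simp del: of_real_prod)
  qed
  then have "Re (complex_of_real (prod_mean P Z I f)) =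
     Re (\<Sum>c\<in>PiE I T. (\<Prod>k\<in>I. b k (c k)) * of_real (exp (- quad_form I R c / 2)))"
    by (rule arg_cong)
  then show ?thesis
    by (simp del: of_real_exp)
qed

text \<open>Means of trigonometric polynomials are determined by \<open>R\<close>, and bounded
  pointwise approximation carries this over to bounded continuous functions. It allows a correlated
  pair to be exchanged for the model of \<open>gaussian_family_two\<close>.\<close>

lemma gaussian_family_integral_unique:
  fixes \<psi> :: "'i \<Rightarrow> real \<Rightarrow> real"
  assumes gf: "gaussian_family P Z I R" "gaussian_family Q Y I R" and I: "finite I"
    and cont: "\<And>k. k \<in> I \<Longrightarrow> continuous_on UNIV (\<psi> k)"
    and bd: "\<And>k x. k \<in> I \<Longrightarrow> \<bar>\<psi> k x\<bar> \<le> B"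
  shows "(prod_mean P Z I \<psi>) = (prod_mean Q Y I \<psi>)"
proof -
  have "\<exists>f :: nat \<Rightarrow> real \<Rightarrow> real. (\<forall>N. is_trig_poly (\<lambda>x. complex_of_real (f N x))) \<and>
    (\<forall>N x. \<bar>f N x\<bar> \<le> B + 1) \<and> (\<forall>x. (\<lambda>N. f N x) \<longlonglongrightarrow> \<psi> k x)" if "k \<in> I" for k
    using continuous_trig_poly_approx[of "\<psi> k" B] cont[OF that] bd[OF that] by metis
  then obtain f :: "'i \<Rightarrow> nat \<Rightarrow> real \<Rightarrow> real" where
    f: "\<And>k N. k \<in> I \<Longrightarrow> is_trig_poly (\<lambda>x. complex_of_real (f k N x))"
    "\<And>k N x. k \<in> I \<Longrightarrow> \<bar>f k N x\<bar> \<le> B + 1" "\<And>k x. k \<in> I \<Longrightarrow> (\<lambda>N. f k N x) \<longlonglongrightarrow> \<psi> k x"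
    by metis
  have "\<exists>T a. finite T \<and> (\<forall>x. complex_of_real (f k N x) = trig_poly T a x)" if "k \<in> I" for k N
    using f(1)[OF that] unfolding is_trig_poly_def by metis
  then obtain T a where Ta: "\<And>k N. k \<in> I \<Longrightarrow> finite (T k N)"
    "\<And>k N x. k \<in> I \<Longrightarrow> complex_of_real (f k N x) = trig_poly (T k N) (a k N) x"
    by metis
  have "(\<lambda>x. Re (trig_poly (T k N) (a k N) x)) \<in> borel_measurable borel" for k N
    by (intro borel_measurable_continuous_onI continuous_intros continuous_trig_poly)
  moreover have "f k N = (\<lambda>x. Re (trig_poly (T k N) (a k N) x))" if "k \<in> I" for k N
    using Ta(2)[OF that] by (metis Re_complex_of_real)
  ultimately have meas: "f k N \<in> borel_measurable borel" if "k \<in> I" for k N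
    using that by simp
  have "(prod_mean P Z I (\<lambda>k. f k N)) = (prod_mean Q Y I (\<lambda>k. f k N))" for N
    using gaussian_family_integral_real_trig_poly[OF gf(1) I, where T = "\<lambda>k. T k N" and f = "\<lambda>k. f k N" and b = "\<lambda>k. a k N"]
      gaussian_family_integral_real_trig_poly[OF gf(2) I, where T = "\<lambda>k. T k N" and f = "\<lambda>k. f k N" and b = "\<lambda>k. a k N"] Ta
    by simp
  moreover have "(\<lambda>N. prod_mean P Z I (\<lambda>k. f k N)) \<longlonglongrightarrow> (prod_mean P Z I \<psi>)"
    by (rule integral_prod_tendsto[where B = "B + 1"])
      (use gf f meas I in \<open>auto simp: gaussian_family_def\<close>)
  moreover have "(\<lambda>N. prod_mean Q Y I (\<lambda>k. f k N)) \<longlonglongrightarrow> (prod_mean Q Y I \<psi>)"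
    by (rule integral_prod_tendsto[where B = "B + 1"])
      (use gf f meas I in \<open>auto simp: gaussian_family_def\<close>)
  ultimately show ?thesis
    using LIMSEQ_unique by simp
qed

section \<open>Interpolation and the normal comparison inequality\<close>

lemma prod_remove_two:
  assumes "finite I" "i \<in> I" "j \<in> I - {i}"
  shows "(\<Prod>k\<in>I. G k) = G i * G j * (\<Prod>k\<in>I-{i,j}. G k)"
proof -
  have "I - {i,j} = I - {i} - {j}" by auto
  then show ?thesis
    using assms by (simp add: prod.remove[of I i] prod.remove[of "I - {i}" j] mult_ac)
qed

text \<open>Differentiating the exponential along the interpolation brings down the terms
  \<open>- c i * c j * r i j\<close>, halved, and
  \<open>- c i * c j = (\<i> * c i) * (\<i> * c j)\<close> is the effect of differentiating the
  factors \<open>f i\<close> and \<open>f j\<close>. So the derivative is a sum of means of products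
  with two factors differentiated (the formula of Price and Plackett). \<open>D i j\<close> must
  bound these means at every stage \<open>h\<close>, on the product space where the interpolating
  family lives.\<close>

lemma gaussian_comparison_trig_poly:
  fixes f f' :: "'i \<Rightarrow> real \<Rightarrow> real" and P :: "'a measure" and Q :: "'b measure"
  assumes I: "finite I" and T: "\<And>k. k \<in> I \<Longrightarrow> finite (T k)"
    and gP: "gaussian_family P X I (\<lambda>i j. if i = j then 1 else r i j)"
    and gQ: "gaussian_family Q Y I (\<lambda>i j. if i = j then 1 else 0)"
    and f: "\<And>k x. k \<in> I \<Longrightarrow> complex_of_real (f k x) = trig_poly (T k) (a k) x"
    and f': "\<And>k x. k \<in> I \<Longrightarrow> complex_of_real (f' k x) = trig_poly (T k) (\<lambda>m. \<i> * m * a k m) x"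
    and C: "C \<ge> 1" and bd: "\<And>k x. k \<in> I \<Longrightarrow> \<bar>f k x\<bar> \<le> C" "\<And>k x. k \<in> I \<Longrightarrow> \<bar>f' k x\<bar> \<le> B"
    and D: "\<And>W :: ('a \<times> 'b) measure. \<And>V h i j. i \<in> I \<Longrightarrow> j \<in> I \<Longrightarrow> i \<noteq> j \<Longrightarrow> h \<in> {0..1} \<Longrightarrow>
      gaussian_family W V I (\<lambda>i j. if i = j then 1 else h * r i j) \<Longrightarrow>
      (LINT \<omega>|W. \<bar>f' i (V i \<omega>)\<bar> * \<bar>f' j (V j \<omega>)\<bar>) \<le> D i j"
  shows "\<bar>(prod_mean P X I f) - (prod_mean Q Y I f)\<bar> \<le>
    C ^ card I * (\<Sum>i\<in>I. \<Sum>j\<in>I-{i}. \<bar>r i j\<bar> * D i j) / 2"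
proof -
  define R where "R h i j = (if i = j then 1 else h * r i j)" for h :: real and i j
  define q where "q h c = - (\<Sum>i\<in>I. \<Sum>j\<in>I. c i * c j * R h i j) / 2" for h and c :: "'i \<Rightarrow> real"
  define A where "A c = Re (\<Prod>k\<in>I. a k (c k))" for c
  \<comment> \<open>\<open>g h\<close> is the mean of the product under the covariance
    \<open>R h\<close>, written as a finite exponential sum; the two given means are its values at 1
    and 0.\<close>
  define g where "g h = (\<Sum>c\<in>PiE I T. A c * exp (q h c))" for h
  define g' where "g' h = (\<Sum>c\<in>PiE I T. A c * (exp (q h c) *
      (- (\<Sum>i\<in>I. \<Sum>j\<in>I-{i}. c i * c j * r i j) / 2)))" for h
  have qd: "((\<lambda>h. q h c) has_real_derivative - (\<Sum>i\<in>I. \<Sum>j\<in>I-{i}. c i * c j * r i j) / 2) (at h)" for h c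
  proof -
    have "((\<lambda>h. q h c) has_real_derivative
      - (\<Sum>i\<in>I. \<Sum>j\<in>I. c i * c j * (if i = j then 0 else r i j)) / 2) (at h)"
    proof -
      have d: "((\<lambda>h. if i = j then 1 else h * r i j) has_real_derivative (if i = j then 0 else r i j)) (at h)" for i j
        by (auto intro!: derivative_eq_intros)
      show ?thesis
        unfolding q_def R_def by (intro DERIV_cdivide DERIV_minus DERIV_sum DERIV_cmult d)
    qed
    moreover have "(\<Sum>i\<in>I. \<Sum>j\<in>I. c i * c j * (if i = j then 0 else r i j)) =
      (\<Sum>i\<in>I. \<Sum>j\<in>I-{i}. c i * c j * r i j)"
      using I by (intro sum.cong refl sum.mono_neutral_cong_right) auto
    ultimately show ?thesis by simp
  qed
  have gd: "(g has_real_derivative g' h) (at h)" for h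
    unfolding g_def g'_def
    by (intro DERIV_sum DERIV_cmult DERIV_fun_exp[OF qd])
  have R0: "R 0 = (\<lambda>i j. if i = j then 1 else 0)" and R1: "R 1 = (\<lambda>i j. if i = j then 1 else r i j)"
    by (auto simp: R_def fun_eq_iff)
  have g0: "(prod_mean Q Y I f) = g 0"
    using gaussian_family_integral_real_trig_poly[OF gQ I, where f = f and b = a and T = T] T f
    by (simp add: g_def q_def A_def R0)
  have g1: "(prod_mean P X I f) = g 1"
    using gaussian_family_integral_real_trig_poly[OF gP I, where f = f and b = a and T = T] T f
    by (simp add: g_def q_def A_def R1)
  have meas: "f k \<in> borel_measurable borel" "f' k \<in> borel_measurable borel" if "k \<in> I" for k
  proof -
    have *: "(\<lambda>x. Re (trig_poly (T k) b x)) \<in> borel_measurable borel" for b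
      by (intro borel_measurable_continuous_onI continuous_intros continuous_trig_poly)
    have "f k = (\<lambda>x. Re (trig_poly (T k) (a k) x))"
      "f' k = (\<lambda>x. Re (trig_poly (T k) (\<lambda>m. \<i> * m * a k m) x))"
      using f[OF that] f'[OF that] by (metis Re_complex_of_real)+
    then show "f k \<in> borel_measurable borel" "f' k \<in> borel_measurable borel"
      using * by simp_all
  qed
  have g'_bound: "\<bar>g' h\<bar> \<le> C ^ card I * (\<Sum>i\<in>I. \<Sum>j\<in>I-{i}. \<bar>r i j\<bar> * D i j) / 2"
    if h: "h \<in> {0..1}" for h
  proof -
    define W where "W = P \<Otimes>\<^sub>M Q"
    \<comment> \<open>The squares of the two weights sum to 1, so unit variances are kept while the
      off-diagonal covariances become \<open>h * r i j\<close>.\<close>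
    define V where "V i \<omega> = sqrt h * X i (fst \<omega>) + sqrt (1 - h) * Y i (snd \<omega>)" for i \<omega>
    have gW: "gaussian_family W V I (R h)"
      using gaussian_family_pair[OF gP gQ, of "sqrt h" "sqrt (1 - h)"] h
      unfolding W_def V_def R_def
      by (subst gaussian_family_cong[where R' = "\<lambda>i j. (sqrt h)\<^sup>2 * (if i = j then 1 else r i j)
        + (sqrt (1 - h))\<^sup>2 * (if i = j then 1 else 0)"]) auto
    interpret W: prob_space W using gW by (simp add: gaussian_family_def)
    have [measurable]: "V i \<in> borel_measurable W" if "i \<in> I" for i
      using gW that by (simp add: gaussian_family_def)
    note [measurable] = meas
    define F where "F i j k = (if k = i \<or> k = j then f' k else f k)" for i j k
    define b where "b i j k = (if k = i \<or> k = j then (\<lambda>m. \<i> * m * a k m) else a k)" for i j k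
    define E where "E i j = (prod_mean W V I (F i j))" for i j
    have b: "Re (\<Prod>k\<in>I. b i j k (c k)) = - (c i * c j) * A c" if "i \<in> I" "j \<in> I - {i}" for i j c
    proof -
      have "(\<Prod>k\<in>I. b i j k (c k)) = (\<i> * c i * a i (c i)) * (\<i> * c j * a j (c j)) * (\<Prod>k\<in>I-{i,j}. a k (c k))"
        unfolding prod_remove_two[OF I that] by (auto simp: b_def intro!: prod.cong)
      also have "\<dots> = of_real (- (c i * c j)) * (\<Prod>k\<in>I. a k (c k))"
        unfolding prod_remove_two[OF I that] by (simp add: algebra_simps)
      finally show ?thesis by (simp only: Re_complex_of_real A_def) simp
    qed
    have E: "E i j = (\<Sum>c\<in>PiE I T. - (c i * c j) * A c * exp (q h c))" if "i \<in> I" "j \<in> I - {i}" for i j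
    proof -
      have "complex_of_real (F i j k x) = trig_poly (T k) (b i j k) x" if "k \<in> I" for k x
        using f[OF that] f'[OF that] by (auto simp: F_def b_def)
      then show ?thesis
        using gaussian_family_integral_real_trig_poly[OF gW I, where f = "F i j" and b = "b i j" and T = T] T
        by (simp add: E_def q_def b[OF that] )
    qed
    have "g' h = (\<Sum>c\<in>PiE I T. \<Sum>i\<in>I. \<Sum>j\<in>I-{i}. r i j * (- (c i * c j) * A c * exp (q h c)) / 2)"
      unfolding g'_def
      by (simp add: sum_distrib_left sum_divide_distrib sum_negf mult_ac)
    also have "\<dots> = (\<Sum>i\<in>I. \<Sum>c\<in>PiE I T. \<Sum>j\<in>I-{i}. r i j * (- (c i * c j) * A c * exp (q h c)) / 2)"
      by (rule sum.swap)
    also have "\<dots> = (\<Sum>i\<in>I. \<Sum>j\<in>I-{i}. \<Sum>c\<in>PiE I T. r i j * (- (c i * c j) * A c * exp (q h c)) / 2)"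
      by (intro sum.cong refl sum.swap)
    also have "\<dots> = (\<Sum>i\<in>I. \<Sum>j\<in>I-{i}. r i j * E i j / 2)"
      by (intro sum.cong refl) (simp add: E sum_distrib_left sum_divide_distrib)
    also have "\<bar>\<dots>\<bar> \<le> (\<Sum>i\<in>I. \<Sum>j\<in>I-{i}. \<bar>r i j * E i j / 2\<bar>)"
      by (intro order_trans[OF sum_abs] sum_mono sum_abs)
    also have "\<dots> \<le> (\<Sum>i\<in>I. \<Sum>j\<in>I-{i}. \<bar>r i j\<bar> * (C ^ card I * D i j) / 2)"
    proof (intro sum_mono)
      fix i j assume ij: "i \<in> I" "j \<in> I - {i}"
      \<comment> \<open>Only the two differentiated factors are kept. The others are at most
        \<open>C\<close>, and \<open>C \<ge> 1\<close> allows the exponent to be raised to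
        \<open>card I\<close>.\<close>
      have pb: "\<bar>\<Prod>k\<in>I. F i j k (V k \<omega>)\<bar> \<le> C ^ card I * (\<bar>f' i (V i \<omega>)\<bar> * \<bar>f' j (V j \<omega>)\<bar>)" for \<omega>
      proof -
        have "\<bar>\<Prod>k\<in>I-{i,j}. F i j k (V k \<omega>)\<bar> \<le> (\<Prod>k\<in>I-{i,j}. C)"
          unfolding abs_prod using bd(1) by (intro prod_mono) (auto simp: F_def)
        also have "\<dots> \<le> C ^ card I"
          using C I by (simp add: power_increasing card_mono)
        finally have "\<bar>\<Prod>k\<in>I-{i,j}. F i j k (V k \<omega>)\<bar> \<le> C ^ card I" .
        from mult_left_mono[OF this, of "\<bar>f' i (V i \<omega>)\<bar> * \<bar>f' j (V j \<omega>)\<bar>"]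
        show ?thesis
          unfolding prod_remove_two[OF I ij] by (simp add: abs_mult F_def mult_ac)
      qed
      have B0: "0 \<le> B" using order_trans[OF abs_ge_zero bd(2)[OF ij(1)]] .
      have iint: "integrable W (\<lambda>\<omega>. \<bar>f' i (V i \<omega>)\<bar> * \<bar>f' j (V j \<omega>)\<bar>)"
        using bd(2) ij B0 by (intro W.integrable_const_bound[of _ "B * B"]) (auto simp: intro!: mult_mono)
      have "\<bar>E i j\<bar> \<le> (LINT \<omega>|W. C ^ card I * (\<bar>f' i (V i \<omega>)\<bar> * \<bar>f' j (V j \<omega>)\<bar>))"
        unfolding E_def
      proof (rule order_trans[OF integral_abs_bound integral_mono])
        show "integrable W (\<lambda>\<omega>. C ^ card I * (\<bar>f' i (V i \<omega>)\<bar> * \<bar>f' j (V j \<omega>)\<bar>))"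
          using iint by simp
        show "integrable W (\<lambda>\<omega>. \<bar>\<Prod>k\<in>I. F i j k (V k \<omega>)\<bar>)"
        proof (rule Bochner_Integration.integrable_bound)
          show "integrable W (\<lambda>\<omega>. C ^ card I * (\<bar>f' i (V i \<omega>)\<bar> * \<bar>f' j (V j \<omega>)\<bar>))"
            using iint by simp
          have [measurable]: "F i j k \<in> borel_measurable borel" if "k \<in> I" for k
            using meas that by (simp add: F_def)
          show "(\<lambda>\<omega>. \<bar>\<Prod>k\<in>I. F i j k (V k \<omega>)\<bar>) \<in> borel_measurable W"
            by measurable
        qed (use pb C in \<open>auto simp: abs_mult intro!: AE_I2\<close>)
      qed (rule pb)
      also have "\<dots> = C ^ card I * (LINT \<omega>|W. \<bar>f' i (V i \<omega>)\<bar> * \<bar>f' j (V j \<omega>)\<bar>)"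
        by simp
      also have "\<dots> \<le> C ^ card I * D i j"
      proof (intro mult_left_mono)
        have "R h = (\<lambda>i j. if i = j then 1 else h * r i j)"
          by (simp add: R_def fun_eq_iff)
        then show "(LINT \<omega>|W. \<bar>f' i (V i \<omega>)\<bar> * \<bar>f' j (V j \<omega>)\<bar>) \<le> D i j"
          using ij h gW by (intro D) auto
      qed (use C in auto)
      finally show "\<bar>r i j * E i j / 2\<bar> \<le> \<bar>r i j\<bar> * (C ^ card I * D i j) / 2"
        by (simp add: abs_mult mult_left_mono divide_right_mono)
    qed
    also have "\<dots> = C ^ card I * (\<Sum>i\<in>I. \<Sum>j\<in>I-{i}. \<bar>r i j\<bar> * D i j) / 2"
      by (simp add: sum_distrib_left sum_divide_distrib mult_ac)
    finally show ?thesis .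
  qed
  have "\<exists>z::real. 0 < z \<and> z < 1 \<and> g 1 - g 0 = (1 - 0) * g' z"
    using gd by (intro MVT2) auto
  then obtain z where z: "0 < z" "z < 1" "g 1 - g 0 = g' z" by auto
  show ?thesis
    unfolding g0 g1 z(3) using g'_bound[of z] z by simp
qed

lemma integrable_bounded_gaussian:
  fixes \<psi> :: "real \<Rightarrow> real"
  assumes "\<psi> \<in> borel_measurable borel" "\<And>x. \<bar>\<psi> x\<bar> \<le> B" "\<rho> \<ge> 0"
  shows "integrable lborel (\<lambda>x. \<psi> x * damp \<rho> x)"
proof (rule Bochner_Integration.integrable_bound)
  have "integrable lborel (\<lambda>x. (B * sqrt (2 * pi * (1 + \<rho>))) * normal_density 0 (sqrt (1 + \<rho>)) x)"
    using assms(3) by (intro integrable_mult_right integrable_normal_density) auto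
  also have "(\<lambda>x. (B * sqrt (2 * pi * (1 + \<rho>))) * normal_density 0 (sqrt (1 + \<rho>)) x) =
      (\<lambda>x. B * damp \<rho> x)"
    using assms(3) by (auto simp: normal_density_def)
  finally show "integrable lborel (\<lambda>x. B * damp \<rho> x)" .
  show "AE x in lborel. norm (\<psi> x * damp \<rho> x) \<le> norm (B * damp \<rho> x)"
    using assms(2) by (intro AE_I2) (auto simp: abs_mult intro!: mult_right_mono order_trans[OF _ abs_ge_self])
qed (use assms(1) in measurable)

lemma integrable_between:
  fixes f g :: "'a \<Rightarrow> real"
  assumes "integrable M g" "f \<in> borel_measurable M" "\<And>x. 0 \<le> f x" "\<And>x. f x \<le> g x"
  shows "integrable M f"
proof (rule Bochner_Integration.integrable_bound[OF assms(1,2)])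
  have "norm (f x) \<le> norm (g x)" for x
    using assms(3)[of x] assms(4)[of x] by simp
  then show "AE x in M. norm (f x) \<le> norm (g x)" by simp
qed

text \<open>The bivariate density is dominated by a product of functions of one variable, because
  \<open>x^2 - 2 * r * x * z + z^2\<close> is at least
  \<open>(1 - \<bar>r\<bar>) * (x^2 + z^2)\<close>. The bound depends on \<open>r\<close> only
  through \<open>\<rho> \<ge> \<bar>r\<bar>\<close>, hence it serves all interpolation stages at
  once.\<close>

lemma gaussian_family_pair_bound:
  assumes gf: "gaussian_family P Z I R" and I: "finite I" "i \<in> I" "j \<in> I" "i \<noteq> j"
    and R: "R i i = 1" "R j j = 1" "R i j = r" "R j i = r" and r: "\<bar>r\<bar> \<le> \<rho>" "\<rho> < 1"
    and cont: "continuous_on UNIV \<psi>1" "continuous_on UNIV \<psi>2"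
    and bd: "\<And>x. 0 \<le> \<psi>1 x" "\<And>x. \<psi>1 x \<le> B" "\<And>x. 0 \<le> \<psi>2 x" "\<And>x. \<psi>2 x \<le> B"
  shows "(LINT \<omega>|P. \<psi>1 (Z i \<omega>) * \<psi>2 (Z j \<omega>)) \<le> 1 / (2 * pi * sqrt (1 - \<rho>\<^sup>2)) *
    ((LINT x|lborel. \<psi>1 x * damp \<rho> x) * (LINT x|lborel. \<psi>2 x * damp \<rho> x))"
proof -
  let ?q = "\<lambda>x z. std_normal_density x * (std_normal_density ((z - r * x) / sqrt (1 - r\<^sup>2)) / sqrt (1 - r\<^sup>2))"
  let ?N = std_normal_distribution and ?s = "sqrt (1 - r\<^sup>2)"
  let ?e = "\<lambda>x. damp \<rho> x" and ?K = "1 / (2 * pi * sqrt (1 - \<rho>\<^sup>2))"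
  interpret N: prob_space ?N by (rule prob_space_std_normal)
  interpret PQ: pair_prob_space ?N ?N ..
  have meas[measurable]: "\<psi>1 \<in> borel_measurable borel" "\<psi>2 \<in> borel_measurable borel"
    using cont by (auto intro: borel_measurable_continuous_onI)
  have \<rho>0: "0 \<le> \<rho>" using r by linarith
  have r1: "r\<^sup>2 \<le> \<rho>\<^sup>2" "\<rho>\<^sup>2 < 1"
    using r \<rho>0 by (auto simp: abs_le_square_iff[symmetric] abs_square_less_1)
  have s: "?s > 0" "?s\<^sup>2 = 1 - r\<^sup>2" using r1 by auto
  have B0: "0 \<le> B" using bd(1,2)[of 0] by linarith
  \<comment> \<open>Continuity of the test functions permits the exchange of the pair for the model
    on two independent standard normals.\<close>
  have "(LINT \<omega>|P. (\<Prod>k\<in>{i,j}. (if k = i then \<psi>1 else \<psi>2) (Z k \<omega>))) =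
    (LINT \<omega>|(?N \<Otimes>\<^sub>M ?N). (\<Prod>k\<in>{i,j}. (if k = i then \<psi>1 else \<psi>2)
        (if k = i then fst \<omega> else r * fst \<omega> + ?s * snd \<omega>)))"
  proof (rule gaussian_family_integral_unique[where R = R and B = B and Z = Z and \<psi> = "\<lambda>k. if k = i then \<psi>1 else \<psi>2"
        and Y = "\<lambda>k \<omega>. if k = i then fst \<omega> else r * fst \<omega> + ?s * snd \<omega>"])
    show "gaussian_family P Z {i,j} R"
      using gaussian_family_mono[OF gf _ I(1)] I by auto
    show "gaussian_family (?N \<Otimes>\<^sub>M ?N) (\<lambda>k \<omega>. if k = i then fst \<omega> else r * fst \<omega> + ?s * snd \<omega>) {i,j} R"
      by (rule gaussian_family_two) (use I R r in auto)
  qed (use cont bd in auto)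
  then have "(LINT \<omega>|P. \<psi>1 (Z i \<omega>) * \<psi>2 (Z j \<omega>)) =
      (LINT \<omega>|(?N \<Otimes>\<^sub>M ?N). \<psi>1 (fst \<omega>) * \<psi>2 (r * fst \<omega> + ?s * snd \<omega>))"
    using I(4) by simp
  also have "\<dots> = (LINT x|?N. LINT y|?N. \<psi>1 x * \<psi>2 (r * x + ?s * y))"
  proof -
    have [measurable]: "fst \<in> borel_measurable (?N \<Otimes>\<^sub>M ?N)" "snd \<in> borel_measurable (?N \<Otimes>\<^sub>M ?N)"
      using measurable_fst[of ?N ?N] measurable_snd[of ?N ?N]
      by (simp_all add: measurable_std_normal)
    have "integrable (?N \<Otimes>\<^sub>M ?N) (\<lambda>\<omega>. \<psi>1 (fst \<omega>) * \<psi>2 (r * fst \<omega> + ?s * snd \<omega>))"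
      using bd B0 by (intro PQ.integrable_const_bound[of _ "B * B"]) (auto simp: abs_mult intro!: mult_mono)
    from PQ.integral_fst'[OF this] show ?thesis by simp
  qed
  also have "\<dots> = (LINT x|?N. \<psi>1 x * (LINT y|?N. \<psi>2 (r * x + ?s * y)))"
    by simp
  \<comment> \<open>The substitution \<open>z = r * x + ?s * y\<close> produces
    \<open>?q x z\<close>, the joint density of the pair, factored into the density at
    \<open>x\<close> and the conditional density of \<open>z\<close> given \<open>x\<close>.\<close>
  also have "\<dots> = (LINT x|lborel. \<psi>1 x * (LINT z|lborel. ?q x z * \<psi>2 z))"
  proof -
    have "(LINT y|?N. \<psi>2 (r * x + ?s * y)) = (LINT z|lborel. (std_normal_density ((z - r * x) / ?s) / ?s) * \<psi>2 z)" for x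
    proof -
      have "(LINT y|?N. \<psi>2 (r * x + ?s * y)) = (LINT y|lborel. std_normal_density y * \<psi>2 (r * x + ?s * y))"
        by (simp add: integral_density)
      also have "\<dots> = (LINT z|lborel. (std_normal_density ((z - r * x) / ?s) / ?s) * \<psi>2 z)"
        using s by (subst (2) lborel_integral_real_affine[of ?s _ "r * x"]) auto
      finally show ?thesis .
    qed
    moreover have "(\<lambda>x. LINT y|?N. \<psi>2 (r * x + ?s * y)) \<in> borel_measurable borel"
      by (intro N.borel_measurable_lebesgue_integral) measurable
    moreover have "(LINT z|lborel. ?q x z * \<psi>2 z) =
        std_normal_density x * (LINT z|lborel. (std_normal_density ((z - r * x) / ?s) / ?s) * \<psi>2 z)" for x
      by (simp only: mult.assoc integral_mult_right_zero)
    ultimately show ?thesis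
      by (subst integral_density) (simp_all only: real_scaleR_def mult_ac, auto)
  qed
  also have "\<dots> \<le> (LINT x|lborel. \<psi>1 x * (?K * ?e x * (LINT z|lborel. \<psi>2 z * ?e z)))"
  proof -
    have int1: "integrable lborel (\<lambda>x. \<psi>1 x * ?e x)" and int2: "integrable lborel (\<lambda>x. \<psi>2 x * ?e x)"
      by (rule integrable_bounded_gaussian[where B = B]; use bd \<rho>0 in simp)+
    have point: "?q x z \<le> ?K * ?e x * ?e z" for x z
    proof -
      have "(x\<^sup>2 + z\<^sup>2) / (1 + \<rho>) \<le> x\<^sup>2 + ((z - r * x) / ?s)\<^sup>2"
      proof -
        have *: "x\<^sup>2 + ((z - r * x) / ?s)\<^sup>2 = (x\<^sup>2 - 2 * r * x * z + z\<^sup>2) / (1 - r\<^sup>2)"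
          using s r1 by (simp add: power_divide divide_simps) (simp add: algebra_simps power2_eq_square)
        have "2 * (r * x * z) \<le> \<bar>r\<bar> * (x\<^sup>2 + z\<^sup>2)"
        proof -
          have "2 * \<bar>x * z\<bar> \<le> x\<^sup>2 + z\<^sup>2"
            using sum_squares_bound[of "\<bar>x\<bar>" "\<bar>z\<bar>"] by (simp add: abs_mult)
          then have "\<bar>r\<bar> * (2 * \<bar>x * z\<bar>) \<le> \<bar>r\<bar> * (x\<^sup>2 + z\<^sup>2)"
            by (rule mult_left_mono) auto
          moreover have "r * x * z \<le> \<bar>r\<bar> * \<bar>x * z\<bar>"
            by (metis abs_ge_self abs_mult mult.assoc)
          ultimately show ?thesis by linarith
        qed
        then have "(1 - \<bar>r\<bar>) * (x\<^sup>2 + z\<^sup>2) \<le> x\<^sup>2 - 2 * r * x * z + z\<^sup>2"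
          by (simp add: algebra_simps)
        then have "(1 - \<bar>r\<bar>) * (x\<^sup>2 + z\<^sup>2) / (1 - r\<^sup>2) \<le> x\<^sup>2 + ((z - r * x) / ?s)\<^sup>2"
          unfolding * using r1 by (intro divide_right_mono) auto
        moreover have "1 - r\<^sup>2 = (1 - \<bar>r\<bar>) * (1 + \<bar>r\<bar>)"
          by (simp add: algebra_simps power2_eq_square)
        moreover have "1 - \<bar>r\<bar> > 0" "1 + \<bar>r\<bar> > 0" using r by auto
        ultimately have "(x\<^sup>2 + z\<^sup>2) / (1 + \<bar>r\<bar>) \<le> x\<^sup>2 + ((z - r * x) / ?s)\<^sup>2"
          by simp
        moreover have "(x\<^sup>2 + z\<^sup>2) / (1 + \<rho>) \<le> (x\<^sup>2 + z\<^sup>2) / (1 + \<bar>r\<bar>)"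
          using r by (intro divide_left_mono) auto
        ultimately show ?thesis by linarith
      qed
      then have ex: "- x\<^sup>2 / 2 - ((z - r * x) / ?s)\<^sup>2 / 2 \<le> - x\<^sup>2 / (2 * (1 + \<rho>)) - z\<^sup>2 / (2 * (1 + \<rho>))"
      proof -
        have "- x\<^sup>2 / 2 - ((z - r * x) / ?s)\<^sup>2 / 2 = - ((x\<^sup>2 + ((z - r * x) / ?s)\<^sup>2) / 2)"
          by (simp add: add_divide_distrib)
        also have "\<dots> \<le> - ((x\<^sup>2 + z\<^sup>2) / (1 + \<rho>) / 2)"
          by (rule le_imp_neg_le[OF divide_right_mono[OF \<open>(x\<^sup>2 + z\<^sup>2) / (1 + \<rho>) \<le> _\<close>]]) simp
        also have "\<dots> = - x\<^sup>2 / (2 * (1 + \<rho>)) - z\<^sup>2 / (2 * (1 + \<rho>))"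
          using \<rho>0 by (simp add: divide_simps) (simp add: algebra_simps)
        finally show ?thesis .
      qed
      have nd: "std_normal_density x * (std_normal_density y / s) =
        1 / (2 * pi * s) * exp (- x\<^sup>2 / 2 - y\<^sup>2 / 2)" for x y s :: real
      proof -
        have "exp (- x\<^sup>2 / 2 - y\<^sup>2 / 2) = exp (- x\<^sup>2 / 2) * exp (- y\<^sup>2 / 2)"
          by (simp flip: exp_add)
        then have "1 / (2 * pi * s) * exp (- x\<^sup>2 / 2 - y\<^sup>2 / 2) =
            exp (- x\<^sup>2 / 2) * exp (- y\<^sup>2 / 2) / (sqrt (2 * pi) * sqrt (2 * pi) * s)"
          by simp
        then show ?thesis
          unfolding std_normal_density_def by (simp only: times_divide_eq_left times_divide_eq_right
              divide_divide_eq_left mult_1 mult_1_right mult_ac)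
      qed
      have "?q x z =
        1 / (2 * pi * ?s) * exp (- x\<^sup>2 / 2 - ((z - r * x) / ?s)\<^sup>2 / 2)"
        by (rule nd)
      also have "\<dots> \<le> ?K * exp (- x\<^sup>2 / (2 * (1 + \<rho>)) - z\<^sup>2 / (2 * (1 + \<rho>)))"
        using ex s r1 by (intro mult_mono divide_left_mono) auto
      also have "\<dots> = ?K * ?e x * ?e z"
        by (simp add: exp_diff exp_minus field_simps)
      finally show ?thesis .
    qed
    have inner: "(LINT z|lborel. ?q x z * \<psi>2 z)
        \<le> ?K * ?e x * (LINT z|lborel. \<psi>2 z * ?e z)"
      and inner_nonneg: "0 \<le> (LINT z|lborel. ?q x z * \<psi>2 z)" for x
    proof -
      have p2: "?q x z * \<psi>2 z \<le> ?K * ?e x * (\<psi>2 z * ?e z)" for z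
        using mult_right_mono[OF point bd(3)[of z], of x z] by (simp only: mult_ac)
      have nn: "0 \<le> ?q x z * \<psi>2 z" for z
        using s bd(3) by (intro mult_nonneg_nonneg divide_nonneg_nonneg) auto
      have i2: "integrable lborel (\<lambda>z. ?K * ?e x * (\<psi>2 z * ?e z))"
        using int2 by (rule integrable_mult_right)
      have "(LINT z|lborel. ?q x z * \<psi>2 z)
        \<le> (LINT z|lborel. ?K * ?e x * (\<psi>2 z * ?e z))"
      proof (rule integral_mono[OF _ i2 p2])
        show "integrable lborel (\<lambda>z. ?q x z * \<psi>2 z)"
          by (rule integrable_between[OF i2 _ nn p2]) measurable
      qed
      then show "(LINT z|lborel. ?q x z * \<psi>2 z)
        \<le> ?K * ?e x * (LINT z|lborel. \<psi>2 z * ?e z)" by simp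
      show "0 \<le> (LINT z|lborel. ?q x z * \<psi>2 z)"
        by (rule Bochner_Integration.integral_nonneg[OF nn])
    qed
    have p3: "\<psi>1 x * (LINT z|lborel. ?q x z * \<psi>2 z)
       \<le> \<psi>1 x * (?K * ?e x * (LINT z|lborel. \<psi>2 z * ?e z))" for x
      by (rule mult_left_mono[OF inner bd(1)])
    have i3: "integrable lborel (\<lambda>x. \<psi>1 x * (?K * ?e x * (LINT z|lborel. \<psi>2 z * ?e z)))"
      using integrable_mult_right[OF int1, of "?K * (LINT z|lborel. \<psi>2 z * ?e z)"] by (simp add: mult_ac)
    show ?thesis
    proof (rule integral_mono[OF _ i3 p3])
      show "integrable lborel (\<lambda>x. \<psi>1 x * (LINT z|lborel. ?q x z * \<psi>2 z))"
      proof (rule integrable_between[OF i3 _ mult_nonneg_nonneg[OF bd(1) inner_nonneg] p3])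
        show "(\<lambda>x. \<psi>1 x * (LINT z|lborel. ?q x z * \<psi>2 z))
          \<in> borel_measurable lborel"
          by (intro borel_measurable_times lborel.borel_measurable_lebesgue_integral) measurable
      qed
    qed
  qed
  also have "\<dots> = ?K * ((LINT x|lborel. \<psi>1 x * ?e x) * (LINT x|lborel. \<psi>2 x * ?e x))"
  proof -
    have "(LINT x|lborel. \<psi>1 x * (?K * ?e x * (LINT z|lborel. \<psi>2 z * ?e z))) =
      (LINT x|lborel. (?K * (LINT z|lborel. \<psi>2 z * ?e z)) * (\<psi>1 x * ?e x))"
      by (intro Bochner_Integration.integral_cong refl) (simp only: mult_ac)
    also have "\<dots> = (?K * (LINT z|lborel. \<psi>2 z * ?e z)) * (LINT x|lborel. \<psi>1 x * ?e x)"
      by (rule integral_mult_right_zero)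
    finally show ?thesis by (simp only: mult_ac)
  qed
  finally show ?thesis .
qed

definition gaussian_mass :: "real \<Rightarrow> (real \<Rightarrow> real) \<Rightarrow> real" where
  "gaussian_mass \<rho> \<psi> = (LINT x|lborel. \<psi> x * damp \<rho> x)"

text \<open>The normalising constant of the standard bivariate normal density with correlation
  \<open>\<rho>\<close>.\<close>

definition pair_const :: "real \<Rightarrow> real" where
  "pair_const \<rho> = 1 / (2 * pi * sqrt (1 - \<rho>\<^sup>2))"

lemma gaussian_mass_nonneg: "(\<And>x. 0 \<le> \<psi> x) \<Longrightarrow> 0 \<le> gaussian_mass \<rho> \<psi>"
  unfolding gaussian_mass_def by (intro Bochner_Integration.integral_nonneg) auto

lemma pair_const_nonneg: "\<bar>\<rho>\<bar> \<le> 1 \<Longrightarrow> 0 \<le> pair_const \<rho>"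
  by (auto simp: pair_const_def abs_square_le_1)

lemma gaussian_mass_mono:
  assumes "\<psi> \<in> borel_measurable borel" "\<psi>' \<in> borel_measurable borel" "\<rho> \<ge> 0"
    and "\<And>x. 0 \<le> \<psi> x" "\<And>x. \<psi> x \<le> \<psi>' x" "\<And>x. \<psi>' x \<le> B"
  shows "gaussian_mass \<rho> \<psi> \<le> gaussian_mass \<rho> \<psi>'"
  unfolding gaussian_mass_def
proof (rule integral_mono)
  have "\<bar>\<psi> x\<bar> \<le> B" "\<bar>\<psi>' x\<bar> \<le> B" for x
    using assms(4)[of x] assms(5)[of x] assms(6)[of x] by auto
  then show "integrable lborel (\<lambda>x. \<psi> x * damp \<rho> x)"
     "integrable lborel (\<lambda>x. \<psi>' x * damp \<rho> x)"
    using assms by (blast intro: integrable_bounded_gaussian)+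
qed (use assms in auto)

text \<open>Limit of the inequality for trigonometric approximants: the means and the Gaussian
  masses of the derivatives converge by dominated convergence, and the prefactor tends to 1 because
  the index set is fixed.\<close>

lemma gaussian_comparison_C1:
  fixes \<phi> \<phi>' :: "'i \<Rightarrow> real \<Rightarrow> real" and P :: "'a measure" and Q :: "'b measure"
  assumes I: "finite I"
    and gP: "gaussian_family P X I (\<lambda>i j. if i = j then 1 else r i j)"
    and gQ: "gaussian_family Q Y I (\<lambda>i j. if i = j then 1 else 0)"
    and r: "\<And>i j. i \<in> I \<Longrightarrow> j \<in> I \<Longrightarrow> i \<noteq> j \<Longrightarrow> \<bar>r i j\<bar> < 1" "\<And>i j. r i j = r j i"
    and deriv: "\<And>k x. k \<in> I \<Longrightarrow> (\<phi> k has_real_derivative \<phi>' k x) (at x)"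
    and cont: "\<And>k. k \<in> I \<Longrightarrow> continuous_on UNIV (\<phi>' k)"
    and bd: "\<And>k x. k \<in> I \<Longrightarrow> \<bar>\<phi> k x\<bar> \<le> 1" "\<And>k x. k \<in> I \<Longrightarrow> \<bar>\<phi>' k x\<bar> \<le> B"
  shows "\<bar>(prod_mean P X I \<phi>) - (prod_mean Q Y I \<phi>)\<bar> \<le>
    (\<Sum>i\<in>I. \<Sum>j\<in>I-{i}. \<bar>r i j\<bar> * (pair_const \<bar>r i j\<bar> *
      (gaussian_mass \<bar>r i j\<bar> (\<lambda>x. \<bar>\<phi>' i x\<bar>) * gaussian_mass \<bar>r i j\<bar> (\<lambda>x. \<bar>\<phi>' j x\<bar>)))) / 2"
proof -
  \<comment> \<open>All properties of one approximating sequence are packed into a single predicate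
    on a tuple, so that the sequences for all \<open>k\<close> can be chosen in one step.\<close>
  define G where "G k t \<longleftrightarrow> (case t of (f, f', T, a) \<Rightarrow> (\<forall>N. finite (T N)) \<and>
    (\<forall>N x. complex_of_real (f N x) = trig_poly (T N) (a N) x) \<and>
    (\<forall>N x. complex_of_real (f' N x) = trig_poly (T N) (\<lambda>m. \<i> * m * a N m) x) \<and>
    (\<forall>N x. \<bar>f N x\<bar> \<le> 1 + 1 / (real N + 1)) \<and> (\<forall>N x. \<bar>f' N x\<bar> \<le> B + 1) \<and>
    (\<forall>x. (\<lambda>N. f N x) \<longlonglongrightarrow> \<phi> k x) \<and> (\<forall>x. (\<lambda>N. f' N x) \<longlonglongrightarrow> \<phi>' k x))"
    for k and t :: "(nat \<Rightarrow> real \<Rightarrow> real) \<times> (nat \<Rightarrow> real \<Rightarrow> real) \<times> (nat \<Rightarrow> real set) \<times> (nat \<Rightarrow> real \<Rightarrow> complex)"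
  have "\<exists>t. G k t" if k: "k \<in> I" for k
  proof -
    obtain f f' :: "nat \<Rightarrow> real \<Rightarrow> real" and T a where
      "\<And>N. finite (T N)"
      "\<And>N x. complex_of_real (f N x) = trig_poly (T N) (a N) x"
      "\<And>N x. complex_of_real (f' N x) = trig_poly (T N) (\<lambda>m. \<i> * m * a N m) x"
      "\<And>N x. \<bar>f N x\<bar> \<le> 1 + 1 / (real N + 1)" "\<And>N x. \<bar>f' N x\<bar> \<le> B + 1"
      "\<And>x. (\<lambda>N. f N x) \<longlonglongrightarrow> \<phi> k x" "\<And>x. (\<lambda>N. f' N x) \<longlonglongrightarrow> \<phi>' k x"
      by (rule C1_trig_poly_approx[OF deriv[OF k] cont[OF k] bd(1)[OF k] bd(2)[OF k]], rule that)
    then have "G k (f, f', T, a)" unfolding G_def prod.case by (intro conjI allI)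
    then show ?thesis ..
  qed
  then obtain t where t: "\<And>k. k \<in> I \<Longrightarrow> G k (t k)" by metis
  define f where "f k = fst (t k)" for k
  define f' where "f' k = fst (snd (t k))" for k
  define T where "T k = fst (snd (snd (t k)))" for k
  define a where "a k = snd (snd (snd (t k)))" for k
  have t': "t k = (f k, f' k, T k, a k)" for k
    by (simp add: f_def f'_def T_def a_def)
  have Ta: "\<And>k N. k \<in> I \<Longrightarrow> finite (T k N)"
    and f: "\<And>k N x. k \<in> I \<Longrightarrow> complex_of_real (f k N x) = trig_poly (T k N) (a k N) x"
    and f': "\<And>k N x. k \<in> I \<Longrightarrow> complex_of_real (f' k N x) = trig_poly (T k N) (\<lambda>m. \<i> * m * a k N m) x"
    and fb: "\<And>k N x. k \<in> I \<Longrightarrow> \<bar>f k N x\<bar> \<le> 1 + 1 / (real N + 1)"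
    and fb': "\<And>k N x. k \<in> I \<Longrightarrow> \<bar>f' k N x\<bar> \<le> B + 1"
    and lim: "\<And>k x. k \<in> I \<Longrightarrow> (\<lambda>N. f k N x) \<longlonglongrightarrow> \<phi> k x"
    and lim': "\<And>k x. k \<in> I \<Longrightarrow> (\<lambda>N. f' k N x) \<longlonglongrightarrow> \<phi>' k x"
    using t unfolding t' G_def prod.case by blast+
  have eqs: "f k N = (\<lambda>x. Re (trig_poly (T k N) (a k N) x))"
      "f' k N = (\<lambda>x. Re (trig_poly (T k N) (\<lambda>m. \<i> * m * a k N m) x))" if "k \<in> I" for k N
    using f[OF that] f'[OF that] by (metis Re_complex_of_real)+
  have cont_f: "continuous_on UNIV (f k N)" "continuous_on UNIV (f' k N)" if "k \<in> I" for k N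
    unfolding eqs[OF that] by (intro continuous_intros continuous_trig_poly)+
  note meas_f = borel_measurable_continuous_onI[OF cont_f(1)] borel_measurable_continuous_onI[OF cont_f(2)]
  define D where "D N i j = pair_const \<bar>r i j\<bar> * (gaussian_mass \<bar>r i j\<bar> (\<lambda>x. \<bar>f' i N x\<bar>) *
     gaussian_mass \<bar>r i j\<bar> (\<lambda>x. \<bar>f' j N x\<bar>))" for N i j
  have bound: "\<bar>(prod_mean P X I (\<lambda>k. f k N)) - (prod_mean Q Y I (\<lambda>k. f k N))\<bar> \<le>
    (1 + 1 / (real N + 1)) ^ card I * (\<Sum>i\<in>I. \<Sum>j\<in>I-{i}. \<bar>r i j\<bar> * D N i j) / 2" for N
  proof (rule gaussian_comparison_trig_poly[OF I, where T = "\<lambda>k. T k N" and a = "\<lambda>k. a k N" and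
        f = "\<lambda>k. f k N" and f' = "\<lambda>k. f' k N" and B = "B + 1"])
    fix W :: "('a \<times> 'b) measure" and V and h :: real and i j
    assume *: "i \<in> I" "j \<in> I" "i \<noteq> j" "h \<in> {0..1}"
      "gaussian_family W V I (\<lambda>i j. if i = j then 1 else h * r i j)"
    show "(LINT \<omega>|W. \<bar>f' i N (V i \<omega>)\<bar> * \<bar>f' j N (V j \<omega>)\<bar>) \<le> D N i j"
      unfolding D_def gaussian_mass_def pair_const_def
    proof (rule gaussian_family_pair_bound[OF *(5) I *(1-3), where r = "h * r i j" and B = "B + 1"])
      show "\<bar>h * r i j\<bar> \<le> \<bar>r i j\<bar>"
        using *(4) by (auto simp: abs_mult mult_left_le_one_le)
      show "\<bar>r i j\<bar> < 1" using r(1) * by blast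
      show "continuous_on UNIV (\<lambda>x. \<bar>f' i N x\<bar>)" "continuous_on UNIV (\<lambda>x. \<bar>f' j N x\<bar>)"
        using cont_f * by (auto intro!: continuous_intros)
    qed (use * fb' r(2)[of i j] in auto)
  qed (use gP gQ Ta f f' fb fb' in auto)
  have mass: "(\<lambda>N. gaussian_mass \<rho> (\<lambda>x. \<bar>f' i N x\<bar>)) \<longlonglongrightarrow> gaussian_mass \<rho> (\<lambda>x. \<bar>\<phi>' i x\<bar>)"
    if i: "i \<in> I" and \<rho>: "\<rho> \<ge> 0" for i \<rho>
    unfolding gaussian_mass_def
  proof (rule integral_dominated_convergence)
    show "integrable lborel (\<lambda>x. (B + 1) * damp \<rho> x)"
      by (rule integrable_bounded_gaussian[where B = "\<bar>B + 1\<bar>"]) (use \<rho> in auto)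
    show "AE x in lborel. (\<lambda>N. \<bar>f' i N x\<bar> * damp \<rho> x)
        \<longlonglongrightarrow> \<bar>\<phi>' i x\<bar> * damp \<rho> x"
      using lim'[OF i] by (intro AE_I2 tendsto_intros)
    have [measurable]: "f' i N \<in> borel_measurable borel" for N
      by (rule meas_f(2)[OF i])
    have [measurable]: "\<phi>' i \<in> borel_measurable borel"
      by (rule borel_measurable_continuous_onI[OF cont[OF i]])
    show "(\<lambda>x. \<bar>f' i N x\<bar> * damp \<rho> x) \<in> borel_measurable lborel" for N
      by measurable
    show "(\<lambda>x. \<bar>\<phi>' i x\<bar> * damp \<rho> x) \<in> borel_measurable lborel"
      by measurable
    show "AE x in lborel. norm (\<bar>f' i N x\<bar> * damp \<rho> x)
         \<le> (B + 1) * damp \<rho> x" for N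
      using fb'[OF i] by (intro AE_I2) (auto simp: abs_mult intro!: mult_right_mono)
  qed
  have one: "(\<lambda>N. 1 + 1 / (real N + 1)) \<longlonglongrightarrow> 1"
    using tendsto_add[OF tendsto_const[of "1::real"] LIMSEQ_inverse_real_of_nat]
    by (simp add: inverse_eq_divide add.commute)
  have rhs: "(\<lambda>N. (1 + 1 / (real N + 1)) ^ card I * (\<Sum>i\<in>I. \<Sum>j\<in>I-{i}. \<bar>r i j\<bar> * D N i j) / 2)
    \<longlonglongrightarrow> 1 ^ card I * (\<Sum>i\<in>I. \<Sum>j\<in>I-{i}. \<bar>r i j\<bar> * (pair_const \<bar>r i j\<bar> *
      (gaussian_mass \<bar>r i j\<bar> (\<lambda>x. \<bar>\<phi>' i x\<bar>) * gaussian_mass \<bar>r i j\<bar> (\<lambda>x. \<bar>\<phi>' j x\<bar>)))) / 2"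
    unfolding D_def by (intro tendsto_intros one mass) auto
  have "(\<lambda>N. prod_mean P X I (\<lambda>k. f k N)) \<longlonglongrightarrow> (prod_mean P X I \<phi>)"
       "(\<lambda>N. prod_mean Q Y I (\<lambda>k. f k N)) \<longlonglongrightarrow> (prod_mean Q Y I \<phi>)"
  proof -
    have "\<bar>f k N x\<bar> \<le> 2" if "k \<in> I" for k N x
      using order_trans[OF fb[OF that, of N x], of 2] by simp
    then show "(\<lambda>N. prod_mean P X I (\<lambda>k. f k N)) \<longlonglongrightarrow> (prod_mean P X I \<phi>)"
       "(\<lambda>N. prod_mean Q Y I (\<lambda>k. f k N)) \<longlonglongrightarrow> (prod_mean Q Y I \<phi>)"
      using gP gQ I lim meas_f(1) unfolding gaussian_family_def
      by (auto intro!: integral_prod_tendsto[where B = 2])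
  qed
  from LIMSEQ_le[OF tendsto_rabs[OF tendsto_diff[OF this]] rhs] bound
  show ?thesis by auto
qed

section \<open>Smoothing of step functions\<close>

definition ramp :: "real \<Rightarrow> real" where
  "ramp x = 2 * ((max 0 x)\<^sup>2 - 2 * (max 0 (x - 1/2))\<^sup>2 + (max 0 (x - 1))\<^sup>2)"

text \<open>The triangular bump on [0, 1] of height 2 and integral 1. It is the derivative of
  \<open>ramp\<close>, a quadratic spline rising from 0 to 1, so that the smoothed steps have the
  continuous derivative required by the comparison.\<close>

definition tent :: "real \<Rightarrow> real" where
  "tent x = 4 * (max 0 x - 2 * max 0 (x - 1/2) + max 0 (x - 1))"

lemma has_real_derivative_max_0_square:
  "((\<lambda>x. (max 0 x)\<^sup>2) has_real_derivative 2 * max 0 x) (at (x::real))"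
proof (cases x "0 :: real" rule: linorder_cases)
  case less
  have "\<forall>\<^sub>F y in nhds x. (max 0 y)\<^sup>2 = (0::real)"
    using eventually_nhds_in_open[of "{..<0}" x] less by (auto elim!: eventually_mono)
  from DERIV_cong_ev[OF refl this refl, of 0] show ?thesis using less by simp
next
  case greater
  have "((\<lambda>x. x\<^sup>2) has_real_derivative 2 * x) (at x)" by (auto intro!: derivative_eq_intros)
  moreover have "\<forall>\<^sub>F y in nhds x. (max 0 y)\<^sup>2 = (y\<^sup>2::real)"
    using eventually_nhds_in_open[of "{0<..}" x] greater by (auto elim!: eventually_mono)
  ultimately show ?thesis
    using DERIV_cong_ev[of x x "\<lambda>x. (max 0 x)\<^sup>2" "\<lambda>x. x\<^sup>2" "2 * x" "2 * x"] greater by simp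
next
  case equal
  have "((\<lambda>h::real. (max 0 h)\<^sup>2 / h) \<longlongrightarrow> 0) (at 0)"
  proof (rule Lim_null_comparison)
    show "\<forall>\<^sub>F h in at 0. norm ((max 0 h)\<^sup>2 / h) \<le> \<bar>h::real\<bar>"
      by (intro always_eventually) (auto simp: max_def power2_eq_square)
  qed (auto intro!: tendsto_eq_intros)
  then show ?thesis using equal by (simp add: DERIV_def)
qed

lemma ramp_deriv: "(ramp has_real_derivative tent x) (at x)"
proof -
  have d: "((\<lambda>x. (max 0 (x - c))\<^sup>2) has_real_derivative 2 * max 0 (x - c) * 1) (at x)" for c :: real
    by (rule DERIV_chain2[OF has_real_derivative_max_0_square]) (auto intro!: derivative_eq_intros)
  have "(ramp has_real_derivative 2 * ((2 * max 0 x - 2 * (2 * max 0 (x - 1/2) * 1)) + 2 * max 0 (x - 1) * 1)) (at x)"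
    unfolding ramp_def[abs_def]
    by (intro DERIV_cmult DERIV_add DERIV_diff has_real_derivative_max_0_square d)
  then show ?thesis by (simp add: tent_def algebra_simps)
qed

lemma ramp_0: "x \<le> 0 \<Longrightarrow> ramp x = 0"
  and ramp_1: "x \<ge> 1 \<Longrightarrow> ramp x = 1"
  by (auto simp: ramp_def max_def power2_eq_square algebra_simps)

lemma tent_nonneg: "0 \<le> tent x" and tent_le: "tent x \<le> 2"
  and tent_0: "x \<le> 0 \<or> x \<ge> 1 \<Longrightarrow> tent x = 0"
  by (auto simp: tent_def max_def)

lemma tent_pos: "tent x \<noteq> 0 \<Longrightarrow> 0 < x"
  and tent_less_1: "tent x \<noteq> 0 \<Longrightarrow> x < 1"
  using tent_0[of x] by linarith+

lemma continuous_tent: "continuous_on A tent"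
  unfolding tent_def[abs_def] by (intro continuous_intros)

lemma borel_measurable_tent [measurable]: "tent \<in> borel_measurable borel"
  by (intro borel_measurable_continuous_onI continuous_tent)

lemma ramp_mono: "x \<le> y \<Longrightarrow> ramp x \<le> ramp y"
  using DERIV_nonneg_imp_nondecreasing[of x y ramp] ramp_deriv tent_nonneg by blast

lemma ramp_bounds: "0 \<le> ramp x" "ramp x \<le> 1"
  using ramp_mono[of "min 0 x" x] ramp_mono[of x "max 1 x"] ramp_0[of "min 0 x"] ramp_1[of "max 1 x"] by auto

lemma has_bochner_integral_tent: "has_bochner_integral lborel tent 1"
proof -
  have "has_bochner_integral lborel (\<lambda>x. tent x * indicator {0..1} x) (ramp 1 - ramp 0)"
    by (rule has_bochner_integral_FTC_Icc_nonneg)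
      (auto simp: tent_nonneg continuous_tent ramp_deriv has_field_derivative_at_within
        simp flip: has_real_derivative_iff_has_vector_derivative)
  moreover have "(\<lambda>x. tent x * indicator {0..1} x) = tent"
    using tent_pos tent_less_1 by (force simp: fun_eq_iff indicator_def)
  ultimately show ?thesis by (simp add: ramp_0 ramp_1)
qed

lemma has_bochner_integral_tent_affine:
  assumes "c \<noteq> 0"
  shows "has_bochner_integral lborel (\<lambda>x. \<bar>c\<bar> * tent (t + c * x)) 1"
proof -
  have "has_bochner_integral lborel (\<lambda>x. tent (t + c * x)) (1 /\<^sub>R \<bar>c\<bar>)"
    using lborel_has_bochner_integral_real_affine_iff[OF assms, of tent 1 t] has_bochner_integral_tent by simp
  from has_bochner_integral_mult_right[OF this, of "\<bar>c\<bar>"] show ?thesis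
    using assms by simp
qed

text \<open>The bump has integral one whatever the slope \<open>c\<close>, so its integral against
  the Gaussian weight is at most the largest weight on its support. The bound is free of
  \<open>c\<close> and survives infinite slope.\<close>

lemma gaussian_mass_tent_affine:
  assumes c: "c \<noteq> 0" and supp: "\<And>x. tent (t + c * x) \<noteq> 0 \<Longrightarrow> v \<le> \<bar>x\<bar>" and v: "v \<ge> 0" and \<rho>: "\<rho> \<ge> 0"
  shows "gaussian_mass \<rho> (\<lambda>x. \<bar>c\<bar> * tent (t + c * x)) \<le> damp \<rho> v"
proof -
  have i: "integrable lborel (\<lambda>x. \<bar>c\<bar> * tent (t + c * x))" "(LINT x|lborel. \<bar>c\<bar> * tent (t + c * x)) = 1"
    using has_bochner_integral_tent_affine[OF c, of t] by (auto simp: has_bochner_integral_iff)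
  have "gaussian_mass \<rho> (\<lambda>x. \<bar>c\<bar> * tent (t + c * x)) \<le>
    (LINT x|lborel. (\<bar>c\<bar> * tent (t + c * x)) * damp \<rho> v)"
    unfolding gaussian_mass_def
  proof (rule integral_mono)
    show "integrable lborel (\<lambda>x. (\<bar>c\<bar> * tent (t + c * x)) * damp \<rho> x)"
      by (rule integrable_bounded_gaussian[where B = "\<bar>c\<bar> * 2"])
        (use \<rho> tent_nonneg tent_le in \<open>auto simp: abs_mult intro!: mult_left_mono\<close>)
    show "integrable lborel (\<lambda>x. (\<bar>c\<bar> * tent (t + c * x)) * damp \<rho> v)"
      using i(1) by (rule integrable_mult_left)
    fix x
    show "(\<bar>c\<bar> * tent (t + c * x)) * damp \<rho> x \<le> (\<bar>c\<bar> * tent (t + c * x)) * damp \<rho> v"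
    proof (cases "tent (t + c * x) = 0")
      case False
      then have "v\<^sup>2 \<le> x\<^sup>2" using supp[OF False] v by (simp add: abs_le_square_iff[symmetric])
      then have "- x\<^sup>2 / (2 * (1 + \<rho>)) \<le> - v\<^sup>2 / (2 * (1 + \<rho>))"
        using \<rho> by (intro divide_right_mono) auto
      then show ?thesis using tent_nonneg by (intro mult_left_mono mult_nonneg_nonneg) auto
    qed auto
  qed
  also have "\<dots> = damp \<rho> v"
    unfolding integral_mult_left_zero i(2) by simp
  finally show ?thesis .
qed

lemma gaussian_mass_linear:
  assumes "\<psi>1 \<in> borel_measurable borel" "\<psi>2 \<in> borel_measurable borel"
    and "\<And>x. \<bar>\<psi>1 x\<bar> \<le> C" "\<And>x. \<bar>\<psi>2 x\<bar> \<le> C" "\<rho> \<ge> 0"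
  shows "gaussian_mass \<rho> (\<lambda>x. a * \<psi>1 x + b * \<psi>2 x) = a * gaussian_mass \<rho> \<psi>1 + b * gaussian_mass \<rho> \<psi>2"
proof -
  have "integrable lborel (\<lambda>x. \<psi>1 x * damp \<rho> x)"
       "integrable lborel (\<lambda>x. \<psi>2 x * damp \<rho> x)"
    using assms by (blast intro: integrable_bounded_gaussian)+
  then show ?thesis
    unfolding gaussian_mass_def distrib_right mult.assoc
    by (subst Bochner_Integration.integral_add) auto
qed

text \<open>Steps are limits of ramps with slope \<open>m N\<close>, and
  \<open>gaussian_mass_tent_affine\<close> keeps the bound independent of that slope. Each index has
  two jumps, of heights \<open>A k\<close> and \<open>B k\<close>, whence the factor
  \<open>A k + B k\<close>.\<close>

lemma gaussian_comparison_step: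
  fixes A B a b w :: "'i \<Rightarrow> real" and P :: "'a measure" and Q :: "'b measure"
  assumes I: "finite I"
    and gP: "gaussian_family P X I (\<lambda>i j. if i = j then 1 else r i j)"
    and gQ: "gaussian_family Q Y I (\<lambda>i j. if i = j then 1 else 0)"
    and r: "\<And>i j. i \<in> I \<Longrightarrow> j \<in> I \<Longrightarrow> i \<noteq> j \<Longrightarrow> \<bar>r i j\<bar> < 1" "\<And>i j. r i j = r j i"
    and AB: "\<And>k. k \<in> I \<Longrightarrow> A k \<in> {0..1}" "\<And>k. k \<in> I \<Longrightarrow> B k \<in> {0..1}"
    and w: "\<And>k. k \<in> I \<Longrightarrow> 0 \<le> w k" "\<And>k. k \<in> I \<Longrightarrow> w k \<le> a k" "\<And>k. k \<in> I \<Longrightarrow> w k \<le> b k"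
  defines "\<phi> \<equiv> (\<lambda>k x. 1 - A k * (if x > a k then 1 else 0) - B k * (if x \<le> - b k then 1 else 0))"
  shows "\<bar>(prod_mean P X I \<phi>) - (prod_mean Q Y I \<phi>)\<bar> \<le>
    (\<Sum>i\<in>I. \<Sum>j\<in>I-{i}. \<bar>r i j\<bar> * (pair_const \<bar>r i j\<bar> *
      (((A i + B i) * damp \<bar>r i j\<bar> (w i)) *
       ((A j + B j) * damp \<bar>r i j\<bar> (w j))))) / 2"
proof -
  define m where "m N = real N + 1" for N :: nat
  \<comment> \<open>The offsets place the first transition on (a, a + 1/m) and the second on (-b, -b
    + 1/m), so that in the limit the upper indicator is strict and the lower one includes its
    endpoint.\<close>
  let ?la = "\<lambda>N k x. - (m N * a k) + m N * x" and ?lb = "\<lambda>N k x. (1 - m N * b k) + (- m N) * x"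
  define \<phi>N where "\<phi>N N k x = 1 - A k * ramp (?la N k x) - B k * ramp (?lb N k x)" for N k x
  define \<psi> where "\<psi> N k x = - (A k * (m N * tent (?la N k x))) + B k * (m N * tent (?lb N k x))" for N k x
  \<comment> \<open>The second transition lies on the inner side of \<open>- b k\<close>, so the
    derivatives are only known to vanish at distance less than \<open>w k - 1 / m N\<close> from
    0.\<close>
  define v where "v N k = max 0 (w k - 1 / m N)" for N k
  have m: "m N > 0" for N by (simp add: m_def)
  have frac: "c * y \<le> z" if "c \<in> {0..1}" "0 \<le> y" "y \<le> z" for c y z :: real
    using that mult_mono[of c 1 y z] by auto
  have bound: "\<bar>(prod_mean P X I (\<phi>N N)) - (prod_mean Q Y I (\<phi>N N))\<bar> \<le>
     (\<Sum>i\<in>I. \<Sum>j\<in>I-{i}. \<bar>r i j\<bar> * (pair_const \<bar>r i j\<bar> *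
      (((A i + B i) * damp \<bar>r i j\<bar> (v N i)) *
       ((A j + B j) * damp \<bar>r i j\<bar> (v N j))))) / 2" for N
  proof -
    have mass: "gaussian_mass \<rho> (\<lambda>x. \<bar>\<psi> N k x\<bar>) \<le> (A k + B k) * damp \<rho> (v N k)"
      if k: "k \<in> I" and \<rho>: "\<rho> \<ge> 0" for k \<rho>
    proof -
      let ?t1 = "\<lambda>x. \<bar>m N\<bar> * tent (?la N k x)"
      let ?t2 = "\<lambda>x. \<bar>- m N\<bar> * tent (?lb N k x)"
      have tb: "0 \<le> \<bar>m N\<bar> * tent y" "\<bar>m N\<bar> * tent y \<le> \<bar>m N\<bar> * 2" for y
        using tent_nonneg tent_le by (auto intro!: mult_left_mono)
      have "gaussian_mass \<rho> (\<lambda>x. \<bar>\<psi> N k x\<bar>) \<le> gaussian_mass \<rho> (\<lambda>x. A k * ?t1 x + B k * ?t2 x)"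
      proof (rule gaussian_mass_mono[where B = "\<bar>m N\<bar> * 2 + \<bar>m N\<bar> * 2"])
        fix x
        have "\<bar>\<psi> N k x\<bar> \<le> \<bar>A k * (m N * tent (?la N k x))\<bar> + \<bar>B k * (m N * tent (?lb N k x))\<bar>"
          unfolding \<psi>_def by (simp only: abs_triangle_ineq[THEN order_trans] abs_minus_cancel)
        also have "\<dots> = A k * ?t1 x + B k * ?t2 x"
          using AB[OF k] m[of N] tent_nonneg by (simp add: abs_mult)
        finally show "\<bar>\<psi> N k x\<bar> \<le> A k * ?t1 x + B k * ?t2 x" .
        have "A k * ?t1 x \<le> \<bar>m N\<bar> * 2" "B k * ?t2 x \<le> \<bar>m N\<bar> * 2"
          unfolding abs_minus_cancel by (rule frac[OF AB(1)[OF k] tb]) (rule frac[OF AB(2)[OF k] tb])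
        then show "A k * ?t1 x + B k * ?t2 x \<le> \<bar>m N\<bar> * 2 + \<bar>m N\<bar> * 2" by linarith
      qed (use \<rho> in \<open>auto simp: \<psi>_def\<close>)
      also have "\<dots> = A k * gaussian_mass \<rho> ?t1 + B k * gaussian_mass \<rho> ?t2"
        by (rule gaussian_mass_linear[where C = "\<bar>m N\<bar> * 2"]) (use tb \<rho> in \<open>auto simp: abs_mult tent_nonneg tent_le\<close>)
      also have "\<dots> \<le> A k * damp \<rho> (v N k) + B k * damp \<rho> (v N k)"
      proof (intro add_mono mult_left_mono gaussian_mass_tent_affine)
        fix x assume "tent (?la N k x) \<noteq> 0"
        then have "- (m N * a k) + m N * x > 0" by (rule tent_pos)
        then have "x > a k" using m[of N] by (simp add: mult_less_cancel_left_pos)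
        then show "v N k \<le> \<bar>x\<bar>" using w[OF k] m[of N] by (auto simp: v_def) (smt (verit) divide_pos_pos)
      next
        fix x assume "tent (?lb N k x) \<noteq> 0"
        then have "(1 - m N * b k) + (- m N) * x > 0" by (rule tent_pos)
        then have "m N * (b k + x) < 1" by (simp add: algebra_simps)
        then have "b k + x < 1 / m N" using m[of N] by (simp add: field_simps)
        then show "v N k \<le> \<bar>x\<bar>" using w[OF k] by (auto simp: v_def)
      qed (use AB[OF k] m[of N] \<rho> in \<open>auto simp: v_def\<close>)
      finally show ?thesis by (simp add: distrib_right)
    qed
    have "\<bar>(prod_mean P X I (\<phi>N N)) - (prod_mean Q Y I (\<phi>N N))\<bar> \<le>
     (\<Sum>i\<in>I. \<Sum>j\<in>I-{i}. \<bar>r i j\<bar> * (pair_const \<bar>r i j\<bar> *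
      (gaussian_mass \<bar>r i j\<bar> (\<lambda>x. \<bar>\<psi> N i x\<bar>) * gaussian_mass \<bar>r i j\<bar> (\<lambda>x. \<bar>\<psi> N j x\<bar>)))) / 2"
    proof (rule gaussian_comparison_C1[OF I gP gQ r, where B = "m N * 2 + m N * 2"])
      fix k x assume k: "k \<in> I"
      have d: "((\<lambda>x. ramp (t + c * x)) has_real_derivative tent (t + c * x) * c) (at x)" for t c
        by (rule DERIV_chain2[OF ramp_deriv]) (auto intro!: derivative_eq_intros)
      have "(\<phi>N N k has_real_derivative (0 - A k * (tent (?la N k x) * m N)
         - B k * (tent (?lb N k x) * (- m N)))) (at x)"
        unfolding \<phi>N_def[abs_def] by (intro DERIV_diff DERIV_cmult DERIV_const d)
      then show "(\<phi>N N k has_real_derivative \<psi> N k x) (at x)"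
        by (simp add: \<psi>_def mult_ac)
      have "A k * ramp (?la N k x) \<le> 1" "B k * ramp (?lb N k x) \<le> 1"
        using frac[OF AB(1)[OF k] ramp_bounds] frac[OF AB(2)[OF k] ramp_bounds] by blast+
      moreover have "0 \<le> A k * ramp (?la N k x)" "0 \<le> B k * ramp (?lb N k x)"
        using AB[OF k] ramp_bounds by auto
      ultimately show "\<bar>\<phi>N N k x\<bar> \<le> 1" unfolding \<phi>N_def by linarith
      have tb: "0 \<le> m N * tent y" "m N * tent y \<le> m N * 2" for y
        using tent_nonneg tent_le m[of N] by (auto simp del: mult_le_cancel_left_pos intro!: mult_left_mono)
      have "A k * (m N * tent (?la N k x)) \<le> m N * 2"
        "B k * (m N * tent (?lb N k x)) \<le> m N * 2"
        by (rule frac[OF AB(1)[OF k] tb]) (rule frac[OF AB(2)[OF k] tb])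
      moreover have "0 \<le> A k * (m N * tent (?la N k x))"
        "0 \<le> B k * (m N * tent (?lb N k x))"
        using AB[OF k] tent_nonneg m[of N] by auto
      ultimately show "\<bar>\<psi> N k x\<bar> \<le> m N * 2 + m N * 2" unfolding \<psi>_def by linarith
      show "continuous_on UNIV (\<psi> N k)"
        unfolding \<psi>_def[abs_def]
        by (intro continuous_intros continuous_on_compose2[OF continuous_tent[of UNIV]]) auto
    qed
    also have "\<dots> \<le> (\<Sum>i\<in>I. \<Sum>j\<in>I-{i}. \<bar>r i j\<bar> * (pair_const \<bar>r i j\<bar> *
      (((A i + B i) * damp \<bar>r i j\<bar> (v N i)) *
       ((A j + B j) * damp \<bar>r i j\<bar> (v N j))))) / 2"
    proof (intro divide_right_mono sum_mono mult_left_mono mult_mono mass)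
      fix i j assume ij: "i \<in> I" "j \<in> I - {i}"
      then show "0 \<le> pair_const \<bar>r i j\<bar>"
        using r(1)[of i j] by (intro pair_const_nonneg) (auto simp: less_imp_le)
      show "0 \<le> (A i + B i) * damp \<bar>r i j\<bar> (v N i)"
        using AB ij by (auto intro!: mult_nonneg_nonneg)
    qed (auto intro!: gaussian_mass_nonneg)
    finally show ?thesis .
  qed
  have m_top: "filterlim m at_top sequentially"
    using filterlim_tendsto_add_at_top[OF tendsto_const[of "1::real"] filterlim_real_sequentially]
    by (simp add: m_def[abs_def] add.commute)
  have vlim: "(\<lambda>N. v N k) \<longlonglongrightarrow> w k" if "k \<in> I" for k
  proof -
    have "(\<lambda>N. max 0 (w k - 1 / m N)) \<longlonglongrightarrow> max 0 (w k - 0)"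
      by (intro tendsto_intros tendsto_divide_0[OF tendsto_const] filterlim_at_top_imp_at_infinity m_top)
    then show ?thesis using w(1)[OF that] by (simp add: v_def)
  qed
  have rhs: "(\<lambda>N. (\<Sum>i\<in>I. \<Sum>j\<in>I-{i}. \<bar>r i j\<bar> * (pair_const \<bar>r i j\<bar> *
      (((A i + B i) * damp \<bar>r i j\<bar> (v N i)) *
       ((A j + B j) * damp \<bar>r i j\<bar> (v N j))))) / 2) \<longlonglongrightarrow>
      (\<Sum>i\<in>I. \<Sum>j\<in>I-{i}. \<bar>r i j\<bar> * (pair_const \<bar>r i j\<bar> *
      (((A i + B i) * damp \<bar>r i j\<bar> (w i)) *
       ((A j + B j) * damp \<bar>r i j\<bar> (w j))))) / 2"
    by (intro tendsto_intros vlim) auto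
  have \<phi>_lim: "(\<lambda>N. \<phi>N N k x) \<longlonglongrightarrow> \<phi> k x" for k x
  proof -
    have large: "\<forall>\<^sub>F N in sequentially. c < m N" for c
      using m_top by (simp add: filterlim_at_top_dense)
    have "\<forall>\<^sub>F N in sequentially. ramp (?la N k x) = (if x > a k then 1 else 0)"
    proof (cases "x > a k")
      case True
      from large[of "1 / (x - a k)"] show ?thesis
        by eventually_elim (use True in \<open>auto intro!: ramp_1 simp: field_simps\<close>)
    next
      case False
      then show ?thesis using m by (auto intro!: always_eventually ramp_0 simp: mult_left_mono less_imp_le)
    qed
    moreover have "\<forall>\<^sub>F N in sequentially. ramp (?lb N k x) = (if x \<le> - b k then 1 else 0)"
    proof (cases "x \<le> - b k")
      case True
      have "m N * b k + m N * x \<le> 0" for N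
        using True m[of N] by (simp add: mult_le_0_iff flip: distrib_left)
      then show ?thesis using True by (auto intro!: always_eventually ramp_1 simp: algebra_simps)
    next
      case False
      from large[of "1 / (x + b k)"] show ?thesis
        by eventually_elim (use False in \<open>auto intro!: ramp_0 simp: field_simps\<close>)
    qed
    ultimately have "\<forall>\<^sub>F N in sequentially. \<phi>N N k x = \<phi> k x"
      by eventually_elim (simp add: \<phi>N_def \<phi>_def)
    then show ?thesis by (rule tendsto_eventually)
  qed
  have bd3: "\<bar>\<phi>N N k x\<bar> \<le> 3" if k: "k \<in> I" for N k x
  proof -
    have "A k * ramp y \<le> 1" "B k * ramp y \<le> 1" "0 \<le> A k * ramp y" "0 \<le> B k * ramp y" for y
      using frac[OF AB(1)[OF k] ramp_bounds] frac[OF AB(2)[OF k] ramp_bounds] AB[OF k] ramp_bounds by auto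
    from this(1,3)[of "- (m N * a k) + m N * x"] this(2,4)[of "(1 - m N * b k) + (- m N) * x"]
    show ?thesis unfolding \<phi>N_def by linarith
  qed
  have meas3: "\<phi>N N k \<in> borel_measurable borel" for N k
  proof -
    have "continuous_on UNIV ramp"
      using DERIV_isCont[OF ramp_deriv] by (simp add: continuous_on_eq_continuous_at)
    then have [measurable]: "ramp \<in> borel_measurable borel" by (rule borel_measurable_continuous_onI)
    show ?thesis unfolding \<phi>N_def[abs_def] by measurable
  qed
  have "(\<lambda>N. prod_mean P X I (\<phi>N N)) \<longlonglongrightarrow> (prod_mean P X I \<phi>)"
       "(\<lambda>N. prod_mean Q Y I (\<phi>N N)) \<longlonglongrightarrow> (prod_mean Q Y I \<phi>)"
    using gP gQ I \<phi>_lim meas3 bd3 unfolding gaussian_family_def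
    by (auto intro!: integral_prod_tendsto[where B = 3])
  from LIMSEQ_le[OF tendsto_rabs[OF tendsto_diff[OF this]] rhs] bound
  show ?thesis by auto
qed

section \<open>Order statistics and Poisson limits\<close>

lemma less_nth_sorted_iff:
  fixes zs :: "real list"
  assumes "sorted zs" "j < length zs"
  shows "c < zs ! j \<longleftrightarrow> length (filter (\<lambda>z. z \<le> c) zs) \<le> j"
  using assms
proof (induction zs arbitrary: j)
  case (Cons z zs)
  show ?case
  proof (cases "z \<le> c")
    case True
    then show ?thesis using Cons by (cases j) auto
  next
    case False
    then have "\<forall>y\<in>set zs. c < y" using Cons.prems by force
    then have "filter (\<lambda>z. z \<le> c) zs = []" by (force simp: filter_empty_conv)
    moreover have "c < (z # zs) ! j"
      using \<open>\<forall>y\<in>set zs. c < y\<close> False Cons.prems by (cases j) auto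
    ultimately show ?thesis using False by simp
  qed
qed auto

lemma length_filter_sort_upt:
  "length (filter Q (sort (map y [1..<Suc n]))) = card {i\<in>{1..n}. Q (y i)}"
proof -
  have "length (filter Q (sort (map y [1..<Suc n]))) = length (filter Q (map y [1..<Suc n]))"
    by (simp add: filter_sort)
  also have "\<dots> = card {i. i < length (map y [1..<Suc n]) \<and> Q (map y [1..<Suc n] ! i)}"
    by (rule length_filter_conv_card)
  \<comment> \<open>List positions start at 0 and indices at 1: position \<open>i\<close> carries
    the value with index \<open>Suc i\<close>.\<close>
  also have "\<dots> = card {i\<in>{1..n}. Q (y i)}"
    by (rule bij_betw_same_card[where f = Suc], rule bij_betwI[where g = "\<lambda>i. i - 1"]) (auto simp del: upt_Suc)
  finally show ?thesis .
qed

lemma less_nth_sort_upt_iff: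
  fixes c :: real
  assumes "j < n"
  shows "c < sort (map y [1..<Suc n]) ! j \<longleftrightarrow> card {i\<in>{1..n}. y i \<le> c} \<le> j"
  unfolding length_filter_sort_upt[of "\<lambda>z. z \<le> c" y n, symmetric]
  using assms by (intro less_nth_sorted_iff) (simp_all del: upt_Suc)

lemma less_lth_smallest_iff:
  assumes "1 \<le> l" "l \<le> n"
  shows "c < lth_smallest l n y \<longleftrightarrow> card {i\<in>{1..n}. y i \<le> c} < l"
  unfolding lth_smallest_def using assms less_nth_sort_upt_iff[of "l - 1" n c y] by linarith

lemma kth_largest_le_iff:
  assumes "1 \<le> k" "k \<le> n"
  shows "kth_largest k n y \<le> c \<longleftrightarrow> card {i\<in>{1..n}. y i > c} < k"
proof -
  \<comment> \<open>Position \<open>k - 1\<close> of the reversed list is position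
    \<open>n - k\<close> of the sorted one.\<close>
  have "kth_largest k n y = sort (map y [1..<Suc n]) ! (n - k)"
    unfolding kth_largest_def using assms by (subst rev_nth) (auto simp del: upt_Suc)
  then have "kth_largest k n y \<le> c \<longleftrightarrow> \<not> card {i\<in>{1..n}. y i \<le> c} \<le> n - k"
    using assms less_nth_sort_upt_iff[of "n - k" n c y] by linarith
  moreover have "card {i\<in>{1..n}. y i \<le> c} + card {i\<in>{1..n}. y i > c} = n"
  proof -
    have "card ({i\<in>{1..n}. y i \<le> c} \<union> {i\<in>{1..n}. y i > c}) =
        card {i\<in>{1..n}. y i \<le> c} + card {i\<in>{1..n}. y i > c}"
      by (rule card_Un_disjoint) auto
    moreover have "{i\<in>{1..n}. y i \<le> c} \<union> {i\<in>{1..n}. y i > c} = {1..n}" by auto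
    ultimately show ?thesis by simp
  qed
  ultimately show ?thesis using assms by linarith
qed

section \<open>Poisson limits from generating functions\<close>

lemma expectation_poisson_pmf:
  assumes \<mu>: "\<mu> > 0" and z: "0 \<le> z" "z \<le> 1"
  shows "measure_pmf.expectation (poisson_pmf \<mu>) (\<lambda>a. z ^ a) = exp (- (1 - z) * \<mu>)"
proof -
  have s: "(\<lambda>a. exp (- \<mu>) * ((z * \<mu>) ^ a /\<^sub>R fact a)) sums (exp (- \<mu>) * exp (z * \<mu>))"
    by (intro sums_mult exp_converges)
  have eq: "pmf (poisson_pmf \<mu>) a * z ^ a = exp (- \<mu>) * ((z * \<mu>) ^ a /\<^sub>R fact a)" for a
    using \<mu> by (simp add: pmf_poisson power_mult_distrib divide_inverse mult_ac)
  have "integrable (count_space UNIV) (\<lambda>a. pmf (poisson_pmf \<mu>) a * z ^ a)"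
    unfolding integrable_count_space_nat_iff eq
    using s z \<mu> by (auto simp: sums_iff)
  then have "measure_pmf.expectation (poisson_pmf \<mu>) (\<lambda>a. z ^ a) = (\<Sum>a. pmf (poisson_pmf \<mu>) a * z ^ a)"
    by (simp add: measure_pmf_eq_density integral_density integral_count_space_nat)
  also have "\<dots> = exp (- \<mu>) * exp (z * \<mu>)"
    unfolding eq using s by (simp add: sums_iff)
  finally show ?thesis by (simp add: algebra_simps flip: exp_add)
qed

lemma expectation_poisson_pmf_less:
  assumes \<mu>: "\<mu> > 0"
  shows "measure_pmf.expectation (poisson_pmf \<mu>) (\<lambda>a. if a < k then 1 else 0) = exp (- \<mu>) * (\<Sum>i<k. \<mu> ^ i / fact i)"
proof -
  have "measure_pmf.expectation (poisson_pmf \<mu>) (\<lambda>a. if a < k then 1 else 0) =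
      measure_pmf.expectation (poisson_pmf \<mu>) (indicator {..<k})"
    by (intro Bochner_Integration.integral_cong) (auto simp: indicator_def)
  also have "\<dots> = (\<Sum>i<k. pmf (poisson_pmf \<mu>) i)"
    by (simp add: measure_measure_pmf_finite)
  also have "\<dots> = exp (- \<mu>) * (\<Sum>i<k. \<mu> ^ i / fact i)"
    using \<mu> by (simp add: sum_distrib_left pmf_poisson mult_ac)
  finally show ?thesis .
qed

text \<open>The pair \<open>((1/2)^N, (1/2)^N')\<close> lives in the compact square, so its mixed moments determine the
  limit; the indicator of \<open>N < k\<close> is a continuous function of \<open>(1/2)^N\<close>.\<close>

lemma (in prob_space) poisson_limit_of_generating_functions:
  fixes N N' :: "nat \<Rightarrow> 'a \<Rightarrow> nat"
  assumes pos: "\<kappa> > 0" "\<mu> > 0"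
    and meas: "\<And>n. N n \<in> measurable M (count_space UNIV)" "\<And>n. N' n \<in> measurable M (count_space UNIV)"
    and lim: "\<And>m m'. (\<lambda>n. expectation (\<lambda>\<omega>. ((1/2) ^ m) ^ N n \<omega> * ((1/2) ^ m') ^ N' n \<omega>)) \<longlonglongrightarrow>
      exp (- (1 - (1/2) ^ m) * \<kappa>) * exp (- (1 - (1/2) ^ m') * \<mu>)"
  shows "(\<lambda>n. prob {\<omega>\<in>space M. N n \<omega> < k \<and> N' n \<omega> < l}) \<longlonglongrightarrow>
    (exp (- \<kappa>) * (\<Sum>i<k. \<kappa> ^ i / fact i)) * (exp (- \<mu>) * (\<Sum>i<l. \<mu> ^ i / fact i))"
proof -
  note [measurable] = meas
  let ?P = "measure_pmf.expectation (poisson_pmf \<kappa>)" and ?Q = "measure_pmf.expectation (poisson_pmf \<mu>)"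
  let ?W = "\<lambda>a::nat. (1/2::real) ^ a"
  \<comment> \<open>Linear between \<open>2^(-k)\<close> and \<open>2^(1-k)\<close>, which are the
    points \<open>(1/2)^a\<close> for \<open>a = k\<close> and \<open>a = k - 1\<close>: hence 1 at
    those with \<open>a < k\<close> and 0 at those with \<open>a \<ge> k\<close>.\<close>
  define f where "f k x = max 0 (min 1 (x * 2 ^ k - 1))" for k :: nat and x :: real
  let ?E = "\<lambda>p q n. expectation (\<lambda>\<omega>. p (?W (N n \<omega>)) * q (?W (N' n \<omega>)))" and ?L = "\<lambda>p q. ?P (\<lambda>a. p (?W a)) * ?Q (\<lambda>a. q (?W a))"
  let ?Ef = "?E (f k) (f l)" and ?Lf = "?L (f k) (f l)"
  have f01: "0 \<le> f k x" "f k x \<le> 1" for k x by (auto simp: f_def)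
  have fW: "f k (?W a) = (if a < k then 1 else 0)" for k a
  proof (cases "a < k")
    case True
    then have "?W a * 2 ^ k = 2 ^ (k - a)" by (simp add: power_diff power_divide)
    moreover have "(2::real) ^ 1 \<le> 2 ^ (k - a)" using True by (intro power_increasing) auto
    ultimately show ?thesis using True by (simp add: f_def)
  next
    case False
    then have "?W a * 2 ^ k \<le> 1"
      using power_increasing[of k a "2::real"] by (simp add: power_divide divide_simps)
    then show ?thesis using False by (simp add: f_def)
  qed
  have W01: "?W a \<in> {0..1}" for a by (auto intro: power_le_one)
  have bint: "integrable M (\<lambda>\<omega>. h (N n \<omega>) (N' n \<omega>))" if "\<And>a b. \<bar>h a b\<bar> \<le> C" for h :: "nat \<Rightarrow> nat \<Rightarrow> real" and C n
    by (rule integrable_const_bound[of _ C]) (use that in auto)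
  have pint: "integrable (measure_pmf p) h" if "\<And>a. \<bar>h a\<bar> \<le> C" for h :: "nat \<Rightarrow> real" and C p
    by (rule measure_pmf.integrable_const_bound[of _ C]) (use that in auto)
  \<comment> \<open>A power of \<open>(1/2)^N\<close> is the integrand of the generating function at
    a power of 1/2, so the hypothesis covers all polynomials by linearity.\<close>
  have poly: "(\<lambda>n. ?E p q n) \<longlonglongrightarrow> ?L p q"
    if p: "real_polynomial_function p" and q: "real_polynomial_function q" for p q
  proof -
    obtain a d where p: "p = (\<lambda>x. \<Sum>i\<le>d. a i * x^i)" using p real_polynomial_function_iff_sum by auto
    obtain b e where q: "q = (\<lambda>x. \<Sum>i\<le>e. b i * x^i)" using q real_polynomial_function_iff_sum by auto
    have pw: "(((1::real)/2) ^ i) ^ j = ?W j ^ i" for i j by (simp add: power_commutes flip: power_mult) (simp add: mult.commute)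
    have bd1: "\<bar>?W j ^ i\<bar> \<le> 1" for i j using W01[of j] by (auto simp: power_abs intro: power_le_one)
    have bd2: "\<bar>?W j ^ i * ?W j' ^ i'\<bar> \<le> 1" for i j i' j'
      unfolding abs_mult by (rule mult_le_one[OF bd1 _ bd1]) auto
    have m1: "?E p q n =
        (\<Sum>i\<le>d. \<Sum>j\<le>e. a i * b j * expectation (\<lambda>\<omega>. ((1/2) ^ i) ^ N n \<omega> * ((1/2) ^ j) ^ N' n \<omega>))" for n
    proof -
      have "p (?W (N n \<omega>)) * q (?W (N' n \<omega>)) = (\<Sum>i\<le>d. \<Sum>j\<le>e. a i * b j * (?W (N n \<omega>) ^ i * ?W (N' n \<omega>) ^ j))" for \<omega>
        by (simp add: p q sum_product mult_ac)
      moreover have "integrable M (\<lambda>\<omega>. ?W (N n \<omega>) ^ i * ?W (N' n \<omega>) ^ j)" for i j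
        by (rule bint[of "\<lambda>x y. ?W x ^ i * ?W y ^ j", OF bd2])
      moreover have "expectation (\<lambda>\<omega>. ((1/2) ^ i) ^ N n \<omega> * ((1/2) ^ j) ^ N' n \<omega>) =
          expectation (\<lambda>\<omega>. ?W (N n \<omega>) ^ i * ?W (N' n \<omega>) ^ j)" for i j
        by (intro Bochner_Integration.integral_cong refl arg_cong2[of _ _ _ _ "(*)"] pw)
      ultimately show ?thesis
        by (simp add: Bochner_Integration.integral_sum)
    qed
    have m2: "measure_pmf.expectation (poisson_pmf \<nu>) (\<lambda>j. \<Sum>i\<le>d. a i * ?W j ^ i) =
        (\<Sum>i\<le>d. a i * exp (- (1 - (1/2) ^ i) * \<nu>))" if "\<nu> > 0" for \<nu> d and a :: "nat \<Rightarrow> real"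
    proof -
      have "integrable (measure_pmf (poisson_pmf \<nu>)) (\<lambda>j. ?W j ^ i)" for i
        by (rule pint[of "\<lambda>j. ?W j ^ i", OF bd1])
      moreover have "measure_pmf.expectation (poisson_pmf \<nu>) (\<lambda>j. ?W j ^ i) = exp (- (1 - (1/2) ^ i) * \<nu>)" for i
      proof -
        have "(\<lambda>j. ?W j ^ i) = (\<lambda>j. ((1/2) ^ i) ^ j)"
          by (rule ext) (rule pw[symmetric])
        then show ?thesis
          using expectation_poisson_pmf[OF that, of "(1/2) ^ i"] W01[of i] by simp
      qed
      ultimately show ?thesis
        by (simp add: Bochner_Integration.integral_sum)
    qed
    have "(\<lambda>n. ?E p q n) \<longlonglongrightarrow>
      (\<Sum>i\<le>d. \<Sum>j\<le>e. a i * b j * (exp (- (1 - (1/2) ^ i) * \<kappa>) * exp (- (1 - (1/2) ^ j) * \<mu>)))"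
      unfolding m1 by (intro tendsto_intros lim)
    also have "(\<Sum>i\<le>d. \<Sum>j\<le>e. a i * b j * (exp (- (1 - (1/2) ^ i) * \<kappa>) * exp (- (1 - (1/2) ^ j) * \<mu>))) =
      ?L p q"
      unfolding p q m2[OF pos(1)] m2[OF pos(2)] sum_product by (simp only: mult_ac)
    finally show ?thesis .
  qed
  have close: "\<bar>f k x * f l y - p x * q y\<bar> \<le> 3 * e"
    if "0 < e" "e \<le> 1" "x \<in> {0..1}" "y \<in> {0..1}"
      and p: "\<And>x. x \<in> {0..1} \<Longrightarrow> \<bar>f k x - p x\<bar> < e" and q: "\<And>x. x \<in> {0..1} \<Longrightarrow> \<bar>f l x - q x\<bar> < e"
    for e x y p q
  proof -
    have "f k x * f l y - p x * q y = f k x * (f l y - q y) + q y * (f k x - p x)"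
      by (simp add: algebra_simps)
    moreover have "\<bar>f k x\<bar> * \<bar>f l y - q y\<bar> \<le> 1 * e"
      using f01 q that by (intro mult_mono) (auto simp: less_imp_le)
    moreover have "\<bar>q y\<bar> \<le> 2"
      using f01[of l y] q[OF that(4)] that(2) by linarith
    then have "\<bar>q y\<bar> * \<bar>f k x - p x\<bar> \<le> 2 * e"
      using p[OF that(3)] by (intro mult_mono) auto
    ultimately show ?thesis
      unfolding abs_mult[symmetric] by linarith
  qed
  have "(\<lambda>n. ?Ef n) \<longlonglongrightarrow>
     ?Lf"
  proof (rule LIMSEQ_I)
    fix e0 :: real assume "0 < e0"
    \<comment> \<open>The error budget is \<open>3 * e\<close> before the limit, \<open>e\<close>
      for convergence and \<open>3 * e\<close> in the limit, altogether below \<open>10 * e\<close>.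
      The cap 1 keeps the polynomials bounded by 2.\<close>
    define e where "e = min 1 (e0 / 10)"
    have e: "0 < e" "e \<le> 1" "10 * e \<le> e0" using \<open>0 < e0\<close> by (auto simp: e_def)
    have "continuous_on {0..1} (f k)" for k unfolding f_def by (intro continuous_intros)
    then obtain p q where p: "real_polynomial_function p" "\<And>x. x \<in> {0..1} \<Longrightarrow> \<bar>f k x - p x\<bar> < e"
      and q: "real_polynomial_function q" "\<And>x. x \<in> {0..1} \<Longrightarrow> \<bar>f l x - q x\<bar> < e"
      using Stone_Weierstrass_real_polynomial_function[of "{0..1::real}" _ e] e(1) by (metis compact_Icc)
    have pq_bd: "\<bar>p x\<bar> \<le> 2" "\<bar>q x\<bar> \<le> 2" if "x \<in> {0..1}" for x
      using p(2)[OF that] q(2)[OF that] f01[of k x] f01[of l x] e by linarith+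
    have ff: "\<bar>f k x\<bar> \<le> 1" for k x using f01[of k x] by auto
    have "\<forall>\<^sub>F n in sequentially. \<bar>?E p q n -
         ?L p q\<bar> < e"
      using poly[OF p(1) q(1)] e(1) by (simp add: tendsto_iff dist_real_def)
    then obtain n0 where n0: "\<And>n. n \<ge> n0 \<Longrightarrow> \<bar>?E p q n -
         ?L p q\<bar> < e"
      by (auto simp: eventually_sequentially)
    have diff: "\<bar>?Ef n -
      ?E p q n\<bar> \<le> 3 * e" for n
    proof -
      have i1: "integrable M (\<lambda>\<omega>. f k (?W (N n \<omega>)) * f l (?W (N' n \<omega>)))"
        by (rule bint[of "\<lambda>a b. f k (?W a) * f l (?W b)" 1]) (use ff in \<open>auto simp: abs_mult intro: mult_le_one\<close>)
      have i2: "integrable M (\<lambda>\<omega>. p (?W (N n \<omega>)) * q (?W (N' n \<omega>)))"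
      proof (rule bint[of "\<lambda>a b. p (?W a) * q (?W b)" "2 * 2"])
        show "\<bar>p (?W a) * q (?W b)\<bar> \<le> 2 * 2" for a b
          unfolding abs_mult using pq_bd W01 by (intro mult_mono) auto
      qed
      have "\<bar>expectation (\<lambda>\<omega>. f k (?W (N n \<omega>)) * f l (?W (N' n \<omega>)) - p (?W (N n \<omega>)) * q (?W (N' n \<omega>)))\<bar>
         \<le> expectation (\<lambda>\<omega>. 3 * e)"
        using i1 i2 close[OF e(1,2) W01 W01 p(2) q(2)]
        by (intro order_trans[OF integral_abs_bound integral_mono] integrable_abs Bochner_Integration.integrable_diff) auto
      then show ?thesis using i1 i2 by (simp add: prob_space)
    qed
    have pdiff: "\<bar>measure_pmf.expectation r (\<lambda>a. g (?W a)) - measure_pmf.expectation r (\<lambda>a. h (?W a))\<bar> \<le> e"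
      if gh: "\<And>x. x \<in> {0..1} \<Longrightarrow> \<bar>g x - h x\<bar> < e" and g: "\<And>x. \<bar>g x\<bar> \<le> 1" for r g h
    proof -
      have "\<bar>h (?W a)\<bar> \<le> 2" for a using gh[OF W01[of a]] g[of "?W a"] e by linarith
      then have i: "integrable (measure_pmf r) (\<lambda>a. g (?W a))" "integrable (measure_pmf r) (\<lambda>a. h (?W a))"
        using g by (auto intro: pint)
      have "\<bar>measure_pmf.expectation r (\<lambda>a. g (?W a) - h (?W a))\<bar> \<le> measure_pmf.expectation r (\<lambda>_. e)"
        using i gh[OF W01]
        by (intro order_trans[OF integral_abs_bound integral_mono] integrable_abs Bochner_Integration.integrable_diff)
          (auto simp: less_imp_le)
      then show ?thesis using i by simp
    qed
    have pbd: "\<bar>measure_pmf.expectation r (\<lambda>a. g (?W a))\<bar> \<le> C"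
      if "\<And>x. x \<in> {0..1} \<Longrightarrow> \<bar>g x\<bar> \<le> C" for r and g :: "real \<Rightarrow> real" and C
    proof -
      have "\<bar>measure_pmf.expectation r (\<lambda>a. g (?W a))\<bar> \<le> measure_pmf.expectation r (\<lambda>_. C)"
        using that W01 pint[of "\<lambda>a. g (?W a)" C]
        by (intro order_trans[OF integral_abs_bound integral_mono]) auto
      then show ?thesis by simp
    qed
    have limdiff: "\<bar>?Lf - ?L p q\<bar> \<le> 3 * e"
    proof -
      have "?Lf - ?L p q =
        ?P (\<lambda>a. f k (?W a)) * (?Q (\<lambda>a. f l (?W a)) - ?Q (\<lambda>a. q (?W a))) +
        ?Q (\<lambda>a. q (?W a)) * (?P (\<lambda>a. f k (?W a)) - ?P (\<lambda>a. p (?W a)))"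
        by (simp add: algebra_simps)
      moreover have "\<bar>?P (\<lambda>a. f k (?W a))\<bar> * \<bar>?Q (\<lambda>a. f l (?W a)) - ?Q (\<lambda>a. q (?W a))\<bar> \<le> 1 * e"
        using ff by (intro mult_mono pbd pdiff q(2)) auto
      moreover have "\<bar>?Q (\<lambda>a. q (?W a))\<bar> * \<bar>?P (\<lambda>a. f k (?W a)) - ?P (\<lambda>a. p (?W a))\<bar> \<le> 2 * e"
        using ff by (intro mult_mono pbd pq_bd pdiff p(2)) auto
      ultimately show ?thesis
        unfolding abs_mult[symmetric] by linarith
    qed
    show "\<exists>no. \<forall>n\<ge>no. norm (?Ef n -
      ?Lf) < e0"
    proof (intro exI[of _ n0] allI impI)
      fix n assume "n \<ge> n0"
      from n0[OF this] diff[of n] limdiff e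
      show "norm (?Ef n -
      ?Lf) < e0"
        unfolding real_norm_def by linarith
    qed
  qed
  moreover have "?Ef n =
      prob {\<omega>\<in>space M. N n \<omega> < k \<and> N' n \<omega> < l}" for n
  proof -
    have "?Ef n =
      expectation (indicator {\<omega>\<in>space M. N n \<omega> < k \<and> N' n \<omega> < l})"
      unfolding fW by (intro Bochner_Integration.integral_cong) (auto simp: indicator_def)
    also have "\<dots> = prob {\<omega>\<in>space M. N n \<omega> < k \<and> N' n \<omega> < l}"
      by (simp add: measurable_sets)
    finally show ?thesis .
  qed
  ultimately show ?thesis
    unfolding fW expectation_poisson_pmf_less[OF pos(1)] expectation_poisson_pmf_less[OF pos(2)] by simp
qed

section \<open>Stationary Gaussian sequences and scale mixtures\<close>

lemma (in prob_space) distr_eq_std_normal: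
  assumes "distributed M lborel Z std_normal_density"
  shows "distr M borel Z = std_normal_distribution"
  using distributed_distr_eq_density[OF assms] by (simp cong: distr_cong)

lemma (in prob_space) integrable_mult_square_integrable:
  fixes f g :: "'a \<Rightarrow> real"
  assumes [measurable]: "f \<in> borel_measurable M" "g \<in> borel_measurable M"
    and "integrable M (\<lambda>\<omega>. (f \<omega>)\<^sup>2)" "integrable M (\<lambda>\<omega>. (g \<omega>)\<^sup>2)"
  shows "integrable M (\<lambda>\<omega>. f \<omega> * g \<omega>)"
proof (rule Bochner_Integration.integrable_bound)
  show "integrable M (\<lambda>\<omega>. (f \<omega>)\<^sup>2 + (g \<omega>)\<^sup>2)" using assms by auto
  have "\<bar>f \<omega> * g \<omega>\<bar> \<le> (f \<omega>)\<^sup>2 + (g \<omega>)\<^sup>2" for \<omega>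
    using sum_squares_bound[of "\<bar>f \<omega>\<bar>" "\<bar>g \<omega>\<bar>"] mult_nonneg_nonneg[OF abs_ge_zero[of "f \<omega>"] abs_ge_zero[of "g \<omega>"]]
    unfolding power2_abs abs_mult by linarith
  then show "AE \<omega> in M. norm (f \<omega> * g \<omega>) \<le> norm ((f \<omega>)\<^sup>2 + (g \<omega>)\<^sup>2)" by simp
qed auto

text \<open>A linear combination \<open>W\<close> has mean 0 and variance \<open>V\<close>, and its
  law is normal or a point mass. In the first case standardisation gives the characteristic
  function; in the second the mass sits at 0 and \<open>V = 0\<close>.\<close>

lemma (in prob_space) gaussian_family_of_jointly_gaussian:
  assumes jg: "jointly_gaussian K X" and I: "finite I" "I \<subseteq> K"
    and sq: "\<And>i. i \<in> I \<Longrightarrow> integrable M (\<lambda>\<omega>. (X i \<omega>)\<^sup>2)"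
    and mean: "\<And>i. i \<in> I \<Longrightarrow> expectation (X i) = 0"
  shows "gaussian_family M X I (\<lambda>i j. expectation (\<lambda>\<omega>. X i \<omega> * X j \<omega>))"
  unfolding gaussian_family_def
proof (intro conjI allI ballI)
  show "prob_space M" by (rule prob_space_axioms)
  have [measurable]: "X i \<in> borel_measurable M" if "i \<in> I" for i
    using jg I that by (auto simp: jointly_gaussian_def)
  then show "X i \<in> borel_measurable M" if "i \<in> I" for i using that .
  fix c :: "'b \<Rightarrow> real"
  define W where "W \<omega> = (\<Sum>i\<in>I. c i * X i \<omega>)" for \<omega>
  define V where "V = (\<Sum>i\<in>I. \<Sum>j\<in>I. c i * c j * expectation (\<lambda>\<omega>. X i \<omega> * X j \<omega>))"
  have [measurable]: "W \<in> borel_measurable M" unfolding W_def[abs_def] by measurable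
  have i1: "integrable M (X i)" if "i \<in> I" for i
    by (rule square_integrable_imp_integrable[OF _ sq[OF that]]) (use that in measurable)
  have i2: "integrable M (\<lambda>\<omega>. X i \<omega> * X j \<omega>)" if "i \<in> I" "j \<in> I" for i j
    by (rule integrable_mult_square_integrable[OF _ _ sq[OF that(1)] sq[OF that(2)]]) (use that in measurable)
  have EW: "expectation W = 0"
    unfolding W_def[abs_def] using i1 mean by (simp add: Bochner_Integration.integral_sum)
  have W2: "(W \<omega>)\<^sup>2 = (\<Sum>i\<in>I. \<Sum>j\<in>I. c i * c j * (X i \<omega> * X j \<omega>))" for \<omega>
    unfolding W_def power2_eq_square sum_product by (simp add: mult_ac)
  have EW2: "expectation (\<lambda>\<omega>. (W \<omega>)\<^sup>2) = V"
    unfolding W2 V_def using i2 by (simp add: Bochner_Integration.integral_sum)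
  have "gaussian_law (distr M borel W)"
    using jg I unfolding jointly_gaussian_def W_def[abs_def] by blast
  then consider (normal) \<mu> \<sigma> where "\<sigma> > 0" "distr M borel W = density lborel (normal_density \<mu> \<sigma>)"
    | (point) \<mu> where "distr M borel W = return borel \<mu>"
    unfolding gaussian_law_def by blast
  then have "(LINT \<omega>|M. cis (W \<omega>)) = of_real (exp (- V / 2))"
  proof cases
    case normal
    have D: "distributed M lborel W (normal_density \<mu> \<sigma>)"
      unfolding distributed_def using normal(2) by (simp cong: distr_cong)
    have \<mu>: "\<mu> = 0" using normal_distributed_expectation[OF normal(1) D] EW by simp
    have V: "V = \<sigma>\<^sup>2" using normal_distributed_variance[OF normal(1) D] EW EW2 by simp
    have "distributed M lborel (\<lambda>\<omega>. (W \<omega> - \<mu>) / \<sigma>) std_normal_density"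
      using D normal_standard_normal_convert[OF normal(1)] by blast
    then have S: "distr M borel (\<lambda>\<omega>. W \<omega> / \<sigma>) = std_normal_distribution"
      using distr_eq_std_normal \<mu> by simp
    have "(LINT \<omega>|M. cis (W \<omega>)) = (LINT \<omega>|M. cis (\<sigma> * (W \<omega> / \<sigma>)))"
      using normal(1) by simp
    also have "\<dots> = (LINT x|distr M borel (\<lambda>\<omega>. W \<omega> / \<sigma>). cis (\<sigma> * x))"
      by (subst integral_distr) auto
    also have "\<dots> = of_real (exp (- V / 2))"
      unfolding S integral_cis_std_normal V ..
    finally show ?thesis .
  next
    case point
    have "expectation W = (LINT x|distr M borel W. x)" by (subst integral_distr) auto
    then have \<mu>: "\<mu> = 0" unfolding point EW by (simp add: integral_return)
    have "V = (LINT x|distr M borel W. x\<^sup>2)" unfolding EW2[symmetric] by (subst integral_distr) auto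
    then have V: "V = 0" unfolding point \<mu> by (simp add: integral_return)
    have "(LINT \<omega>|M. cis (W \<omega>)) = (LINT x|distr M borel W. cis x)" by (subst integral_distr) auto
    also have "\<dots> = 1" unfolding point \<mu> by (simp add: integral_return)
    finally show ?thesis using V by simp
  qed
  then show "(LINT \<omega>|M. cis (\<Sum>i\<in>I. c i * X i \<omega>)) = of_real (exp (- (\<Sum>i\<in>I. \<Sum>j\<in>I. c i * c j *
      expectation (\<lambda>\<omega>. X i \<omega> * X j \<omega>)) / 2))"
    unfolding W_def V_def .
qed

context prob_space
begin

context
  fixes X :: "nat \<Rightarrow> 'a \<Rightarrow> real"
  assumes X: "standard_stationary_gaussian X"
begin

lemma stationary_measurable: "i \<ge> 1 \<Longrightarrow> X i \<in> borel_measurable M"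
  using X by (auto simp: standard_stationary_gaussian_def jointly_gaussian_def)

lemma stationary_moments:
  assumes "i \<ge> 1"
  shows "expectation (X i) = 0" "integrable M (\<lambda>\<omega>. (X i \<omega>)\<^sup>2)" "expectation (\<lambda>\<omega>. (X i \<omega>)\<^sup>2) = 1"
proof -
  have D: "distributed M lborel (X i) std_normal_density"
    using X assms by (auto simp: standard_stationary_gaussian_def)
  show "expectation (X i) = 0"
    by (rule standard_normal_distributed_expectation[OF D])
  show "integrable M (\<lambda>\<omega>. (X i \<omega>)\<^sup>2)"
    using distributed_integrable[OF D, of "\<lambda>x. x\<^sup>2"] integrable_std_normal_moment[of 2] by simp
  show "expectation (\<lambda>\<omega>. (X i \<omega>)\<^sup>2) = 1"
    using standard_normal_distributed_variance[OF D] standard_normal_distributed_expectation[OF D] by simp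
qed

text \<open>On natural numbers, \<open>max i j - min i j\<close> is the lag
  \<open>\<bar>i - j\<bar>\<close>, symmetric in \<open>i\<close> and \<open>j\<close> and free of
  truncation.\<close>

lemma stationary_gaussian_family:
  "gaussian_family M X {1..n} (\<lambda>i j. if i = j then 1 else correlation_function X (max i j - min i j))"
proof (subst gaussian_family_cong)
  show "gaussian_family M X {1..n} (\<lambda>i j. expectation (\<lambda>\<omega>. X i \<omega> * X j \<omega>))"
    using X stationary_moments
    by (intro gaussian_family_of_jointly_gaussian[where K = "{1..}"]) (auto simp: standard_stationary_gaussian_def)
  fix i j assume ij: "i \<in> {1..n}" "j \<in> {1..n}"
  have st: "expectation (\<lambda>\<omega>. X a \<omega> * X b \<omega>) = correlation_function X (b - a)" if "a \<ge> 1" "a < b" for a b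
  proof -
    have "expectation (\<lambda>\<omega>. X a \<omega> * X ((b - a) + a) \<omega>) = correlation_function X (b - a)"
    proof -
      have "\<forall>n\<ge>1. \<forall>j\<ge>1. expectation (\<lambda>\<omega>. X j \<omega> * X (n + j) \<omega>) = correlation_function X n"
        using X unfolding standard_stationary_gaussian_def by blast
      moreover have "b - a \<ge> 1" using that by simp
      ultimately show ?thesis using that(1) by blast
    qed
    then show ?thesis using that by simp
  qed
  show "(if i = j then 1 else correlation_function X (max i j - min i j)) = expectation (\<lambda>\<omega>. X i \<omega> * X j \<omega>)"
    using ij st[of i j] st[of j i] stationary_moments(3)[of i]
    by (cases i j rule: linorder_cases) (auto simp: power2_eq_square mult.commute)
qed

lemma stationary_correlation_le_1:
  assumes "n \<ge> 1"
  shows "\<bar>correlation_function X n\<bar> \<le> 1"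
proof -
  note [measurable] = stationary_measurable
  have "\<bar>correlation_function X n\<bar> \<le> expectation (\<lambda>\<omega>. ((X 1 \<omega>)\<^sup>2 + (X (n + 1) \<omega>)\<^sup>2) / 2)"
    unfolding correlation_function_def
  proof (rule order_trans[OF integral_abs_bound integral_mono])
    show "integrable M (\<lambda>\<omega>. \<bar>X 1 \<omega> * X (n + 1) \<omega>\<bar>)"
      using stationary_moments(2)[of 1] stationary_moments(2)[of "n + 1"]
      by (intro integrable_abs integrable_mult_square_integrable) (auto intro: stationary_measurable)
    show "integrable M (\<lambda>\<omega>. ((X 1 \<omega>)\<^sup>2 + (X (n + 1) \<omega>)\<^sup>2) / 2)"
      using stationary_moments(2)[of 1] stationary_moments(2)[of "n + 1"] by simp
    show "\<bar>X 1 \<omega> * X (n + 1) \<omega>\<bar> \<le> ((X 1 \<omega>)\<^sup>2 + (X (n + 1) \<omega>)\<^sup>2) / 2" for \<omega>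
      using sum_squares_bound[of "\<bar>X 1 \<omega>\<bar>" "\<bar>X (n + 1) \<omega>\<bar>"] by (simp add: abs_mult)
  qed
  also have "\<dots> = 1"
    using stationary_moments[of 1] stationary_moments[of "n + 1"] by simp
  finally show ?thesis .
qed

text \<open>Perfect correlation at lag \<open>n\<close> would propagate to all multiples of \<open>n\<close>.\<close>

lemma stationary_correlation_less_1:
  assumes lim: "correlation_function X \<longlonglongrightarrow> 0" and n: "n \<ge> 1"
  shows "\<bar>correlation_function X n\<bar> < 1"
proof (rule ccontr)
  assume "\<not> \<bar>correlation_function X n\<bar> < 1"
  then have one: "\<bar>correlation_function X n\<bar> = 1" using stationary_correlation_le_1[OF n] by simp
  define s where "s = correlation_function X n"
  have s: "s * s = 1" "\<bar>s\<bar> = 1" using one by (auto simp: s_def abs_if split: if_splits)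
  \<comment> \<open>The second moment of \<open>X (n + j) - s * X j\<close> is
    \<open>1 + s^2 - 2 * s^2 = 0\<close>, since the covariance is \<open>s\<close> and
    \<open>s^2 = 1\<close>.\<close>
  have step: "AE \<omega> in M. X (n + j) \<omega> = s * X j \<omega>" if j: "j \<ge> 1" for j
  proof -
    have int: "integrable M (\<lambda>\<omega>. X j \<omega> * X (n + j) \<omega>)"
      using stationary_moments(2)[of j] stationary_moments(2)[of "n + j"] j
      by (intro integrable_mult_square_integrable) (auto intro: stationary_measurable)
    have eq: "(X (n + j) \<omega> - s * X j \<omega>)\<^sup>2 = (X (n + j) \<omega>)\<^sup>2 + (X j \<omega>)\<^sup>2 - 2 * s * (X j \<omega> * X (n + j) \<omega>)" for \<omega>
    proof -
      have "(X (n + j) \<omega> - s * X j \<omega>)\<^sup>2 = (X (n + j) \<omega>)\<^sup>2 + (s * s) * (X j \<omega>)\<^sup>2 - 2 * s * (X j \<omega> * X (n + j) \<omega>)"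
        by (simp add: power2_eq_square algebra_simps)
      then show ?thesis using s by simp
    qed
    have cov: "expectation (\<lambda>\<omega>. X j \<omega> * X (n + j) \<omega>) = s"
      using X n j unfolding standard_stationary_gaussian_def s_def by blast
    have "integrable M (\<lambda>\<omega>. (X (n + j) \<omega> - s * X j \<omega>)\<^sup>2)"
      unfolding eq using stationary_moments(2)[of j] stationary_moments(2)[of "n + j"] j int by simp
    moreover have "expectation (\<lambda>\<omega>. (X (n + j) \<omega> - s * X j \<omega>)\<^sup>2) = 0"
      unfolding eq using stationary_moments[of j] stationary_moments[of "n + j"] j int cov s by simp
    ultimately have "AE \<omega> in M. (X (n + j) \<omega> - s * X j \<omega>)\<^sup>2 = 0"
      by (subst (asm) integral_nonneg_eq_0_iff_AE) auto
    then show ?thesis by simp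
  qed
  have iter: "AE \<omega> in M. X (m * n + 1) \<omega> = s ^ m * X 1 \<omega>" for m
  proof (induction m)
    case (Suc m)
    from step[of "m * n + 1"] Suc show ?case
      by (auto simp: algebra_simps elim!: eventually_elim2)
  qed auto
  have "\<bar>correlation_function X (m * n)\<bar> = 1" for m
  proof -
    have "correlation_function X (m * n) = expectation (\<lambda>\<omega>. s ^ m * (X 1 \<omega>)\<^sup>2)"
      unfolding correlation_function_def
    proof (rule integral_cong_AE)
      show "AE \<omega> in M. X 1 \<omega> * X (m * n + 1) \<omega> = s ^ m * (X 1 \<omega>)\<^sup>2"
        using iter[of m] by eventually_elim (simp add: power2_eq_square)
    qed (use stationary_measurable[of 1] stationary_measurable[of "m * n + 1"] in measurable)
    then show ?thesis using stationary_moments(3)[of 1] s by (simp add: power_abs)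
  qed
  moreover have "(\<lambda>m. correlation_function X (m * n)) \<longlonglongrightarrow> 0"
    using LIMSEQ_subseq_LIMSEQ[OF lim, of "\<lambda>m. m * n"] n by (auto simp: strict_mono_def o_def)
  then have "(\<lambda>m. \<bar>correlation_function X (m * n)\<bar>) \<longlonglongrightarrow> 0"
    by (rule tendsto_rabs_zero)
  ultimately show False by (simp add: LIMSEQ_const_iff)
qed

end

end

text \<open>A zero scale never reaches a positive level, so it must contribute 0; the bare formula
  would give 1 there, because \<open>w / 0 = 0\<close>.\<close>

definition gauss_decay :: "real \<Rightarrow> real \<Rightarrow> real \<Rightarrow> real" where
  "gauss_decay \<rho> w s = (if s > 0 then exp (- (w / s)\<^sup>2 / (2 * (1 + \<rho>))) else 0)"

lemma gauss_decay_bounds: "\<rho> \<ge> 0 \<Longrightarrow> 0 \<le> gauss_decay \<rho> w s" "\<rho> \<ge> 0 \<Longrightarrow> gauss_decay \<rho> w s \<le> 1"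
  by (auto simp: gauss_decay_def)

lemma borel_measurable_gauss_decay [measurable]: "gauss_decay \<rho> w \<in> borel_measurable borel"
  unfolding gauss_decay_def[abs_def] by measurable

text \<open>With \<open>A = 1 - s\<close>, \<open>B = 1 - t\<close> and positive levels, the product
  over a sample is \<open>s ^ N * t ^ N'\<close>, the integrand of the generating function.\<close>

definition two_sided_step :: "real \<Rightarrow> real \<Rightarrow> real \<Rightarrow> real \<Rightarrow> real \<Rightarrow> real" where
  "two_sided_step A B a b y = 1 - A * (if y > a then 1 else 0) - B * (if y \<le> - b then 1 else 0)"

lemma borel_measurable_two_sided_step [measurable]: "two_sided_step A B a b \<in> borel_measurable borel"
  unfolding two_sided_step_def[abs_def] by measurable

lemma two_sided_step_bound: "A \<in> {0..1} \<Longrightarrow> B \<in> {0..1} \<Longrightarrow> \<bar>two_sided_step A B a b y\<bar> \<le> 1"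
  by (auto simp: two_sided_step_def)

text \<open>With frozen scales, a step of \<open>s k * x\<close> at level \<open>a\<close> is a step
  of \<open>x\<close> at level \<open>a / s k\<close>. The constant arises from
  \<open>A + B \<le> 2\<close> in each of the two factors, divided by the 2 of the comparison
  inequality.\<close>

lemma gaussian_comparison_scaled_step:
  fixes s :: "'i \<Rightarrow> real"
  assumes I: "finite I"
    and gP: "gaussian_family P X I (\<lambda>i j. if i = j then 1 else r i j)"
    and r: "\<And>i j. i \<in> I \<Longrightarrow> j \<in> I \<Longrightarrow> i \<noteq> j \<Longrightarrow> \<bar>r i j\<bar> < 1" "\<And>i j. r i j = r j i"
    and AB: "A \<in> {0..1}" "B \<in> {0..1}" and w: "0 < w" "w \<le> a" "w \<le> b"
    and s: "\<And>k. k \<in> I \<Longrightarrow> 0 \<le> s k"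
  shows "\<bar>(LINT \<omega>|P. (\<Prod>k\<in>I. two_sided_step A B a b (s k * X k \<omega>))) -
      (\<Prod>k\<in>I. LINT z|std_normal_distribution. two_sided_step A B a b (s k * z))\<bar> \<le>
    2 * (\<Sum>i\<in>I. \<Sum>j\<in>I-{i}. \<bar>r i j\<bar> * (pair_const \<bar>r i j\<bar> *
      (gauss_decay \<bar>r i j\<bar> w (s i) * gauss_decay \<bar>r i j\<bar> w (s j))))"
proof -
  let ?N = std_normal_distribution
  interpret N: prob_space ?N by (rule prob_space_std_normal)
  interpret Q: product_prob_space "\<lambda>_. ?N" I by unfold_locales
  \<comment> \<open>At scale 0 the step function is constantly 1 since the levels are positive;
    heights 0 express this and make the meaningless level \<open>a / 0\<close> harmless.\<close>
  define A' where "A' k = (if s k > 0 then A else 0)" for k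
  define B' where "B' k = (if s k > 0 then B else 0)" for k
  define \<phi> where "\<phi> = (\<lambda>k x. 1 - A' k * (if x > a / s k then 1 else 0) - B' k * (if x \<le> - (b / s k) then 1 else 0))"
  have eq: "two_sided_step A B a b (s k * x) = \<phi> k x" if "k \<in> I" for k x
  proof (cases "s k > 0")
    case True
    then show ?thesis by (auto simp: two_sided_step_def \<phi>_def A'_def B'_def field_simps)
  next
    case False
    then have "s k = 0" using s[OF that] by simp
    then show ?thesis using w by (auto simp: two_sided_step_def \<phi>_def A'_def B'_def)
  qed
  have "\<bar>(prod_mean P X I \<phi>) - (LINT \<omega>|(Pi\<^sub>M I (\<lambda>_. ?N)). (\<Prod>k\<in>I. \<phi> k (\<omega> k)))\<bar> \<le>
    (\<Sum>i\<in>I. \<Sum>j\<in>I-{i}. \<bar>r i j\<bar> * (pair_const \<bar>r i j\<bar> *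
      (((A' i + B' i) * damp \<bar>r i j\<bar> (w / s i)) *
       ((A' j + B' j) * damp \<bar>r i j\<bar> (w / s j))))) / 2"
    unfolding \<phi>_def
    by (rule gaussian_comparison_step[OF I gP gaussian_family_PiM[OF I] r, where A = A' and B = B'
          and a = "\<lambda>k. a / s k" and b = "\<lambda>k. b / s k" and w = "\<lambda>k. w / s k"])
      (use AB w s in \<open>auto simp: A'_def B'_def intro!: divide_right_mono\<close>)
  also have "\<dots> \<le> (\<Sum>i\<in>I. \<Sum>j\<in>I-{i}. \<bar>r i j\<bar> * (pair_const \<bar>r i j\<bar> *
      ((2 * gauss_decay \<bar>r i j\<bar> w (s i)) * (2 * gauss_decay \<bar>r i j\<bar> w (s j))))) / 2"
  proof -
    have e: "(A' k + B' k) * damp \<rho> (w / s k) \<le> 2 * gauss_decay \<rho> w (s k)" for k \<rho>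
      using AB by (auto simp: A'_def B'_def gauss_decay_def)
    have nn: "0 \<le> (A' k + B' k) * damp \<rho> (w / s k)" "0 \<le> 2 * gauss_decay \<rho> w (s k)" for k \<rho>
      using AB by (auto simp: A'_def B'_def gauss_decay_def)
    have "0 \<le> pair_const \<bar>r i j\<bar>" if "i \<in> I" "j \<in> I - {i}" for i j
      using r(1)[of i j] that by (intro pair_const_nonneg) (auto simp: less_imp_le)
    then show ?thesis
      by (intro divide_right_mono sum_mono mult_left_mono mult_mono[OF e e nn(2) nn(1)]) auto
  qed
  also have "\<dots> = 2 * (\<Sum>i\<in>I. \<Sum>j\<in>I-{i}. \<bar>r i j\<bar> * (pair_const \<bar>r i j\<bar> *
      (gauss_decay \<bar>r i j\<bar> w (s i) * gauss_decay \<bar>r i j\<bar> w (s j))))"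
    by (simp add: sum_distrib_left sum_divide_distrib mult_ac)
  finally have main: "\<bar>(prod_mean P X I \<phi>) - (LINT \<omega>|(Pi\<^sub>M I (\<lambda>_. ?N)). (\<Prod>k\<in>I. \<phi> k (\<omega> k)))\<bar> \<le> \<dots>" .
  have "(LINT \<omega>|(Pi\<^sub>M I (\<lambda>_. ?N)). (\<Prod>k\<in>I. two_sided_step A B a b (s k * \<omega> k))) =
      (\<Prod>k\<in>I. LINT z|?N. two_sided_step A B a b (s k * z))"
    by (intro Q.product_integral_prod I N.integrable_const_bound[of _ 1]) (use two_sided_step_bound[OF AB] in auto)
  moreover have "(\<Prod>k\<in>I. \<phi> k (f k)) = (\<Prod>k\<in>I. two_sided_step A B a b (s k * f k))" for f
    using eq by (intro prod.cong) auto
  ultimately show ?thesis using main by simp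
qed

section \<open>Tails of normal scale mixtures\<close>

lemma measure_std_normal_UNIV [simp]: "measure std_normal_distribution UNIV = 1"
  using prob_space.prob_space[OF prob_space_std_normal] by simp

lemma AE_std_normalI: "(AE x in lborel. P x) \<Longrightarrow> (AE x in std_normal_distribution. P x)"
  by (subst AE_density) auto

lemma integral_std_normal_uminus:
  fixes f :: "real \<Rightarrow> real"
  assumes [measurable]: "f \<in> borel_measurable borel"
  shows "(LINT z|std_normal_distribution. f (- z)) = (LINT z|std_normal_distribution. f z)"
proof -
  have "(LINT z|std_normal_distribution. f z) = (LINT z|lborel. std_normal_density z * f z)"
    by (subst integral_density) auto
  also have "\<dots> = (LINT z|lborel. std_normal_density (- z) * f (- z))"
    using lborel_integral_real_affine[of "-1" "\<lambda>z. std_normal_density z * f z" 0] by simp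
  also have "\<dots> = (LINT z|lborel. std_normal_density z * f (- z))"
    by (simp add: std_normal_density_def)
  also have "\<dots> = (LINT z|std_normal_distribution. f (- z))"
    by (subst integral_density) auto
  finally show ?thesis ..
qed

text \<open>\<open>scaled_tail s v\<close> is \<open>P(s Z > v)\<close> for standard normal \<open>Z\<close>, so that \<open>mixture_tail D v\<close> is \<open>P(S Z > v)\<close>
  for \<open>S\<close> with law \<open>D\<close> independent of \<open>Z\<close>.\<close>

definition scaled_tail :: "real \<Rightarrow> real \<Rightarrow> real" where
  "scaled_tail s v = (LINT z|std_normal_distribution. (if s * z > v then 1 else 0))"

definition mixture_tail :: "real measure \<Rightarrow> real \<Rightarrow> real" where
  "mixture_tail D v = (LINT s|D. scaled_tail s v)"

definition mean_decay :: "real measure \<Rightarrow> real \<Rightarrow> real \<Rightarrow> real" where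
  "mean_decay D \<rho> w = (LINT s|D. gauss_decay \<rho> w s)"

lemma borel_measurable_scaled_tail [measurable]: "(\<lambda>s. scaled_tail s v) \<in> borel_measurable borel"
proof -
  interpret N: prob_space std_normal_distribution by (rule prob_space_std_normal)
  show ?thesis unfolding scaled_tail_def
    by (intro N.borel_measurable_lebesgue_integral) measurable
qed

lemma scaled_tail_bounds: "0 \<le> scaled_tail s v" "scaled_tail s v \<le> 1"
proof -
  interpret N: prob_space std_normal_distribution by (rule prob_space_std_normal)
  show "0 \<le> scaled_tail s v" unfolding scaled_tail_def by (intro Bochner_Integration.integral_nonneg) auto
  have "scaled_tail s v \<le> (LINT z|std_normal_distribution. 1)"
    unfolding scaled_tail_def by (intro integral_mono N.integrable_const_bound[of _ 1]) auto
  then show "scaled_tail s v \<le> 1" by (simp add: N.prob_space)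
qed

lemma scaled_tail_eq:
  assumes "s > 0"
  shows "scaled_tail s v = (LINT z|lborel. indicator {v / s<..} z * std_normal_density z)"
  unfolding scaled_tail_def using assms
  by (subst integral_density) (auto intro!: Bochner_Integration.integral_cong simp: indicator_def field_simps)

text \<open>A crude Mills ratio bound: integrate the density over an interval of length \<open>1 / (1 + v / s)\<close>.\<close>

definition mills_const :: real where
  "mills_const = sqrt (2 * pi) * exp (3 / 2)"

lemma exp_le_scaled_tail:
  assumes s: "s > 0" and v: "v \<ge> 0"
  shows "exp (- (v / s)\<^sup>2 / 2) \<le> mills_const * (1 + v / s) * scaled_tail s v"
proof -
  define a where "a = v / s"
  define b where "b = a + 1 / (1 + a)"
  have a: "a \<ge> 0" using s v by (simp add: a_def)
  have ab: "a < b" using a by (simp add: b_def)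
  \<comment> \<open>Over this interval the square grows by at most 3, which is the origin of
    \<open>exp (3 / 2)\<close> in \<open>mills_const\<close>; the inverse of its length is the
    factor \<open>1 + a\<close>.\<close>
  have "b\<^sup>2 = a\<^sup>2 + 2 * (a / (1 + a)) + (1 / (1 + a))\<^sup>2"
    by (simp add: b_def power2_eq_square algebra_simps)
  moreover have "a / (1 + a) \<le> 1" using a by simp
  moreover have "(1 / (1 + a))\<^sup>2 \<le> 1" using a by (simp add: abs_square_le_1)
  ultimately have b2: "b\<^sup>2 \<le> a\<^sup>2 + 3" by linarith
  have "(b - a) * std_normal_density b = (LINT z|lborel. indicator {a<..b} z * std_normal_density b)"
    using ab by simp
  also have "\<dots> \<le> (LINT z|lborel. indicator {a<..} z * std_normal_density z)"
  proof (rule integral_mono)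
    show "integrable lborel (\<lambda>z. indicator {a<..b} z * std_normal_density b)"
      using ab by (intro integrable_mult_left integrable_real_indicator) auto
    show "integrable lborel (\<lambda>z. indicator {a<..} z * std_normal_density z)"
      using integrable_real_mult_indicator[of "{a<..}" lborel std_normal_density] integrable_normal_density[of 1 0]
      by (simp add: mult.commute)
    fix z
    show "indicator {a<..b} z * std_normal_density b \<le> indicator {a<..} z * std_normal_density z"
    proof (cases "z \<in> {a<..b}")
      case True
      then have "z\<^sup>2 \<le> b\<^sup>2" using a by (intro power_mono) auto
      then show ?thesis using True by (auto simp: std_normal_density_def indicator_def intro!: divide_right_mono)
    qed (auto simp: indicator_def)
  qed
  also have "\<dots> = scaled_tail s v" using scaled_tail_eq[OF s] by (simp add: a_def)
  finally have "std_normal_density b \<le> (1 + a) * scaled_tail s v"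
    using a by (simp add: b_def field_simps)
  moreover have "exp (- a\<^sup>2 / 2) \<le> mills_const * std_normal_density b"
  proof -
    have "exp (- a\<^sup>2 / 2) \<le> exp (3 / 2 + (- b\<^sup>2 / 2))" using b2 by simp
    also have "\<dots> = mills_const * std_normal_density b"
      unfolding exp_add by (simp add: mills_const_def std_normal_density_def)
    finally show ?thesis .
  qed
  moreover have "0 \<le> mills_const" by (simp add: mills_const_def)
  ultimately show ?thesis
    unfolding a_def[symmetric] by (smt (verit) mult_left_mono mult.assoc)
qed

text \<open>Reflection turns the event into \<open>s * z \<ge> b\<close>. For
  \<open>s \<noteq> 0\<close> this differs from the strict event at one point, a null set; for
  \<open>s = 0\<close> both fail because \<open>b > 0\<close>.\<close>

lemma scaled_tail_reflect:
  assumes "b > 0"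
  shows "(LINT z|std_normal_distribution. (if s * z \<le> - b then 1 else 0)) = scaled_tail s b"
proof -
  have "(LINT z|std_normal_distribution. (if s * z \<le> - b then 1 else 0)) =
      (LINT z|std_normal_distribution. (if s * (- z) \<le> - b then 1 else (0::real)))"
    by (rule integral_std_normal_uminus[symmetric]) measurable
  also have "\<dots> = scaled_tail s b"
    unfolding scaled_tail_def
  proof (rule integral_cong_AE)
    have "AE z in lborel. z \<noteq> b / s" by (rule AE_lborel_singleton)
    then have "AE z in std_normal_distribution. z \<noteq> b / s" by (rule AE_std_normalI)
    then show "AE z in std_normal_distribution. (if s * (- z) \<le> - b then 1 else 0) = (if s * z > b then 1 else (0::real))"
      by eventually_elim (use assms in \<open>cases "s = 0"; auto simp: field_simps\<close>)
  qed measurable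
  finally show ?thesis .
qed

lemma integral_two_sided_step:
  assumes "prob_space D" "sets D = sets borel" "b > 0"
  shows "(LINT s|D. LINT z|std_normal_distribution. two_sided_step A B a b (s * z)) =
    1 - A * mixture_tail D a - B * mixture_tail D b"
proof -
  interpret N: prob_space std_normal_distribution by (rule prob_space_std_normal)
  interpret D: prob_space D by fact
  have i: "integrable std_normal_distribution (\<lambda>z. if P z then 1 else (0::real))" if "Measurable.pred borel P" for P
    using that by (intro N.integrable_const_bound[of _ 1]) auto
  have "(LINT z|std_normal_distribution. two_sided_step A B a b (s * z)) =
      1 - A * scaled_tail s a - B * scaled_tail s b" for s
  proof -
    have "(LINT z|std_normal_distribution. two_sided_step A B a b (s * z)) =
      (LINT z|std_normal_distribution. 1 - A * (if s * z > a then 1 else 0) - B * (if s * z \<le> - b then 1 else 0))"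
      unfolding two_sided_step_def ..
    also have "\<dots> = 1 - A * (LINT z|std_normal_distribution. (if s * z > a then 1 else 0)) -
        B * (LINT z|std_normal_distribution. (if s * z \<le> - b then 1 else 0))"
      using i[of "\<lambda>z. s * z > a"] i[of "\<lambda>z. s * z \<le> - b"] by (simp add: N.prob_space)
    finally show ?thesis
      unfolding scaled_tail_reflect[OF assms(3)] scaled_tail_def[symmetric] .
  qed
  moreover have "integrable D (\<lambda>s. scaled_tail s v)" for v
    using scaled_tail_bounds assms(2) by (intro D.integrable_const_bound[of _ 1])
      (auto simp: measurable_cong_sets[OF assms(2) refl])
  ultimately show ?thesis
    by (simp add: mixture_tail_def D.prob_space)
qed

context
  fixes D :: "real measure"
  assumes D: "prob_space D" "sets D = sets borel" and nonneg: "AE s in D. 0 \<le> s"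
begin

interpretation D: prob_space D by (rule D(1))

lemma borel_measurable_D: "f \<in> borel_measurable borel \<Longrightarrow> f \<in> borel_measurable D"
  by (simp add: measurable_cong_sets[OF D(2) refl])

lemma integrable_scaled_tail: "integrable D (\<lambda>s. scaled_tail s v)"
  using scaled_tail_bounds by (intro D.integrable_const_bound[of _ 1] borel_measurable_D) auto

lemma integrable_gauss_decay: "\<rho> \<ge> 0 \<Longrightarrow> integrable D (gauss_decay \<rho> w)"
  using gauss_decay_bounds by (intro D.integrable_const_bound[of _ 1] borel_measurable_D) auto

lemma mean_decay_nonneg: "\<rho> \<ge> 0 \<Longrightarrow> 0 \<le> mean_decay D \<rho> w"
  unfolding mean_decay_def using gauss_decay_bounds by (intro Bochner_Integration.integral_nonneg) auto

lemma mixture_tail_nonneg: "0 \<le> mixture_tail D v"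
  unfolding mixture_tail_def using scaled_tail_bounds by (intro Bochner_Integration.integral_nonneg) auto

lemma mean_decay_mono:
  assumes "0 \<le> \<rho>" "\<rho> \<le> \<rho>'"
  shows "mean_decay D \<rho> w \<le> mean_decay D \<rho>' w"
  unfolding mean_decay_def
proof (rule integral_mono)
  fix s
  have "(w / s)\<^sup>2 / (2 * (1 + \<rho>')) \<le> (w / s)\<^sup>2 / (2 * (1 + \<rho>))"
    using assms by (intro divide_left_mono) auto
  then show "gauss_decay \<rho> w s \<le> gauss_decay \<rho>' w s"
    by (auto simp: gauss_decay_def)
qed (use assms in \<open>auto intro: integrable_gauss_decay\<close>)

text \<open>Scales with \<open>(w / s)\<^sup>2 > 8 ln n\<close> contribute at most \<open>n powr -2\<close>; for the others the Mills ratio and the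
  correction of the exponent are controlled by \<open>ln n\<close>.\<close>

lemma mean_decay_le_tail:
  assumes w: "w > 0" and n: "n \<ge> 2" and \<rho>: "0 \<le> \<rho>" "\<rho> \<le> 1"
  shows "mean_decay D \<rho> w \<le> mills_const * exp (4 * \<rho> * ln n) * (1 + sqrt (8 * ln n)) * mixture_tail D w + 1 / n\<^sup>2"
proof -
  define C where "C = mills_const * exp (4 * \<rho> * ln n) * (1 + sqrt (8 * ln n))"
  have ln: "ln n \<ge> 0" using n by simp
  have C: "C \<ge> 0" using ln by (auto simp: C_def mills_const_def)
  have "gauss_decay \<rho> w s \<le> C * scaled_tail s w + 1 / n\<^sup>2" if s: "s \<ge> 0" for s
  proof (cases "s = 0")
    case True
    then show ?thesis using C scaled_tail_bounds n by (simp add: gauss_decay_def)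
  next
    case False
    then have s: "s > 0" using s by simp
    define a where "a = w / s"
    have a: "a > 0" using s w by (simp add: a_def)
    show ?thesis
    proof (cases "a\<^sup>2 \<le> 8 * ln n")
      case True
      have "a = sqrt (a\<^sup>2)" using a by simp
      also have "\<dots> \<le> sqrt (8 * ln n)" using True by (rule real_sqrt_le_mono)
      finally have al: "a \<le> sqrt (8 * ln n)" .
      \<comment> \<open>The price for replacing the exponent by \<open>- a^2 / 2\<close>: a
        correction of at most \<open>4 * \<rho> * ln n\<close> in this range of scales.\<close>
      have "- a\<^sup>2 / (2 * (1 + \<rho>)) = a\<^sup>2 * \<rho> / (2 * (1 + \<rho>)) + (- a\<^sup>2 / 2)"
        using \<rho> by (simp add: field_simps)
      also have "a\<^sup>2 * \<rho> / (2 * (1 + \<rho>)) \<le> (8 * ln n) * \<rho> / 2"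
        using True \<rho> ln by (intro frac_le mult_right_mono) auto
      finally have "exp (- a\<^sup>2 / (2 * (1 + \<rho>))) \<le> exp (4 * \<rho> * ln n) * exp (- a\<^sup>2 / 2)"
        by (simp add: mult_ac flip: exp_add)
      also have "\<dots> \<le> exp (4 * \<rho> * ln n) * (mills_const * (1 + a) * scaled_tail s w)"
        using exp_le_scaled_tail[OF s, of w] w by (intro mult_left_mono) (auto simp: a_def)
      also have "\<dots> \<le> exp (4 * \<rho> * ln n) * (mills_const * (1 + sqrt (8 * ln n)) * scaled_tail s w)"
        using al scaled_tail_bounds by (intro mult_left_mono mult_right_mono) (auto simp: mills_const_def)
      also have "\<dots> = C * scaled_tail s w" by (simp add: C_def)
      finally have "exp (- a\<^sup>2 / (2 * (1 + \<rho>))) \<le> C * scaled_tail s w + 1 / n\<^sup>2"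
        by (rule order_trans) simp
      then show ?thesis using s by (simp add: gauss_decay_def a_def)
    next
      case False
      \<comment> \<open>Here \<open>\<rho> \<le> 1\<close> enters as
        \<open>2 * (1 + \<rho>) \<le> 4\<close>; the threshold 8 then makes the exponent at most
        \<open>- 2 * ln n\<close>.\<close>
      have "a\<^sup>2 / 4 \<le> a\<^sup>2 / (2 * (1 + \<rho>))" using \<rho> by (intro divide_left_mono) auto
      moreover have "2 * ln n \<le> a\<^sup>2 / 4" using False by simp
      ultimately have "- a\<^sup>2 / (2 * (1 + \<rho>)) \<le> - (2 * ln n)"
        unfolding minus_divide_left[symmetric] by linarith
      then have "exp (- a\<^sup>2 / (2 * (1 + \<rho>))) \<le> exp (- (2 * ln n))" by simp
      also have "\<dots> = 1 / n\<^sup>2"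
        using n by (simp add: exp_minus inverse_eq_divide exp_double)
      finally show ?thesis using s C scaled_tail_bounds[of s w]
        by (simp add: gauss_decay_def a_def add_increasing)
    qed
  qed
  then have "mean_decay D \<rho> w \<le> (LINT s|D. C * scaled_tail s w + 1 / n\<^sup>2)"
    unfolding mean_decay_def using nonneg \<rho> integrable_scaled_tail
    by (intro integral_mono_AE integrable_gauss_decay) (auto elim!: eventually_mono)
  also have "\<dots> = C * mixture_tail D w + 1 / n\<^sup>2"
    using integrable_scaled_tail by (simp add: mixture_tail_def D.prob_space)
  finally show ?thesis by (simp add: C_def)
qed

text \<open>With \<open>\<beta> = 1 / (1 + \<rho>)\<close>, \<open>z powr \<beta> \<le> n powr - \<beta> + n powr (1 - \<beta>) * z\<close>: compare \<open>z\<close> with \<open>1 / n\<close>.\<close>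

lemma mean_decay_interpolate:
  assumes n: "n \<ge> 1" and \<rho>: "0 \<le> \<rho>"
  shows "mean_decay D \<rho> w \<le> n powr (- (1 / (1 + \<rho>))) * (1 + n * mean_decay D 0 w)"
proof -
  define \<beta> where "\<beta> = 1 / (1 + \<rho>)"
  have \<beta>: "0 < \<beta>" "\<beta> \<le> 1" using \<rho> by (auto simp: \<beta>_def)
  have "gauss_decay \<rho> w s \<le> n powr (- \<beta>) + n powr (1 - \<beta>) * gauss_decay 0 w s" for s
  proof (cases "s > 0")
    case True
    define z where "z = exp (- (w / s)\<^sup>2 / 2)"
    have z: "z > 0" by (simp add: z_def)
    have zb: "gauss_decay \<rho> w s = z powr \<beta>"
      using True by (simp add: gauss_decay_def z_def powr_def \<beta>_def)
    have z0: "gauss_decay 0 w s = z" using True by (simp add: gauss_decay_def z_def)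
    show ?thesis
    proof (cases "z \<le> 1 / n")
      case le: True
      have "z powr \<beta> \<le> (1 / n) powr \<beta>" using z \<beta> le by (intro powr_mono2) auto
      also have "\<dots> = n powr (- \<beta>)" using n by (simp add: powr_minus powr_divide inverse_eq_divide)
      finally show ?thesis unfolding zb z0 using z by (simp add: add_increasing2)
    next
      case False
      have "z powr \<beta> = z powr (\<beta> - 1) * z" using z by (simp add: powr_diff)
      also have "\<dots> \<le> (1 / n) powr (\<beta> - 1) * z"
        using False \<beta> n z by (intro mult_right_mono powr_mono2') auto
      also have "(1 / n) powr (\<beta> - 1) = n powr (1 - \<beta>)"
        using n by (simp add: powr_divide powr_diff)
      finally show ?thesis unfolding zb z0 by (simp add: add_increasing)
    qed
  qed (simp add: gauss_decay_def)
  then have "mean_decay D \<rho> w \<le> (LINT s|D. n powr (- \<beta>) + n powr (1 - \<beta>) * gauss_decay 0 w s)"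
    unfolding mean_decay_def using \<rho> integrable_gauss_decay[of 0]
    by (intro integral_mono integrable_gauss_decay) auto
  also have "\<dots> = n powr (- \<beta>) + n powr (1 - \<beta>) * mean_decay D 0 w"
    using integrable_gauss_decay[of 0] by (simp add: mean_decay_def D.prob_space)
  also have "\<dots> = n powr (- \<beta>) * (1 + n * mean_decay D 0 w)"
    using n by (simp add: powr_diff powr_minus field_simps)
  finally show ?thesis by (simp add: \<beta>_def)
qed

end

text \<open>Since the scales are independent of the Gaussian vector, Fubini allows the comparison to
  be made with frozen scales and averaged afterwards. The product of conditional means factorises
  over the independent scales, and the two scales in an error term are independent with common law
  \<open>D\<close>, whence the square.\<close>

lemma (in prob_space) scaled_gaussian_comparison:
  fixes S X :: "'i \<Rightarrow> 'a \<Rightarrow> real"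
  assumes I: "finite I" "I \<noteq> {}"
    and gM: "gaussian_family M X I (\<lambda>i j. if i = j then 1 else r i j)"
    and r: "\<And>i j. i \<in> I \<Longrightarrow> j \<in> I \<Longrightarrow> i \<noteq> j \<Longrightarrow> \<bar>r i j\<bar> < 1" "\<And>i j. r i j = r j i"
    and AB: "A \<in> {0..1}" "B \<in> {0..1}" and w: "0 < w" "w \<le> a" "w \<le> b"
    and S: "indep_vars (\<lambda>_. borel) S I" and D: "\<And>k. k \<in> I \<Longrightarrow> distr M borel (S k) = D"
    and nonneg: "AE s in D. 0 \<le> s"
    and ind: "indep_var (Pi\<^sub>M I (\<lambda>_. borel)) (\<lambda>\<omega>. \<lambda>k\<in>I. S k \<omega>) (Pi\<^sub>M I (\<lambda>_. borel)) (\<lambda>\<omega>. \<lambda>k\<in>I. X k \<omega>)"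
  shows "\<bar>expectation (\<lambda>\<omega>. \<Prod>k\<in>I. two_sided_step A B a b (S k \<omega> * X k \<omega>)) -
      (1 - A * mixture_tail D a - B * mixture_tail D b) ^ card I\<bar> \<le>
    2 * (\<Sum>i\<in>I. \<Sum>j\<in>I-{i}. \<bar>r i j\<bar> * (pair_const \<bar>r i j\<bar> * (mean_decay D \<bar>r i j\<bar> w)\<^sup>2))"
proof -
  let ?PI = "Pi\<^sub>M I (\<lambda>_. D)"
  let ?B = "Pi\<^sub>M I (\<lambda>_. borel :: real measure)" and ?N = std_normal_distribution
  let ?S = "\<lambda>\<omega>. \<lambda>k\<in>I. S k \<omega>" and ?X = "\<lambda>\<omega>. \<lambda>k\<in>I. X k \<omega>"
  let ?h = "two_sided_step A B a b"
  obtain k0 where k0: "k0 \<in> I" using I(2) by blast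
  have Sm[measurable]: "S k \<in> borel_measurable M" if "k \<in> I" for k
    using S that by (auto simp: indep_vars_def)
  have Xm[measurable]: "X k \<in> borel_measurable M" if "k \<in> I" for k
    using gM that by (auto simp: gaussian_family_def)
  have D_prob: "prob_space D" using prob_space_distr[OF Sm[OF k0]] D[OF k0] by simp
  have D_sets: "sets D = sets borel" using D[OF k0] by (metis sets_distr)
  interpret D: prob_space D by fact
  interpret DI: product_prob_space "\<lambda>_. D" I by unfold_locales
  interpret N: prob_space ?N by (rule prob_space_std_normal)
  have PS: "distr M ?B ?S = ?PI"
  proof -
    have "distr M ?B ?S = Pi\<^sub>M I (\<lambda>k. distr M borel (S k))"
      using indep_vars_iff_distr_eq_PiM'[OF I(2), where M' = "\<lambda>_. borel" and X = S] S Sm by blast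
    also have "\<dots> = ?PI" by (rule PiM_cong) (auto simp: D)
    finally show ?thesis .
  qed
  have sets_DI: "sets ?PI = sets ?B" by (intro sets_PiM_cong D_sets refl)
  define PX where "PX = distr M ?B ?X"
  have Xm'[measurable]: "?X \<in> measurable M ?B" and Sm'[measurable]: "?S \<in> measurable M ?B"
    by (auto intro!: measurable_restrict)
  interpret PX: prob_space PX unfolding PX_def by (rule prob_space_distr) measurable
  interpret PP: pair_prob_space "?PI" PX ..
  \<comment> \<open>The Gaussian vector is moved to its law on the product space, so that the pair
    of scales and vector lives on a product measure.\<close>
  have gX: "gaussian_family PX (\<lambda>k x. x k) I (\<lambda>i j. if i = j then 1 else r i j)"
    unfolding gaussian_family_def
  proof (intro conjI ballI allI)
    show "prob_space PX" by (rule PX.prob_space_axioms)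
    show "(\<lambda>x. x i) \<in> borel_measurable PX" if "i \<in> I" for i unfolding PX_def using that by simp
    fix c :: "'i \<Rightarrow> real"
    have "(LINT x|PX. cis (\<Sum>i\<in>I. c i * x i)) = (LINT \<omega>|M. cis (\<Sum>i\<in>I. c i * X i \<omega>))"
      unfolding PX_def by (subst integral_distr) auto
    then show "(LINT x|PX. cis (\<Sum>i\<in>I. c i * x i)) =
        of_real (exp (- (\<Sum>i\<in>I. \<Sum>j\<in>I. c i * c j * (if i = j then 1 else r i j)) / 2))"
      using gM by (simp add: gaussian_family_def)
  qed
  define m where "m s = (LINT z|?N. ?h (s * z))" for s
  have mm[measurable]: "m \<in> borel_measurable borel"
    unfolding m_def[abs_def] by (intro N.borel_measurable_lebesgue_integral) measurable
  have mb: "\<bar>m s\<bar> \<le> 1" for s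
  proof -
    have i: "integrable ?N (\<lambda>z. ?h (s * z))"
      using two_sided_step_bound[OF AB] by (intro N.integrable_const_bound[of _ 1]) auto
    have "\<bar>m s\<bar> \<le> (LINT z|?N. 1)"
      unfolding m_def using i two_sided_step_bound[OF AB]
      by (intro order_trans[OF integral_abs_bound integral_mono]) auto
    then show ?thesis by (simp add: N.prob_space)
  qed
  have m_int: "(LINT s|D. m s) = 1 - A * mixture_tail D a - B * mixture_tail D b"
    unfolding m_def using w by (intro integral_two_sided_step D_prob D_sets) auto
  have prod_bound: "\<bar>\<Prod>k\<in>I. f k\<bar> \<le> 1" if "\<And>k. \<bar>f k\<bar> \<le> 1" for f :: "'i \<Rightarrow> real"
    unfolding abs_prod using that by (intro prod_le_1) auto
  have comp[measurable]: "(\<lambda>x. x k) \<in> borel_measurable ?PI" "(\<lambda>x. x k) \<in> borel_measurable PX" if "k \<in> I" for k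
    using that unfolding PX_def by (simp_all add: measurable_cong_sets[OF sets_DI refl])
  have "expectation (\<lambda>\<omega>. \<Prod>k\<in>I. ?h (S k \<omega> * X k \<omega>)) =
    (LINT p|(distr M (?B \<Otimes>\<^sub>M ?B) (\<lambda>\<omega>. (?S \<omega>, ?X \<omega>))). (\<Prod>k\<in>I. ?h (fst p k * snd p k)))"
    by (subst integral_distr) auto
  also have "distr M (?B \<Otimes>\<^sub>M ?B) (\<lambda>\<omega>. (?S \<omega>, ?X \<omega>)) = ?PI \<Otimes>\<^sub>M PX"
    using ind unfolding indep_var_distribution_eq PS PX_def by simp
  also have "(LINT p|(?PI \<Otimes>\<^sub>M PX). (\<Prod>k\<in>I. ?h (fst p k * snd p k))) =
     (LINT s|?PI. (LINT x|PX. (\<Prod>k\<in>I. ?h (s k * x k))))"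
  proof -
    have "integrable (?PI \<Otimes>\<^sub>M PX) (\<lambda>p. (\<Prod>k\<in>I. ?h (fst p k * snd p k)))"
      using two_sided_step_bound[OF AB] prod_bound by (intro PP.integrable_const_bound[of _ 1]) auto
    from PP.integral_fst'[OF this] show ?thesis by simp
  qed
  finally have E1: "expectation (\<lambda>\<omega>. \<Prod>k\<in>I. ?h (S k \<omega> * X k \<omega>)) =
     (LINT s|?PI. (LINT x|PX. (\<Prod>k\<in>I. ?h (s k * x k))))" .
  have prodint: "(LINT s|?PI. (\<Prod>k\<in>I. g k (s k))) = (\<Prod>k\<in>I. LINT s|D. g k s)"
    if "\<And>k. g k \<in> borel_measurable borel" "\<And>k s. \<bar>g k s\<bar> \<le> 1" for g :: "'i \<Rightarrow> real \<Rightarrow> real"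
    using that by (intro DI.product_integral_prod I D.integrable_const_bound[of _ 1])
      (auto simp: measurable_cong_sets[OF D_sets refl])
  have E2: "(1 - A * mixture_tail D a - B * mixture_tail D b) ^ card I = (LINT s|?PI. (\<Prod>k\<in>I. m (s k)))"
    using prodint[of "\<lambda>_. m"] mm mb m_int by simp
  have pp: "(LINT s|?PI. gauss_decay \<rho> w (s i) * gauss_decay \<rho> w (s j)) = (mean_decay D \<rho> w)\<^sup>2"
    if ij: "i \<in> I" "j \<in> I - {i}" and \<rho>: "\<rho> \<ge> 0" for i j \<rho>
  proof -
    define g where "g k = (if k = i \<or> k = j then gauss_decay \<rho> w else (\<lambda>_. 1))" for k
    have "(\<Prod>k\<in>I. f k) = f i * f j" if "\<And>k. k \<noteq> i \<Longrightarrow> k \<noteq> j \<Longrightarrow> f k = 1" for f :: "'i \<Rightarrow> real"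
    proof -
      have "(\<Prod>k\<in>I. f k) = (\<Prod>k\<in>{i,j}. f k)"
        using ij I that by (intro prod.mono_neutral_right) auto
      moreover have "i \<noteq> j" using ij by auto
      ultimately show ?thesis by simp
    qed note two = this
    have "(LINT s|?PI. gauss_decay \<rho> w (s i) * gauss_decay \<rho> w (s j)) =
       (LINT s|?PI. (\<Prod>k\<in>I. g k (s k)))"
      by (subst two) (auto simp: g_def)
    also have "\<dots> = (\<Prod>k\<in>I. LINT s|D. g k s)"
      using gauss_decay_bounds[OF \<rho>] by (intro prodint) (auto simp: g_def)
    also have "\<dots> = (mean_decay D \<rho> w)\<^sup>2"
      by (subst two) (auto simp: g_def mean_decay_def D.prob_space power2_eq_square)
    finally show ?thesis .
  qed
  define Bd where "Bd s = 2 * (\<Sum>i\<in>I. \<Sum>j\<in>I-{i}. \<bar>r i j\<bar> * (pair_const \<bar>r i j\<bar> *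
      (gauss_decay \<bar>r i j\<bar> w (s i) * gauss_decay \<bar>r i j\<bar> w (s j))))" for s
  have gint: "integrable ?PI (\<lambda>s. gauss_decay \<rho> w (s i) * gauss_decay \<rho> w (s j))"
    if ij: "i \<in> I" "j \<in> I" and \<rho>: "\<rho> \<ge> 0" for i j \<rho>
    using gauss_decay_bounds[OF \<rho>] ij
    by (intro DI.integrable_const_bound[of _ 1]) (auto simp: abs_mult intro!: mult_le_one)
  have Bd_int: "integrable ?PI Bd"
    unfolding Bd_def[abs_def]
    by (intro integrable_mult_right Bochner_Integration.integrable_sum gint) auto
  have "\<bar>(LINT s|?PI. (LINT x|PX. (\<Prod>k\<in>I. ?h (s k * x k)))) - (LINT s|?PI. (\<Prod>k\<in>I. m (s k)))\<bar>
      \<le> (LINT s|?PI. Bd s)"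
  proof -
    have i1: "integrable ?PI (\<lambda>s. LINT x|PX. (\<Prod>k\<in>I. ?h (s k * x k)))"
    proof (rule DI.integrable_const_bound[of _ 1])
      have b: "\<bar>LINT x|PX. (\<Prod>k\<in>I. ?h (s k * x k))\<bar> \<le> 1" for s
      proof -
        have i: "integrable PX (\<lambda>x. (\<Prod>k\<in>I. ?h (s k * x k)))"
          using two_sided_step_bound[OF AB] prod_bound by (intro PX.integrable_const_bound[of _ 1]) auto
        have "\<bar>LINT x|PX. (\<Prod>k\<in>I. ?h (s k * x k))\<bar> \<le> (LINT x|PX. 1)"
          using i two_sided_step_bound[OF AB] prod_bound
          by (intro order_trans[OF integral_abs_bound integral_mono]) auto
        then show ?thesis by (simp add: PX.prob_space)
      qed
      then show "AE s in ?PI. norm (LINT x|PX. (\<Prod>k\<in>I. ?h (s k * x k))) \<le> 1" by simp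
      show "(\<lambda>s. LINT x|PX. (\<Prod>k\<in>I. ?h (s k * x k))) \<in> borel_measurable ?PI"
        by (intro PX.borel_measurable_lebesgue_integral) measurable
    qed
    have i2: "integrable ?PI (\<lambda>s. (\<Prod>k\<in>I. m (s k)))"
      using mb prod_bound by (intro DI.integrable_const_bound[of _ 1]) auto
    have ae: "AE s in ?PI. \<forall>k\<in>I. 0 \<le> s k"
      using AE_PiM_component[of I "\<lambda>_. D" _ "\<lambda>s. 0 \<le> s"] D_prob nonneg I by (auto intro!: AE_finite_allI)
    have "\<bar>(LINT s|?PI. (LINT x|PX. (\<Prod>k\<in>I. ?h (s k * x k)))) - (LINT s|?PI. (\<Prod>k\<in>I. m (s k)))\<bar>
      = \<bar>LINT s|?PI. (LINT x|PX. (\<Prod>k\<in>I. ?h (s k * x k))) - (\<Prod>k\<in>I. m (s k))\<bar>"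
      using i1 i2 by simp
    also have "\<dots> \<le> (LINT s|?PI. \<bar>(LINT x|PX. (\<Prod>k\<in>I. ?h (s k * x k))) - (\<Prod>k\<in>I. m (s k))\<bar>)"
      by (rule integral_abs_bound)
    also have "\<dots> \<le> (LINT s|?PI. Bd s)"
    proof (rule integral_mono_AE[OF _ Bd_int])
      show "AE s in ?PI. \<bar>(LINT x|PX. (\<Prod>k\<in>I. ?h (s k * x k))) - (\<Prod>k\<in>I. m (s k))\<bar> \<le> Bd s"
        using ae
      proof eventually_elim
        case (elim s)
        show ?case unfolding Bd_def m_def
          by (rule gaussian_comparison_scaled_step[OF I(1) gX r AB w]) (use elim in auto)
      qed
    qed (use i1 i2 in auto)
    finally show ?thesis .
  qed
  also have "(LINT s|?PI. Bd s) =
     2 * (\<Sum>i\<in>I. \<Sum>j\<in>I-{i}. \<bar>r i j\<bar> * (pair_const \<bar>r i j\<bar> * (mean_decay D \<bar>r i j\<bar> w)\<^sup>2))"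
  proof -
    let ?g = "\<lambda>i j s. \<bar>r i j\<bar> * (pair_const \<bar>r i j\<bar> * (gauss_decay \<bar>r i j\<bar> w (s i) * gauss_decay \<bar>r i j\<bar> w (s j)))"
    have gi: "integrable ?PI (?g i j)" if "i \<in> I" "j \<in> I - {i}" for i j
      using that by (intro integrable_mult_right gint) auto
    have "(LINT s|?PI. Bd s) = 2 * (\<Sum>i\<in>I. LINT s|?PI. (\<Sum>j\<in>I-{i}. ?g i j s))"
      unfolding Bd_def integral_mult_right_zero
      by (subst Bochner_Integration.integral_sum) (auto intro!: Bochner_Integration.integrable_sum gi)
    also have "\<dots> = 2 * (\<Sum>i\<in>I. \<Sum>j\<in>I-{i}. LINT s|?PI. ?g i j s)"
      by (intro arg_cong[of _ _ "(*) 2"] sum.cong refl Bochner_Integration.integral_sum gi)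
    also have "\<dots> = 2 * (\<Sum>i\<in>I. \<Sum>j\<in>I-{i}. \<bar>r i j\<bar> * (pair_const \<bar>r i j\<bar> * (mean_decay D \<bar>r i j\<bar> w)\<^sup>2))"
      unfolding integral_mult_right_zero
      by (intro arg_cong[of _ _ "(*) 2"] sum.cong refl arg_cong2[of _ _ _ _ "(*)"] pp) auto
    finally show ?thesis .
  qed
  finally show ?thesis unfolding E1 E2 .
qed

section \<open>Summing the comparison bound\<close>

lemma pair_const_mono: "0 \<le> \<rho> \<Longrightarrow> \<rho> \<le> R \<Longrightarrow> R < 1 \<Longrightarrow> pair_const \<rho> \<le> pair_const R"
  unfolding pair_const_def
  by (intro divide_left_mono mult_left_mono mult_pos_pos real_sqrt_le_mono diff_left_mono power_mono)
    (auto simp: abs_square_less_1)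

text \<open>Pairs at distance less than \<open>n powr \<eta>\<close> are few, and \<open>mean_decay_interpolate\<close> gives them a power of \<open>n\<close>
  better than \<open>1 / n\<close>; at larger distances \<open>\<bar>\<rho>\<bar> ln n\<close> is small and the full bound \<open>ln n / n\<^sup>2\<close> is available.\<close>

lemma decay_sum_tendsto_0:
  fixes \<rho> w :: "nat \<Rightarrow> real"
  assumes D: "prob_space D" "sets D = sets borel" and nonneg: "AE s in D. 0 \<le> s"
    and lim: "(\<lambda>n. \<rho> n * ln (real n)) \<longlonglongrightarrow> 0" and less_1: "\<And>n. n \<ge> 1 \<Longrightarrow> \<bar>\<rho> n\<bar> < 1" and \<rho>0: "\<rho> \<longlonglongrightarrow> 0"
    and w: "\<forall>\<^sub>F n in sequentially. w n > 0"
    and tail: "\<forall>\<^sub>F n in sequentially. real n * mixture_tail D (w n) \<le> c"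
  shows "(\<lambda>n. \<Sum>i\<in>{1..n}. \<Sum>j\<in>{1..n}-{i}. \<bar>\<rho> (max i j - min i j)\<bar> *
    (pair_const \<bar>\<rho> (max i j - min i j)\<bar> * (mean_decay D \<bar>\<rho> (max i j - min i j)\<bar> (w n))\<^sup>2)) \<longlonglongrightarrow> 0"
    (is "?T \<longlonglongrightarrow> 0")
proof -
  have "\<forall>\<^sub>F n in sequentially. \<bar>\<rho> n\<bar> < 1/2"
    using tendstoD[OF \<rho>0, of "1/2"] by (simp add: dist_real_def)
  then obtain d0 where d0: "\<And>n. n \<ge> d0 \<Longrightarrow> \<bar>\<rho> n\<bar> < 1/2" by (auto simp: eventually_sequentially)
  \<comment> \<open>A bound below 1 for the correlations at all positive lags: all but finitely many
    are below 1/2, and each of the others is below 1.\<close>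
  define R where "R = Max (insert (1/2) ((\<lambda>d. \<bar>\<rho> d\<bar>) ` {1..<d0}))"
  have R1: "R < 1" unfolding R_def using less_1 by (subst Max_less_iff) auto
  have R0: "1/2 \<le> R" unfolding R_def by (intro Max_ge) auto
  have R: "\<bar>\<rho> d\<bar> \<le> R" if "d \<ge> 1" for d
  proof (cases "d < d0")
    case True
    then show ?thesis unfolding R_def using that by (intro Max_ge) auto
  next
    case False
    then show ?thesis using d0[of d] R0 by simp
  qed
  define K where "K = pair_const R"
  have K: "K \<ge> 0" unfolding K_def using R0 R1 by (intro pair_const_nonneg) auto
  \<comment> \<open>About \<open>n powr (1 + \<eta>)\<close> near pairs, each of order
    \<open>n powr (- 2 * \<beta>)\<close> up to a logarithm, total
    \<open>n powr (- \<gamma>)\<close>. \<open>R < 1\<close> gives \<open>2 * \<beta> > 1\<close>,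
    and \<open>\<eta>\<close> spends half of that margin.\<close>
  define \<beta> where "\<beta> = 1 / (1 + R)"
  define \<eta> where "\<eta> = (2 * \<beta> - 1) / 2"
  define \<gamma> where "\<gamma> = 2 * \<beta> - 1 - \<eta>"
  have "2 * \<beta> > 1" using R0 R1 by (simp add: \<beta>_def field_simps)
  then have \<eta>: "\<eta> > 0" and \<gamma>: "\<gamma> > 0" by (auto simp: \<eta>_def \<gamma>_def)
  define c' where "c' = max c 0"
  \<comment> \<open>Chosen to give \<open>mean_decay D x (w n) \<le> Z * sqrt (ln n) / n\<close>
    whenever \<open>x * ln n \<le> 1\<close>: \<open>exp 4\<close> bounds the exponent correction,
    \<open>1 + sqrt 8\<close> the Mills factor, and the last 1 absorbs the remainder
    \<open>1 / n^2\<close>.\<close>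
  define Z where "Z = mills_const * exp 4 * (1 + sqrt 8) * c' + 1"
  have mc: "mills_const \<ge> 0" by (simp add: mills_const_def)
  have Z: "Z \<ge> 1" using mc by (simp add: Z_def c'_def)
  have bound: "\<forall>\<^sub>F n in sequentially. norm (?T n) \<le> 3 * K * (1 + Z)\<^sup>2 * (real n powr (- \<gamma>) * ln (real n)) + \<epsilon> * K * Z\<^sup>2"
    if \<epsilon>: "0 < \<epsilon>" "\<epsilon> \<le> 1" for \<epsilon>
  proof -
    \<comment> \<open>A lag \<open>d \<ge> n powr \<eta>\<close> satisfies
      \<open>ln d \<ge> \<eta> * ln n\<close>, so the extra factor \<open>\<eta>\<close> turns this
      into \<open>\<bar>\<rho> d\<bar> * ln n \<le> \<epsilon>\<close>.\<close>
    have "\<forall>\<^sub>F d in sequentially. \<bar>\<rho> d * ln (real d)\<bar> < \<epsilon> * \<eta>"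
      using tendstoD[OF lim, of "\<epsilon> * \<eta>"] \<epsilon> \<eta> by (simp add: dist_real_def)
    then obtain d1 where d1: "\<And>d. d \<ge> d1 \<Longrightarrow> \<bar>\<rho> d * ln (real d)\<bar> < \<epsilon> * \<eta>" by (auto simp: eventually_sequentially)
    have "filterlim (\<lambda>n. real n powr \<eta>) at_top sequentially"
      using \<eta> by real_asymp
    then have "\<forall>\<^sub>F n in sequentially. real n powr \<eta> \<ge> real d1"
      by (simp add: filterlim_at_top)
    \<comment> \<open>Ensures \<open>ln n \<ge> 1\<close>, so that constants can be absorbed into
      \<open>sqrt (ln n)\<close>.\<close>
    moreover have "\<forall>\<^sub>F n in sequentially. n \<ge> 3" by (rule eventually_ge_at_top)
    ultimately show ?thesis using w tail
    proof eventually_elim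
      case (elim n)
      define l where "l = ln (real n)"
      have "exp 1 \<le> (3::real)" by (rule exp_le)
      also have "\<dots> \<le> real n" using elim(2) by simp
      finally have "exp 1 \<le> real n" .
      then have l1: "l \<ge> 1" unfolding l_def using elim(2) by (subst ln_ge_iff) auto
      then have sl: "sqrt l \<ge> 1" by simp
      have n: "real n \<ge> 2" "real n \<ge> 1" "real n > 0" using elim(2) by auto
      have tail': "real n * mixture_tail D (w n) \<le> c'" using elim(4) by (simp add: c'_def)
      have G: "mean_decay D x (w n) \<le> Z * sqrt l / n" if x: "0 \<le> x" "x \<le> 1" "x * l \<le> 1" for x
      proof -
        have "mean_decay D x (w n) \<le> mills_const * exp (4 * x * l) * (1 + sqrt (8 * l)) * mixture_tail D (w n) + 1 / (real n)\<^sup>2"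
          unfolding l_def by (rule mean_decay_le_tail[OF D nonneg elim(3) n(1) x(1,2)])
        also have "\<dots> \<le> mills_const * exp 4 * ((1 + sqrt 8) * sqrt l) * (c' / n) + sqrt l / n"
        proof (intro add_mono mult_mono)
          show "exp (4 * x * l) \<le> exp 4" using x by simp
          show "1 + sqrt (8 * l) \<le> (1 + sqrt 8) * sqrt l" using sl by (simp add: real_sqrt_mult algebra_simps)
          show "mixture_tail D (w n) \<le> c' / n" using tail' n by (simp add: field_simps)
          have "1 / (real n)\<^sup>2 \<le> 1 / n" using n by (intro divide_left_mono) (auto simp: power2_eq_square)
          also have "\<dots> \<le> sqrt l / n" using sl n by (intro divide_right_mono) auto
          finally show "1 / (real n)\<^sup>2 \<le> sqrt l / n" .
        qed (use mc l1 in \<open>auto intro!: mult_nonneg_nonneg mixture_tail_nonneg[OF D nonneg]\<close>)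
        also have "\<dots> = Z * sqrt l / n" using n by (simp add: Z_def field_simps)
        finally show ?thesis .
      qed
      have G0: "mean_decay D R (w n) \<le> real n powr (- \<beta>) * ((1 + Z) * sqrt l)"
      proof -
        have "mean_decay D R (w n) \<le> real n powr (- \<beta>) * (1 + real n * mean_decay D 0 (w n))"
          unfolding \<beta>_def using R0 by (intro mean_decay_interpolate[OF D nonneg] n) auto
        also have "\<dots> \<le> real n powr (- \<beta>) * ((1 + Z) * sqrt l)"
        proof (intro mult_left_mono)
          have "real n * mean_decay D 0 (w n) \<le> Z * sqrt l"
            using G[of 0] n by (simp add: field_simps)
          then show "1 + real n * mean_decay D 0 (w n) \<le> (1 + Z) * sqrt l"
            using sl unfolding distrib_right by linarith
        qed auto
        finally show ?thesis .
      qed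
      \<comment> \<open>Bounds for a single pair. In \<open>far\<close> the square of
        \<open>sqrt l\<close> cancels the \<open>1 / l\<close> coming from
        \<open>\<bar>\<rho>\<bar> \<le> \<epsilon> / l\<close>, so that \<open>n^2\<close> far pairs
        add up to \<open>\<epsilon> * K * Z^2\<close>, independent of \<open>n\<close>.\<close>
      define near where "near = K * (real n powr (- \<beta>) * ((1 + Z) * sqrt l))\<^sup>2"
      define far where "far = (\<epsilon> / l) * (K * (Z * sqrt l / n)\<^sup>2)"
      have near0: "near \<ge> 0" "far \<ge> 0" using K \<epsilon> l1 by (auto simp: near_def far_def)
      define t where "t d = \<bar>\<rho> d\<bar> * (pair_const \<bar>\<rho> d\<bar> * (mean_decay D \<bar>\<rho> d\<bar> (w n))\<^sup>2)" for d
      have t0: "0 \<le> t d" if "d \<ge> 1" for d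
        using less_1[OF that] by (auto simp: t_def intro!: mult_nonneg_nonneg pair_const_nonneg)
      have pK: "pair_const \<bar>\<rho> d\<bar> \<le> K" "0 \<le> pair_const \<bar>\<rho> d\<bar>" if "d \<ge> 1" for d
        unfolding K_def using R[OF that] R1 by (auto intro!: pair_const_mono pair_const_nonneg)
      have t_near: "t d \<le> near" if d: "d \<ge> 1" for d
      proof -
        have "mean_decay D \<bar>\<rho> d\<bar> (w n) \<le> real n powr (- \<beta>) * ((1 + Z) * sqrt l)"
          by (rule order_trans[OF mean_decay_mono[OF D nonneg] G0]) (use R[OF d] in auto)
        then have "t d \<le> 1 * near"
          unfolding t_def near_def using pK[OF d] less_1[OF d] K
          by (intro mult_mono power_mono) (auto intro!: mean_decay_nonneg[OF D nonneg] mult_nonneg_nonneg)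
        then show ?thesis by simp
      qed
      have t_far: "t d \<le> far" if d: "d \<ge> 1" "real d \<ge> real n powr \<eta>" for d
      proof -
        have "d \<ge> d1" using d elim(1) by linarith
        then have "\<bar>\<rho> d\<bar> * ln (real d) < \<epsilon> * \<eta>" using d1[of d] d(1) by (simp add: abs_mult)
        moreover have "\<eta> * l \<le> ln (real d)"
        proof -
          have "\<eta> * l = ln (real n powr \<eta>)" using n by (simp add: l_def ln_powr)
          also have "\<dots> \<le> ln (real d)" using d n by (subst ln_le_cancel_iff) auto
          finally show ?thesis .
        qed
        then have "\<bar>\<rho> d\<bar> * (\<eta> * l) \<le> \<bar>\<rho> d\<bar> * ln (real d)" by (intro mult_left_mono) auto
        ultimately have "\<eta> * (\<bar>\<rho> d\<bar> * l) \<le> \<eta> * \<epsilon>" by (simp add: mult_ac)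
        then have rl: "\<bar>\<rho> d\<bar> * l \<le> \<epsilon>" using \<eta> by (simp add: mult_le_cancel_left_pos)
        have "mean_decay D \<bar>\<rho> d\<bar> (w n) \<le> Z * sqrt l / n"
          using rl \<epsilon> less_1[OF d(1)] by (intro G) auto
        moreover have "\<bar>\<rho> d\<bar> \<le> \<epsilon> / l" using rl l1 by (simp add: field_simps)
        ultimately show ?thesis
          unfolding t_def far_def using pK[OF d(1)] K \<epsilon> l1
          by (intro mult_mono power_mono) (auto intro!: mean_decay_nonneg[OF D nonneg] mult_nonneg_nonneg)
      qed
      define m where "m = nat \<lfloor>real n powr \<eta>\<rfloor>"
      \<comment> \<open>For fixed \<open>i\<close>, at most
        \<open>2 * m + 1 \<le> 3 * n powr \<eta>\<close> indices are closer than
        \<open>n powr \<eta>\<close>; truncation of \<open>i - m\<close> at 0 only shortens this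
        window.\<close>
      have row: "(\<Sum>j\<in>{1..n}-{i}. t (max i j - min i j)) \<le> 3 * real n powr \<eta> * near + n * far" if i: "i \<in> {1..n}" for i
      proof -
        define A where "A = {j\<in>{1..n}-{i}. real (max i j - min i j) < real n powr \<eta>}"
        define B where "B = {j\<in>{1..n}-{i}. real (max i j - min i j) \<ge> real n powr \<eta>}"
        have AB: "{1..n}-{i} = A \<union> B" "A \<inter> B = {}" "finite A" "finite B" by (auto simp: A_def B_def)
        have pos: "max i j - min i j \<ge> 1" if "j \<noteq> i" for j using that by (cases i j rule: linorder_cases) auto
        have "A \<subseteq> {i - m..i + m}"
        proof
          fix j assume "j \<in> A"
          then have "real (max i j - min i j) < real n powr \<eta>" by (simp add: A_def)
          then have "int (max i j - min i j) \<le> \<lfloor>real n powr \<eta>\<rfloor>" by (simp add: le_floor_iff)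
          then have "max i j - min i j \<le> m" unfolding m_def by linarith
          then show "j \<in> {i - m..i + m}" by (auto simp: max_def min_def split: if_splits)
        qed
        then have "card A \<le> card {i - m..i + m}" by (intro card_mono) auto
        also have "\<dots> \<le> 2 * m + 1" by simp
        finally have "real (card A) \<le> 2 * real m + 1" by linarith
        also have "real m \<le> real n powr \<eta>" unfolding m_def by simp
        also have "1 \<le> real n powr \<eta>" using n \<eta> by (simp add: ge_one_powr_ge_zero)
        finally have cA: "real (card A) \<le> 3 * real n powr \<eta>" by simp
        have "card B \<le> card {1..n}" by (rule card_mono) (auto simp: B_def)
        then have cB: "real (card B) \<le> n" by simp
        have "(\<Sum>j\<in>{1..n}-{i}. t (max i j - min i j)) = (\<Sum>j\<in>A. t (max i j - min i j)) + (\<Sum>j\<in>B. t (max i j - min i j))"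
          unfolding AB(1) using AB by (intro sum.union_disjoint) auto
        also have "\<dots> \<le> real (card A) * near + real (card B) * far"
          using pos by (intro add_mono sum_bounded_above t_near t_far) (auto simp: A_def B_def)
        also have "\<dots> \<le> 3 * real n powr \<eta> * near + n * far"
          using cA cB near0 by (intro add_mono mult_right_mono) auto
        finally show ?thesis .
      qed
      have T: "?T n = (\<Sum>i\<in>{1..n}. \<Sum>j\<in>{1..n}-{i}. t (max i j - min i j))" by (simp add: t_def)
      have "?T n \<ge> 0"
        unfolding T by (intro sum_nonneg t0) (auto simp: max_def min_def)
      moreover have "?T n \<le> (\<Sum>i\<in>{1..n}. 3 * real n powr \<eta> * near + n * far)"
        unfolding T by (intro sum_mono row)
      moreover have "\<dots> = 3 * K * (1 + Z)\<^sup>2 * (real n powr (- \<gamma>) * ln (real n)) + \<epsilon> * K * Z\<^sup>2"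
      proof -
        have "(sqrt l)\<^sup>2 = l" using l1 by simp
        then have near_eq: "near = K * (1 + Z)\<^sup>2 * l * (real n powr (- \<beta>) * real n powr (- \<beta>))"
          by (simp add: near_def power_mult_distrib power2_eq_square mult_ac)
        have pw: "real n * (real n powr \<eta> * (real n powr (- \<beta>) * real n powr (- \<beta>))) = real n powr (- \<gamma>)"
        proof -
          have "real n * (real n powr \<eta> * (real n powr (- \<beta>) * real n powr (- \<beta>))) =
             real n powr (1 + (\<eta> + (- \<beta> + - \<beta>)))"
            using n by (simp only: powr_add powr_one)
          also have "1 + (\<eta> + (- \<beta> + - \<beta>)) = - \<gamma>" by (simp add: \<gamma>_def)
          finally show ?thesis .
        qed
        have "real n * (3 * real n powr \<eta> * near) =
          3 * K * (1 + Z)\<^sup>2 * (real n * (real n powr \<eta> * (real n powr (- \<beta>) * real n powr (- \<beta>))) * l)"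
          unfolding near_eq by (simp only: mult.assoc mult.commute mult.left_commute)
        then have "real n * (3 * real n powr \<eta> * near) = 3 * K * (1 + Z)\<^sup>2 * (real n powr (- \<gamma>) * l)"
          unfolding pw .
        moreover have "real n * (n * far) = \<epsilon> * K * Z\<^sup>2"
          using n l1 by (simp add: far_def power_mult_distrib power_divide power2_eq_square field_simps)
        ultimately show ?thesis by (simp add: l_def distrib_left)
      qed
      ultimately show ?case by simp
    qed
  qed
  have z: "(\<lambda>n. real n powr (- \<gamma>) * ln (real n)) \<longlonglongrightarrow> 0"
    using \<gamma> by real_asymp
  show ?thesis
  proof (rule tendstoI)
    fix e :: real assume e: "e > 0"
    \<comment> \<open>Keeps the far contribution within \<open>e / 2\<close>; the \<open>+ 1\<close>
      rules out a zero denominator.\<close>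
    define \<epsilon> where "\<epsilon> = min 1 (e / (2 * (K * Z\<^sup>2 + 1)))"
    have KZ: "0 \<le> K * Z\<^sup>2" using K by simp
    have \<epsilon>: "0 < \<epsilon>" "\<epsilon> \<le> 1" using e KZ by (auto simp: \<epsilon>_def)
    have "\<epsilon> * (K * Z\<^sup>2) \<le> e / (2 * (K * Z\<^sup>2 + 1)) * (K * Z\<^sup>2 + 1)"
      using KZ e by (intro mult_mono) (auto simp: \<epsilon>_def)
    also have "\<dots> = e / 2" using KZ by (simp add: field_simps)
    finally have \<epsilon>e: "\<epsilon> * K * Z\<^sup>2 \<le> e / 2" by (simp add: mult.assoc)
    have "(\<lambda>n. 3 * K * (1 + Z)\<^sup>2 * (real n powr (- \<gamma>) * ln (real n))) \<longlonglongrightarrow> 0"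
      by (rule tendsto_mult_right_zero[OF z])
    then have "\<forall>\<^sub>F n in sequentially. dist (3 * K * (1 + Z)\<^sup>2 * (real n powr (- \<gamma>) * ln (real n))) 0 < e / 2"
      by (rule tendstoD) (use e in simp)
    with bound[OF \<epsilon>] show "\<forall>\<^sub>F n in sequentially. dist (?T n) 0 < e"
    proof eventually_elim
      case (elim n)
      show ?case using elim \<epsilon>e unfolding dist_real_def real_norm_def diff_0_right by linarith
    qed
  qed
qed

text \<open>Compare with \<open>(1 - c / n) ^ n\<close>: for numbers of modulus at most 1, the
  difference of nth powers is at most \<open>n\<close> times the difference of the bases, here
  \<open>\<bar>n * a n - c\<bar>\<close>.\<close>

lemma power_tendsto_exp:
  fixes a :: "nat \<Rightarrow> real"
  assumes lim: "(\<lambda>n. real n * a n) \<longlonglongrightarrow> c" and a: "\<forall>\<^sub>F n in sequentially. 0 \<le> a n \<and> a n \<le> 1"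
  shows "(\<lambda>n. (1 - a n) ^ n) \<longlonglongrightarrow> exp (- c)"
proof -
  have c: "c \<ge> 0"
    by (rule tendsto_lowerbound[OF lim]) (use a in \<open>auto elim!: eventually_mono\<close>)
  have 1: "(\<lambda>n. (1 + (- c) / real n) ^ n) \<longlonglongrightarrow> exp (- c)"
    by (rule tendsto_exp_limit_sequentially)
  have "(\<lambda>n. (1 - a n) ^ n - (1 + (- c) / real n) ^ n) \<longlonglongrightarrow> 0"
  proof (rule Lim_null_comparison)
    have "\<forall>\<^sub>F n in sequentially. real n \<ge> c + 1"
      using filterlim_real_sequentially by (simp add: filterlim_at_top)
    with a show "\<forall>\<^sub>F n in sequentially. norm ((1 - a n) ^ n - (1 + (- c) / real n) ^ n) \<le> \<bar>real n * a n - c\<bar>"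
    proof eventually_elim
      case (elim n)
      have n: "real n > 0" using elim c by linarith
      have "c / n \<le> 1" using elim n by (simp add: field_simps)
      then have "norm ((1 - a n) ^ n - (1 + (- c) / real n) ^ n) \<le> n * norm ((1 - a n) - (1 + (- c) / real n))"
        using elim c n by (intro norm_power_diff) auto
      also have "\<dots> = \<bar>real n * ((1 - a n) - (1 + (- c) / real n))\<bar>"
        by (simp add: abs_mult)
      also have "real n * ((1 - a n) - (1 + (- c) / real n)) = - (real n * a n - c)"
        using n by (simp add: field_simps)
      finally show ?case by simp
    qed
    show "(\<lambda>n. \<bar>real n * a n - c\<bar>) \<longlonglongrightarrow> 0"
      using tendsto_rabs_zero[OF tendsto_diff[OF lim tendsto_const[of c], simplified]] .
  qed
  from tendsto_add[OF this 1] show ?thesis by simp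
qed

text \<open>Positive levels make the two exceedances of one index exclusive, so each factor, an
  affine combination of two indicators, is the product of a choice between \<open>s\<close> and 1
  and a choice between \<open>t\<close> and 1.\<close>

lemma prod_two_sided_step:
  assumes "finite I" "0 < a" "0 < b"
  shows "(\<Prod>k\<in>I. two_sided_step (1 - s) (1 - t) a b (y k)) = s ^ card {k\<in>I. y k > a} * t ^ card {k\<in>I. y k \<le> - b}"
proof -
  have pw: "(\<Prod>k\<in>I. if P k then s else 1) = s ^ card {k\<in>I. P k}" for P and s :: real
    using assms(1) by (simp flip: prod.inter_filter)
  have "(\<Prod>k\<in>I. two_sided_step (1 - s) (1 - t) a b (y k)) =
     (\<Prod>k\<in>I. (if y k > a then s else 1) * (if y k \<le> - b then t else 1))"
    using assms by (intro prod.cong) (auto simp: two_sided_step_def)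
  then show ?thesis by (simp add: prod.distrib pw)
qed

lemma (in prob_space) prob_scale_mixture:
  assumes ind: "indep_var borel S borel X" and X: "distr M borel X = std_normal_distribution"
  shows "prob {\<omega> \<in> space M. S \<omega> * X \<omega> > v} = mixture_tail (distr M borel S) v"
proof -
  let ?D = "distr M borel S" and ?N = std_normal_distribution
  have [measurable]: "S \<in> borel_measurable M" "X \<in> borel_measurable M"
    using ind by (auto simp: indep_var_distribution_eq)
  interpret D: prob_space ?D by (rule prob_space_distr) measurable
  interpret N: prob_space ?N by (rule prob_space_std_normal)
  interpret P: pair_prob_space ?D ?N ..
  have "prob {\<omega> \<in> space M. S \<omega> * X \<omega> > v} = expectation (indicator {\<omega> \<in> space M. S \<omega> * X \<omega> > v})"
    by simp
  also have "\<dots> = expectation (\<lambda>\<omega>. if S \<omega> * X \<omega> > v then 1 else 0)"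
    by (intro Bochner_Integration.integral_cong) (auto simp: indicator_def)
  also have "\<dots> = (LINT p|(distr M (borel \<Otimes>\<^sub>M borel) (\<lambda>\<omega>. (S \<omega>, X \<omega>))). (if fst p * snd p > v then 1 else 0))"
    by (subst integral_distr) auto
  also have "distr M (borel \<Otimes>\<^sub>M borel) (\<lambda>\<omega>. (S \<omega>, X \<omega>)) = ?D \<Otimes>\<^sub>M ?N"
    using ind X by (simp add: indep_var_distribution_eq)
  also have "(LINT p|(?D \<Otimes>\<^sub>M ?N). (if fst p * snd p > v then 1 else 0)) = mixture_tail ?D v"
  proof -
    have [measurable]: "fst \<in> borel_measurable (?D \<Otimes>\<^sub>M ?N)" "snd \<in> borel_measurable (?D \<Otimes>\<^sub>M ?N)"
      using measurable_fst[of ?D ?N] measurable_snd[of ?D ?N] by (simp_all add: measurable_std_normal)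
    have "integrable (?D \<Otimes>\<^sub>M ?N) (\<lambda>p. if fst p * snd p > v then 1 else (0::real))"
      by (intro P.integrable_const_bound[of _ 1]) auto
    from P.integral_fst'[OF this] show ?thesis by (simp add: mixture_tail_def scaled_tail_def)
  qed
  finally show ?thesis .
qed

lemma mixture_tail_antimono:
  assumes "prob_space D" "sets D = sets borel" "AE s in D. 0 \<le> s" "v \<le> v'"
  shows "mixture_tail D v' \<le> mixture_tail D v"
  unfolding mixture_tail_def
proof (rule integral_mono)
  interpret N: prob_space std_normal_distribution by (rule prob_space_std_normal)
  show "scaled_tail s v' \<le> scaled_tail s v" for s
    unfolding scaled_tail_def using assms(4)
    by (intro integral_mono N.integrable_const_bound[of _ 1]) auto
qed (use integrable_scaled_tail[OF assms(1-3)] in auto)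

text \<open>The Mills bound at level 0 shows that every positive scale contributes at least
  \<open>1 / mills_const\<close>.\<close>

lemma mixture_tail_0_pos:
  assumes D: "prob_space D" "sets D = sets borel" "AE s in D. 0 \<le> s" and pos: "measure D {0<..} > 0"
  shows "mixture_tail D 0 > 0"
proof -
  interpret D: prob_space D by fact
  have mc: "mills_const > 0" by (simp add: mills_const_def)
  have [measurable]: "{0::real<..} \<in> sets D" using D(2) by simp
  have le: "(1 / mills_const) * indicator {0<..} s \<le> scaled_tail s 0" for s
    using exp_le_scaled_tail[of s 0] scaled_tail_bounds[of s 0] mc by (auto simp: indicator_def field_simps)
  have "0 < (1 / mills_const) * measure D {0<..}" using pos mc by simp
  also have "\<dots> = (LINT s|D. (1 / mills_const) * indicator {0<..} s)"
    by simp
  also have "\<dots> \<le> mixture_tail D 0"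
    unfolding mixture_tail_def
    by (intro integral_mono le integrable_scaled_tail[OF D] integrable_mult_right integrable_real_indicator)
      (auto simp: D.emeasure_eq_measure)
  finally show ?thesis .
qed

section \<open>Convergence of the order statistics\<close>

text \<open>Otherwise the asymptotic equivalence would force \<open>g\<close> to vanish eventually.
  Then \<open>g (t * 1) / g t\<close> is eventually \<open>0 / 0 = 0\<close>, against its limit
  \<open>1 powr \<alpha> = 1\<close>.\<close>

lemma (in prob_space) regularly_varying_tail_pos:
  assumes [measurable]: "S \<in> borel_measurable M" and g: "regularly_varying g \<alpha>"
    and tail: "(\<lambda>v. prob {\<omega> \<in> space M. S \<omega> > v}) \<sim>[at_top] (\<lambda>v. g v * exp (- L * v powr p))"
  shows "prob {\<omega> \<in> space M. S \<omega> > 0} > 0"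
proof (rule ccontr)
  assume "\<not> prob {\<omega> \<in> space M. S \<omega> > 0} > 0"
  then have zero: "prob {\<omega> \<in> space M. S \<omega> > 0} = 0"
    using measure_nonneg[of M "{\<omega> \<in> space M. S \<omega> > 0}"] by linarith
  have "prob {\<omega> \<in> space M. S \<omega> > v} = 0" if "v \<ge> 0" for v
  proof -
    have "prob {\<omega> \<in> space M. S \<omega> > v} \<le> prob {\<omega> \<in> space M. S \<omega> > 0}"
      using that by (intro finite_measure_mono) auto
    then show ?thesis using zero measure_nonneg[of M "{\<omega> \<in> space M. S \<omega> > v}"] by linarith
  qed
  then have 0: "\<forall>\<^sub>F v in at_top. prob {\<omega> \<in> space M. S \<omega> > v} = 0"
    by (rule eventually_mono[OF eventually_ge_at_top[of "0::real"]])
  have "\<forall>\<^sub>F v in at_top. prob {\<omega> \<in> space M. S \<omega> > v} \<noteq> 0 \<longleftrightarrow> g v * exp (- L * v powr p) \<noteq> 0"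
    by (rule asymp_equiv_eventually_zeros[OF tail, THEN eventually_mono]) auto
  with 0 have g0: "\<forall>\<^sub>F v in at_top. g v = 0"
    by eventually_elim simp
  have "((\<lambda>t. g (t * 1) / g t) \<longlongrightarrow> 1 powr \<alpha>) at_top"
    using g unfolding regularly_varying_def by (meson zero_less_one)
  moreover have "\<forall>\<^sub>F t in at_top. g (t * 1) / g t = 0"
    using g0 by eventually_elim simp
  ultimately have "((\<lambda>t. 0) \<longlongrightarrow> (1::real)) (at_top :: real filter)"
    unfolding powr_one_eq_one by (rule Lim_transform_eventually)
  then show False by (simp add: tendsto_const_iff)
qed

text \<open>Convergence of \<open>n\<close> times the tail sends the tail itself to 0, whereas at a
  level \<open>v \<le> 0\<close> the tail is at least \<open>mixture_tail D 0\<close>.\<close>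

lemma eventually_level_pos:
  fixes v :: "nat \<Rightarrow> real"
  assumes D: "prob_space D" "sets D = sets borel" "AE s in D. 0 \<le> s" and pos: "mixture_tail D 0 > 0"
    and lim: "(\<lambda>n. real n * mixture_tail D (v n)) \<longlonglongrightarrow> c"
  shows "\<forall>\<^sub>F n in sequentially. v n > 0"
proof -
  have "(\<lambda>n. (real n * mixture_tail D (v n)) * inverse (real n)) \<longlonglongrightarrow> c * 0"
    by (intro tendsto_mult lim tendsto_inverse_0_at_top filterlim_real_sequentially)
  moreover have "\<forall>\<^sub>F n in sequentially. (real n * mixture_tail D (v n)) * inverse (real n) = mixture_tail D (v n)"
    using eventually_gt_at_top[of 0] by eventually_elim simp
  ultimately have "(\<lambda>n. mixture_tail D (v n)) \<longlonglongrightarrow> 0"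
    unfolding mult_zero_right by (rule Lim_transform_eventually)
  then have "\<forall>\<^sub>F n in sequentially. mixture_tail D (v n) < mixture_tail D 0"
    using pos by (rule order_tendstoD)
  then show ?thesis
    by eventually_elim (use mixture_tail_antimono[OF D] in \<open>force simp: not_less[symmetric]\<close>)
qed

lemma (in prob_space) indep_var_restrict:
  assumes ind: "indep_var (Pi\<^sub>M A (\<lambda>_. borel)) (\<lambda>\<omega>. \<lambda>k\<in>A. f k \<omega>) (Pi\<^sub>M B (\<lambda>_. borel)) (\<lambda>\<omega>. \<lambda>k\<in>B. g k \<omega>)"
    and "I \<subseteq> A" "J \<subseteq> B"
  shows "indep_var (Pi\<^sub>M I (\<lambda>_. borel)) (\<lambda>\<omega>. \<lambda>k\<in>I. f k \<omega>) (Pi\<^sub>M J (\<lambda>_. borel)) (\<lambda>\<omega>. \<lambda>k\<in>J. g k \<omega>)"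
proof -
  have "indep_var (Pi\<^sub>M I (\<lambda>_. borel)) ((\<lambda>x. restrict x I) \<circ> (\<lambda>\<omega>. \<lambda>k\<in>A. f k \<omega>))
      (Pi\<^sub>M J (\<lambda>_. borel)) ((\<lambda>x. restrict x J) \<circ> (\<lambda>\<omega>. \<lambda>k\<in>B. g k \<omega>))"
    by (intro indep_var_compose[OF ind] measurable_restrict_subset assms)
  moreover have "(\<lambda>x. restrict x I) \<circ> (\<lambda>\<omega>. \<lambda>k\<in>A. f k \<omega>) = (\<lambda>\<omega>. \<lambda>k\<in>I. f k \<omega>)"
    "(\<lambda>x. restrict x J) \<circ> (\<lambda>\<omega>. \<lambda>k\<in>B. g k \<omega>) = (\<lambda>\<omega>. \<lambda>k\<in>J. g k \<omega>)"
    using assms(2,3) by (auto simp: fun_eq_iff restrict_def)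
  ultimately show ?thesis by simp
qed

lemma measurable_card_filter:
  fixes f :: "nat \<Rightarrow> 'a \<Rightarrow> bool"
  assumes "\<And>k. k \<in> I \<Longrightarrow> Measurable.pred M (f k)"
  shows "(\<lambda>\<omega>. card {k\<in>I. f k \<omega>}) \<in> measurable M (count_space UNIV)"
proof (rule measurable_card)
  fix i
  show "{\<omega> \<in> space M. i \<in> {k\<in>I. f k \<omega>}} \<in> sets M"
    using assms[of i] by (cases "i \<in> I") (auto simp: pred_def)
qed

text \<open>The comparison replaces the mean by its value \<open>(1 - z n) ^ n\<close> for
  independent variables, where \<open>n * z n\<close> converges. The limit is a sum of one term for
  each side, so its exponential factorises: the upper and lower exceedance counts are asymptotically
  independent.\<close>

lemma (in prob_space) exceedance_generating_function:
  fixes S X :: "nat \<Rightarrow> 'a \<Rightarrow> real" and a b :: "nat \<Rightarrow> real"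
  assumes X: "standard_stationary_gaussian X"
    and corr: "(\<lambda>n. correlation_function X n * ln (real n)) \<longlonglongrightarrow> 0"
    and S: "indep_vars (\<lambda>_. borel) S {1..}" and D: "\<And>k. k \<ge> 1 \<Longrightarrow> distr M borel (S k) = D"
    and nonneg: "AE s in D. 0 \<le> s" and pos: "mixture_tail D 0 > 0"
    and ind: "indep_var (Pi\<^sub>M {1..} (\<lambda>_. borel)) (\<lambda>\<omega>. \<lambda>k\<in>{1..}. S k \<omega>)
      (Pi\<^sub>M {1..} (\<lambda>_. borel)) (\<lambda>\<omega>. \<lambda>k\<in>{1..}. X k \<omega>)"
    and a: "(\<lambda>n. real n * mixture_tail D (a n)) \<longlonglongrightarrow> \<kappa>"
    and b: "(\<lambda>n. real n * mixture_tail D (b n)) \<longlonglongrightarrow> \<mu>"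
    and st: "s \<in> {0..1}" "t \<in> {0..1}"
  shows "(\<lambda>n. expectation (\<lambda>\<omega>. s ^ card {k\<in>{1..n}. S k \<omega> * X k \<omega> > a n} *
      t ^ card {k\<in>{1..n}. S k \<omega> * X k \<omega> \<le> - b n})) \<longlonglongrightarrow> exp (- (1 - s) * \<kappa>) * exp (- (1 - t) * \<mu>)"
proof -
  let ?r = "\<lambda>i j :: nat. correlation_function X (max i j - min i j)"
  have Sm: "S k \<in> borel_measurable M" if "k \<ge> 1" for k
    using S that by (auto simp: indep_vars_def)
  have Dp: "prob_space D" using prob_space_distr[OF Sm[of 1]] D[of 1] by simp
  have Ds: "sets D = sets borel" using D[of 1] by (metis sets_distr order_refl)
  note DD = Dp Ds nonneg
  have corr0: "correlation_function X \<longlonglongrightarrow> 0"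
  proof (rule Lim_null_comparison)
    show "(\<lambda>n. \<bar>correlation_function X n * ln (real n)\<bar>) \<longlonglongrightarrow> 0" using corr by (rule tendsto_rabs_zero)
    show "\<forall>\<^sub>F n in sequentially. norm (correlation_function X n) \<le> \<bar>correlation_function X n * ln (real n)\<bar>"
      using eventually_ge_at_top[of 3]
    proof eventually_elim
      case (elim n)
      have "exp 1 \<le> (3::real)" by (rule exp_le)
      also have "\<dots> \<le> real n" using elim by simp
      finally have "1 \<le> ln (real n)" using elim by (subst ln_ge_iff) auto
      then show ?case by (simp add: abs_mult mult_le_cancel_left1)
    qed
  qed
  note less_1 = stationary_correlation_less_1[OF X corr0]
  \<comment> \<open>A single level below both thresholds; its tail is one of the two given tails, so
    \<open>n\<close> times it stays bounded by the sum.\<close>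
  define w where "w n = min (a n) (b n)" for n
  have apos: "\<forall>\<^sub>F n in sequentially. a n > 0" and bpos: "\<forall>\<^sub>F n in sequentially. b n > 0"
    by (rule eventually_level_pos[OF DD pos a] eventually_level_pos[OF DD pos b])+
  then have wpos: "\<forall>\<^sub>F n in sequentially. w n > 0"
    by eventually_elim (simp add: w_def)
  have wtail: "\<forall>\<^sub>F n in sequentially. real n * mixture_tail D (w n) \<le> \<kappa> + \<mu> + 1"
  proof -
    have "(\<lambda>n. real n * mixture_tail D (a n) + real n * mixture_tail D (b n)) \<longlonglongrightarrow> \<kappa> + \<mu>"
      by (intro tendsto_add a b)
    then have "\<forall>\<^sub>F n in sequentially. real n * mixture_tail D (a n) + real n * mixture_tail D (b n) < \<kappa> + \<mu> + 1"
      by (rule order_tendstoD) simp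
    then show ?thesis
    proof eventually_elim
      case (elim n)
      have "mixture_tail D (w n) \<le> mixture_tail D (a n) + mixture_tail D (b n)"
        using mixture_tail_nonneg[OF DD, of "a n"] mixture_tail_nonneg[OF DD, of "b n"] by (simp add: w_def min_def)
      then have "real n * mixture_tail D (w n) \<le> real n * (mixture_tail D (a n) + mixture_tail D (b n))"
        by (rule mult_left_mono) simp
      with elim show ?case by (simp add: distrib_left)
    qed
  qed
  define z where "z n = (1 - s) * mixture_tail D (a n) + (1 - t) * mixture_tail D (b n)" for n
  have nz: "(\<lambda>n. real n * z n) \<longlonglongrightarrow> (1 - s) * \<kappa> + (1 - t) * \<mu>"
  proof -
    have "(\<lambda>n. (1 - s) * (real n * mixture_tail D (a n)) + (1 - t) * (real n * mixture_tail D (b n)))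
        \<longlonglongrightarrow> (1 - s) * \<kappa> + (1 - t) * \<mu>"
      by (intro tendsto_intros a b)
    then show ?thesis by (simp add: z_def algebra_simps)
  qed
  have z01: "\<forall>\<^sub>F n in sequentially. 0 \<le> z n \<and> z n \<le> 1"
  proof -
    have "(\<lambda>n. (real n * z n) * inverse (real n)) \<longlonglongrightarrow> ((1 - s) * \<kappa> + (1 - t) * \<mu>) * 0"
      by (intro tendsto_mult nz tendsto_inverse_0_at_top filterlim_real_sequentially)
    then have "\<forall>\<^sub>F n in sequentially. (real n * z n) * inverse (real n) < 1"
      by (rule order_tendstoD) simp
    with eventually_gt_at_top[of 0] show ?thesis
    proof eventually_elim
      case (elim n)
      have "0 \<le> z n" using st mixture_tail_nonneg[OF DD] by (simp add: z_def)
      moreover have "(real n * z n) * inverse (real n) = z n" using elim(1) by (simp add: field_simps)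
      with elim(2) have "z n < 1" by (simp only:)
      ultimately show ?case by simp
    qed
  qed
  have pw: "(\<lambda>n. (1 - z n) ^ n) \<longlonglongrightarrow> exp (- ((1 - s) * \<kappa> + (1 - t) * \<mu>))"
    by (rule power_tendsto_exp[OF nz z01])
  define T where "T n = (\<Sum>i\<in>{1..n}. \<Sum>j\<in>{1..n}-{i}. \<bar>?r i j\<bar> * (pair_const \<bar>?r i j\<bar> * (mean_decay D \<bar>?r i j\<bar> (w n))\<^sup>2))" for n
  have T: "T \<longlonglongrightarrow> 0"
    unfolding T_def by (rule decay_sum_tendsto_0[OF DD corr less_1 corr0 wpos wtail])
  define E where "E n = expectation (\<lambda>\<omega>. s ^ card {k\<in>{1..n}. S k \<omega> * X k \<omega> > a n} *
      t ^ card {k\<in>{1..n}. S k \<omega> * X k \<omega> \<le> - b n})" for n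
  have "(\<lambda>n. E n - (1 - z n) ^ n) \<longlonglongrightarrow> 0"
  proof (rule Lim_null_comparison)
    show "(\<lambda>n. 2 * T n) \<longlonglongrightarrow> 0" using tendsto_mult_right_zero[OF T] .
    show "\<forall>\<^sub>F n in sequentially. norm (E n - (1 - z n) ^ n) \<le> 2 * T n"
      using apos bpos eventually_ge_at_top[of 1]
    proof eventually_elim
      case (elim n)
      have "E n = expectation (\<lambda>\<omega>. \<Prod>k\<in>{1..n}. two_sided_step (1 - s) (1 - t) (a n) (b n) (S k \<omega> * X k \<omega>))"
        unfolding E_def using elim by (subst prod_two_sided_step) auto
      moreover have "\<bar>expectation (\<lambda>\<omega>. \<Prod>k\<in>{1..n}. two_sided_step (1 - s) (1 - t) (a n) (b n) (S k \<omega> * X k \<omega>)) -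
        (1 - (1 - s) * mixture_tail D (a n) - (1 - t) * mixture_tail D (b n)) ^ card {1..n}\<bar> \<le> 2 * T n"
        unfolding T_def
      proof (rule scaled_gaussian_comparison)
        show "gaussian_family M X {1..n} (\<lambda>i j. if i = j then 1 else ?r i j)"
          by (rule stationary_gaussian_family[OF X])
        show "\<bar>?r i j\<bar> < 1" if "i \<in> {1..n}" "j \<in> {1..n}" "i \<noteq> j" for i j
          by (rule less_1) (use that in \<open>auto simp: max_def min_def\<close>)
        show "?r i j = ?r j i" for i j by (simp add: max.commute min.commute)
        show "indep_vars (\<lambda>_. borel) S {1..n}" by (rule indep_vars_subset[OF S]) auto
        show "indep_var (Pi\<^sub>M {1..n} (\<lambda>_. borel)) (\<lambda>\<omega>. \<lambda>k\<in>{1..n}. S k \<omega>) (Pi\<^sub>M {1..n} (\<lambda>_. borel)) (\<lambda>\<omega>. \<lambda>k\<in>{1..n}. X k \<omega>)"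
          by (rule indep_var_restrict[OF ind]) auto
      qed (use elim st D nonneg in \<open>auto simp: w_def\<close>)
      ultimately show ?case by (simp add: z_def algebra_simps)
    qed
  qed
  from tendsto_add[OF this pw] have "E \<longlonglongrightarrow> exp (- ((1 - s) * \<kappa> + (1 - t) * \<mu>))" by simp
  also have "exp (- ((1 - s) * \<kappa> + (1 - t) * \<mu>)) = exp (- (1 - s) * \<kappa>) * exp (- (1 - t) * \<mu>)"
    by (simp add: algebra_simps flip: exp_add)
  finally show ?thesis unfolding E_def .
qed

theorem corollary2p3:
  fixes M :: "'a measure"
    and X Y S :: "'a \<Rightarrow> real" and Xn Yn Sn :: "nat \<Rightarrow> 'a \<Rightarrow> real"
    and F g :: "real \<Rightarrow> real" and L p \<alpha> :: real
    and u :: "nat \<Rightarrow> real \<Rightarrow> real" and k l :: nat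
  assumes "prob_space M"
    and "prob_space.standard_stationary_gaussian M Xn"
    and "(\<lambda>n. prob_space.correlation_function M Xn n * ln (real n)) \<longlonglongrightarrow> 0"
    and "distributed M lborel X std_normal_density"
    \<comment> \<open>\<open>Sn(0 := S)\<close> is the family \<open>S, Sn 1, Sn 2, ...\<close>\<close>
    and "prob_space.indep_vars M (\<lambda>_. borel) (Sn(0 := S)) UNIV"
    and "prob_space.indep_var M
           (\<Pi>\<^sub>M n\<in>UNIV. borel) (\<lambda>\<omega>. \<lambda>n\<in>UNIV. (Sn(0 := S)) n \<omega>)
           (\<Pi>\<^sub>M n\<in>{1..}. borel) (\<lambda>\<omega>. \<lambda>n\<in>{1..}. Xn n \<omega>)"
    \<comment> \<open>\<open>X\<close> is viewed as a one-element family, since \<open>indep_var\<close> wants equal value types\<close>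
    and "prob_space.indep_var M
           (\<Pi>\<^sub>M n\<in>UNIV. borel) (\<lambda>\<omega>. \<lambda>n\<in>UNIV. (Sn(0 := S)) n \<omega>)
           (\<Pi>\<^sub>M n\<in>{0::nat}. borel) (\<lambda>\<omega>. \<lambda>n\<in>{0::nat}. X \<omega>)"
    and "AE \<omega> in M. S \<omega> \<ge> 0"
    and "\<And>n. n \<ge> 1 \<Longrightarrow> AE \<omega> in M. Sn n \<omega> \<ge> 0"
    and "cdf (distr M borel S) = F"
    and "\<And>n. n \<ge> 1 \<Longrightarrow> cdf (distr M borel (Sn n)) = F"
    and "L > 0" and "p > 0"
    and "ultimately_monotone g" and "regularly_varying g \<alpha>"
    and "(\<lambda>v. measure M {\<omega> \<in> space M. S \<omega> > v}) \<sim>[at_top] (\<lambda>v. g v * exp (- L * v powr p))"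
    and "\<And>\<omega>. Y \<omega> = S \<omega> * X \<omega>"
    and "\<And>n \<omega>. n \<ge> 1 \<Longrightarrow> Yn n \<omega> = Sn n \<omega> * Xn n \<omega>"
    and "\<And>x. (\<lambda>n. real n * measure M {\<omega> \<in> space M. Y \<omega> > u n x}) \<longlonglongrightarrow> exp (- x)"
    and "k \<ge> 1" and "l \<ge> 1"
  shows "\<forall>x y :: real.
    (\<lambda>n. measure M {\<omega> \<in> space M. kth_largest k n (\<lambda>i. Yn i \<omega>) \<le> u n x \<and>
                                  lth_smallest l n (\<lambda>i. Yn i \<omega>) > - u n y})
      \<longlonglongrightarrow> exp (- exp (- x) - exp (- y)) *
          (\<Sum>i<k. exp (- real i * x) / fact i) * (\<Sum>j<l. exp (- real j * y) / fact j)"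
proof (intro allI)
  fix x y :: real
  interpret prob_space M by fact
  let ?F = "Sn(0 := S)"
  have S_indep: "indep_vars (\<lambda>_. borel) ?F UNIV" by fact
  have Fm: "?F k \<in> borel_measurable M" for k
    using S_indep by (auto simp: indep_vars_def)
  then have Sm [measurable]: "S \<in> borel_measurable M" and Snm: "\<And>k. k \<ge> 1 \<Longrightarrow> Sn k \<in> borel_measurable M"
    by (metis fun_upd_same, metis fun_upd_other not_one_le_zero)
  define D where "D = distr M borel S"
  \<comment> \<open>The common distribution function \<open>F\<close> determines the law.\<close>
  have D: "distr M borel (Sn k) = D" if "k \<ge> 1" for k
    unfolding D_def using assms(10) assms(11)[OF that] Snm[OF that] Sm
    by (intro cdf_unique real_distribution_distr) auto
  have nonneg: "AE s in D. 0 \<le> s"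
    unfolding D_def using assms(8) by (subst AE_distr_iff) auto
  have Dp: "prob_space D" unfolding D_def by (rule prob_space_distr) measurable
  have Ds: "sets D = sets borel" by (simp add: D_def)
  have indS: "indep_vars (\<lambda>_. borel) Sn {1..}"
    using indep_vars_subset[OF S_indep, of "{1..}"] by (subst indep_vars_cong[where Y = ?F]) auto
  have indSX: "indep_var (Pi\<^sub>M {1..} (\<lambda>_. borel)) (\<lambda>\<omega>. \<lambda>k\<in>{1..}. Sn k \<omega>) (Pi\<^sub>M {1..} (\<lambda>_. borel)) (\<lambda>\<omega>. \<lambda>k\<in>{1..}. Xn k \<omega>)"
  proof -
    have "(\<lambda>\<omega>. \<lambda>k\<in>{1..}. ?F k \<omega>) = (\<lambda>\<omega>. \<lambda>k\<in>{1..}. Sn k \<omega>)" by (auto simp: fun_eq_iff restrict_def)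
    then show ?thesis using indep_var_restrict[OF assms(6), of "{1..}" "{1..}"] by simp
  qed
  \<comment> \<open>Coordinate 0 of the two families is \<open>S\<close> and \<open>X\<close>
    respectively.\<close>
  have indY: "indep_var borel S borel X"
  proof -
    have "indep_var borel ((\<lambda>f. f 0) \<circ> (\<lambda>\<omega>. \<lambda>n\<in>UNIV. ?F n \<omega>)) borel ((\<lambda>f. f 0) \<circ> (\<lambda>\<omega>. \<lambda>n\<in>{0::nat}. X \<omega>))"
      by (rule indep_var_compose[OF assms(7)]) measurable
    then show ?thesis by (simp add: o_def)
  qed
  \<comment> \<open>Translates the normalisation of the levels, stated for \<open>Y\<close>, into
    one for the scale mixture that governs each \<open>Yn i\<close>.\<close>
  have tailY: "measure M {\<omega> \<in> space M. Y \<omega> > v} = mixture_tail D v" for v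
    using prob_scale_mixture[OF indY distr_eq_std_normal[OF assms(4)], of v] by (simp add: assms(17) D_def)
  have lim: "(\<lambda>n. real n * mixture_tail D (u n x)) \<longlonglongrightarrow> exp (- x)" for x
    using assms(19)[of x] by (simp add: tailY)
  have "prob {\<omega> \<in> space M. S \<omega> > 0} > 0"
    by (rule regularly_varying_tail_pos[OF Sm assms(15,16)])
  then have "measure D {0<..} > 0"
    unfolding D_def by (subst measure_distr) (auto simp: vimage_def Int_def conj_commute)
  then have pos: "mixture_tail D 0 > 0" by (rule mixture_tail_0_pos[OF Dp Ds nonneg])
  define N where "N n \<omega> = card {i\<in>{1..n}. Sn i \<omega> * Xn i \<omega> > u n x}" for n \<omega>
  define N' where "N' n \<omega> = card {i\<in>{1..n}. Sn i \<omega> * Xn i \<omega> \<le> - u n y}" for n \<omega>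
  have Xnm: "Xn k \<in> borel_measurable M" if "k \<ge> 1" for k
    by (rule stationary_measurable[OF assms(2) that])
  have "(\<lambda>n. prob {\<omega> \<in> space M. N n \<omega> < k \<and> N' n \<omega> < l}) \<longlonglongrightarrow>
      (exp (- exp (- x)) * (\<Sum>i<k. exp (- x) ^ i / fact i)) * (exp (- exp (- y)) * (\<Sum>j<l. exp (- y) ^ j / fact j))"
  proof (rule poisson_limit_of_generating_functions)
    show "N n \<in> measurable M (count_space UNIV)" "N' n \<in> measurable M (count_space UNIV)" for n
      unfolding N_def N'_def
      by (intro measurable_card_filter; use Snm Xnm in \<open>simp; measurable\<close>)+
    show "(\<lambda>n. expectation (\<lambda>\<omega>. ((1/2) ^ m) ^ N n \<omega> * ((1/2) ^ m') ^ N' n \<omega>)) \<longlonglongrightarrow>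
      exp (- (1 - (1/2) ^ m) * exp (- x)) * exp (- (1 - (1/2) ^ m') * exp (- y))" for m m'
      unfolding N_def N'_def
      by (rule exceedance_generating_function[OF assms(2,3) indS D nonneg pos indSX lim lim])
        (auto intro: power_le_one)
  qed auto
  \<comment> \<open>The order statistics are meaningful once \<open>n \<ge> k\<close> and
    \<open>n \<ge> l\<close>; the earlier terms do not affect the limit.\<close>
  moreover have "\<forall>\<^sub>F n in sequentially. prob {\<omega> \<in> space M. N n \<omega> < k \<and> N' n \<omega> < l} =
     prob {\<omega> \<in> space M. kth_largest k n (\<lambda>i. Yn i \<omega>) \<le> u n x \<and> lth_smallest l n (\<lambda>i. Yn i \<omega>) > - u n y}"
    using eventually_ge_at_top[of k] eventually_ge_at_top[of l]
  proof eventually_elim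
    case (elim n)
    have "{i\<in>{1..n}. Yn i \<omega> > u n x} = {i\<in>{1..n}. Sn i \<omega> * Xn i \<omega> > u n x}"
      "{i\<in>{1..n}. Yn i \<omega> \<le> - u n y} = {i\<in>{1..n}. Sn i \<omega> * Xn i \<omega> \<le> - u n y}" for \<omega>
      using assms(18) by auto
    then show ?case
      unfolding kth_largest_le_iff[OF \<open>k \<ge> 1\<close> elim(1)] less_lth_smallest_iff[OF \<open>l \<ge> 1\<close> elim(2)] N_def N'_def
      by simp
  qed
  ultimately have "(\<lambda>n. prob {\<omega> \<in> space M. kth_largest k n (\<lambda>i. Yn i \<omega>) \<le> u n x \<and> lth_smallest l n (\<lambda>i. Yn i \<omega>) > - u n y})
    \<longlonglongrightarrow> (exp (- exp (- x)) * (\<Sum>i<k. exp (- x) ^ i / fact i)) * (exp (- exp (- y)) * (\<Sum>j<l. exp (- y) ^ j / fact j))"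
    by (rule Lim_transform_eventually)
  also have "(exp (- exp (- x)) * (\<Sum>i<k. exp (- x) ^ i / fact i)) * (exp (- exp (- y)) * (\<Sum>j<l. exp (- y) ^ j / fact j)) =
     exp (- exp (- x) - exp (- y)) * (\<Sum>i<k. exp (- real i * x) / fact i) * (\<Sum>j<l. exp (- real j * y) / fact j)"
  proof -
    have "exp (- x) ^ i = exp (- real i * x)" for x and i :: nat
      by (simp flip: exp_of_nat_mult)
    moreover have "exp (- exp (- x)) * exp (- exp (- y)) = exp (- exp (- x) - exp (- y))"
      by (simp flip: exp_add)
    ultimately show ?thesis by (simp add: mult_ac)
  qed
  finally show "(\<lambda>n. prob {\<omega> \<in> space M. kth_largest k n (\<lambda>i. Yn i \<omega>) \<le> u n x \<and> lth_smallest l n (\<lambda>i. Yn i \<omega>) > - u n y})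
    \<longlonglongrightarrow> exp (- exp (- x) - exp (- y)) * (\<Sum>i<k. exp (- real i * x) / fact i) * (\<Sum>j<l. exp (- real j * y) / fact j)" .
qed

end
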